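(* Let $d=1$, $\Phi(x)=-\log|x|$, and let $V(x)$ be a potential that is $C^{3}(\mathbb{R})$, symmetric ($V(x)=V(-x)$), strictly convex, and satisfies $\liminf_{|x|\to\infty}\frac{V(x)}{\log|x|}>1$. For $R>0$ consider the constrained minimisation problem $$\mathcal{E}[\rho_R]=\inf_{\rho\in\mathcal{P}([-R,R])}\mathcal{E}[\rho],\qquad \mathcal{E}[\rho]=-\frac{1}{2}\iint_{\mathbb{R}\times\mathbb{R}}\log|x-y|\,\mathrm{d}\rho(x)\mathrm{d}\rho(y)+\int_{\mathbb{R}} V(x)\,\mathrm{d}\rho(x),$$ where $\mathcal{P}([-R,R])$ is the set of probability measures supported in $[-R,R]$. Then: i) there exists a unique probability measure solving this constrained minimisation problem, and it takes the form $$\mathrm{d}\rho_R(x)= \begin{cases} \displaystyle\frac{1}{\pi}\frac{P_R(x)}{\sqrt{R^2-x^2}}\,\mathbf{1}_{|x|< R}\,\mathrm{d} x & \text{if } R< R_{\star} \text{ (pushed phase)},\\[2mm] \displaystyle\frac{1}{\pi}Q(x)\sqrt{R_{\star}^2-x^2}\,\mathbf{1}_{|x|\leq R_{\star}}\,\mathrm{d} x & \text{if } R\geq R_{\star} \text{ (pulled phase)}, \end{cases}$$ where $P_R(x)$ and $Q(x)=\lim_{R\uparrow R_{\star}}P_{R}(x)/(R^2-x^2)$ are nonnegative on $[-R,R]$ and $[-R_{\star},R_{\star}]$, respectively. ii) Explicitly, let $c_n(R)$ denote the Chebyshev coefficients of $V(Rx)$, $$c_n(R)=\frac{1}{h_n}\int_{-1}^1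 \frac{V(R x)T_n(x)}{\sqrt{1-x^2}}\,\mathrm{d} x,$$ with $T_n$ the Chebyshev polynomials of the first kind and $h_0=\pi$, $h_n=\pi/2$ for $n\geq1$. Then the equilibrium measure above is uniquely determined by $$P_R(x)=1-\sum_{n\geq1}n\,c_n(R)\,T_{n}(x/R),$$ and the critical radius $R_{\star}$ is the smallest positive solution of $$\sum_{n\geq1}n\,c_{n}(R_{\star})=1.$$
   Context: $\mathbf{1}_{F}$ denotes the indicator of the set defined by the formula $F$. The Chebyshev polynomials satisfy $\int_{-1}^1 T_n(x)T_m(x)(1-x^2)^{-1/2}\mathrm{d}x=\delta_{nm}h_n$. In the pulled phase ($R\ge R_\star$) the hard walls at $\pm R$ are not active and $\rho_R$ equals the unconstrained global minimiser, supported on $[-R_\star,R_\star]$. *)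

theory Defs
  imports "HOL-Probability.Probability"
begin

definition strictly_convex :: "(real \<Rightarrow> real) \<Rightarrow> bool" where
  "strictly_convex f \<longleftrightarrow> (\<forall>x y t. x \<noteq> y \<and> 0 < t \<and> t < 1 \<longrightarrow>
      f (t * x + (1 - t) * y) < t * f x + (1 - t) * f y)"

fun cheb :: "nat \<Rightarrow> real \<Rightarrow> real" where
  "cheb 0 x = 1"
| "cheb (Suc 0) x = x"
| "cheb (Suc (Suc n)) x = 2 * x * cheb (Suc n) x - cheb n x"

definition cheb_h :: "nat \<Rightarrow> real" where
  "cheb_h n = (if n = 0 then pi else pi / 2)"

definition cheb_coeff :: "(real \<Rightarrow> real) \<Rightarrow> nat \<Rightarrow> real \<Rightarrow> real" where
  "cheb_coeff V n R = (1 / cheb_h n) *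
     set_lebesgue_integral lborel {-1<..<1} (\<lambda>x. V (R * x) * cheb n x / sqrt (1 - x\<^sup>2))"

definition P_R :: "(real \<Rightarrow> real) \<Rightarrow> real \<Rightarrow> real \<Rightarrow> real" where
  "P_R V R x = 1 - (\<Sum>n. real (Suc n) * cheb_coeff V (Suc n) R * cheb (Suc n) (x / R))"

definition crit_sum :: "(real \<Rightarrow> real) \<Rightarrow> real \<Rightarrow> real" where
  "crit_sum V R = (\<Sum>n. real (Suc n) * cheb_coeff V (Suc n) R)"

definition probs_on :: "real \<Rightarrow> real measure set" where
  "probs_on R = {M. prob_space M \<and> sets M = sets borel \<and> emeasure M {-R..R} = 1}"

definition eint :: "'a measure \<Rightarrow> ('a \<Rightarrow> ereal) \<Rightarrow> ereal" where
  "eint M f = enn2ereal (\<integral>\<^sup>+ x. e2ennreal (f x) \<partial>M) - enn2ereal (\<integral>\<^sup>+ x. e2ennreal (- f x) \<partial>M)"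

definition log_kernel :: "real \<Rightarrow> real \<Rightarrow> ereal" where
  "log_kernel x y = (if x = y then \<infinity> else ereal (- ln \<bar>x - y\<bar>))"

definition energy :: "(real \<Rightarrow> real) \<Rightarrow> real measure \<Rightarrow> ereal" where
  "energy V M = ereal (1/2) * eint (M \<Otimes>\<^sub>M M) (\<lambda>(x, y). log_kernel x y)
               + eint M (\<lambda>x. ereal (V x))"

definition constrained_minimiser :: "(real \<Rightarrow> real) \<Rightarrow> real \<Rightarrow> real measure \<Rightarrow> bool" where
  "constrained_minimiser V R \<rho> \<longleftrightarrow>
     \<rho> \<in> probs_on R \<and> (\<forall>\<nu> \<in> probs_on R. energy V \<rho> \<le> energy V \<nu>)"

end

theory Submission
  imports Defs
begin

text \<open>
  Under \<open>x = S cos t\<close> the kernel becomes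
  \<open>- ln \<bar>x - y\<bar> = ln (2/S) + (\<Sum>n\<ge>1. 2/n cos (n s) cos (n t))\<close>. Replacing the terms by \<open>r^n\<close> times themselves
  gives a bounded kernel dominated by the logarithm, so that letting \<open>r \<rightarrow> 1\<close> shows that the logarithmic
  energy of a difference of two probability measures is positive definite; hence the Euler--Lagrange conditions
  are sufficient for being the unique minimiser. The expansion also shows that the weight
  \<open>p t = 1 - (\<Sum>n\<ge>1. n c\<^sub>n cos (n t))\<close> has potential \<open>const - V\<close> on \<open>[-S, S]\<close>.

  Since \<open>(1 - cos (n t)) / (1 - cos t)\<close> is a Fejer kernel of mean \<open>n\<close>, the number \<open>1 - p s\<close> is the mean over \<open>t\<close> of
  \<open>(V (S cos s) - (V (S cos (s + t)) + V (S cos (s - t))) / 2) / (1 - cos t)\<close>. Convexity shows that this is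
  largest at \<open>s = 0\<close>, where it equals the critical sum, and increasing in \<open>S\<close>. So \<open>p \<ge> 0\<close> as long as the sum is at most \<open>1\<close>.
  When it equals \<open>1\<close>, the same kernel bounds the force that \<open>p\<close> exerts at the edge \<open>S\<close> by \<open>V' S\<close>, and by convexity
  the Euler--Lagrange inequality holds outside \<open>[-S, S]\<close>.
\<close>

subsection \<open>The regularised logarithmic kernel\<close>

text \<open>Working with angles turns the arcsine law into the uniform law and Chebyshev polynomials
  into cosines, so the edge singularity of \<open>1 / sqrt (S^2 - x^2)\<close> disappears from all
  estimates.

  The third derivative of \<open>V\<close> enters through decay: \<open>n^3 c_n\<close> are sine
  coefficients of a continuous function, hence square summable, and therefore
  \<open>n^2 |c_n|\<close> is summable. The weight \<open>n^2\<close> is forced, being the value at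
  \<open>t = 0\<close> of the Fejer kernel from which the force at the edge is read off.

  Both phases come from one family of measures \<open>equilibrium S\<close>, with
  \<open>S = R\<close> in the pushed and \<open>S = Rs\<close> in the pulled phase. The square root
  in the pulled density is the case where the weight vanishes at the edges, that is where the
  critical sum is 1.

  Competitors may have infinite energy, and the real logarithm has a default value at 0, so
  finiteness is carried by the predicate \<open>log_finite\<close>. For uniqueness, each single term
  of the positive definite series is kept as a lower bound: equal energies force equal Chebyshev
  moments, and these determine a measure on a bounded interval.\<close>

definition circ_dist2 :: "real \<Rightarrow> real \<Rightarrow> real" where
  "circ_dist2 r t = 1 - 2 * r * cos t + r\<^sup>2"

lemma cmod_1_minus_rcis: "(cmod (1 - rcis r t))\<^sup>2 = circ_dist2 r t"
proof -
  have "(cmod (1 - rcis r t))\<^sup>2 = (1 - r * cos t)\<^sup>2 + (r * sin t)\<^sup>2"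
    by (simp add: cmod_power2)
  also have "\<dots> = 1 - 2 * r * cos t + r\<^sup>2 * ((cos t)\<^sup>2 + (sin t)\<^sup>2)"
    unfolding power2_eq_square by algebra
  finally show ?thesis by (simp add: circ_dist2_def)
qed

text \<open>This is the real part of the Taylor series of \<open>- ln (1 - z)\<close> at
  \<open>z = rcis r t\<close>; the half appears because \<open>circ_dist2\<close> is a squared
  distance.\<close>

lemma log_series_cos:
  assumes "0 \<le> r" "r < 1"
  shows "(\<lambda>n. r ^ Suc n / real (Suc n) * cos (real (Suc n) * t)) sums (- ln (circ_dist2 r t) / 2)"
proof -
  let ?z = "rcis r t"
  have z: "cmod ?z < 1" using assms by simp
  have "(\<lambda>n. - ((- (- ?z)) ^ n) / of_nat n) sums ln (1 + - ?z)"
    by (rule Ln_series') (use z in simp)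
  then have "(\<lambda>n. Re (- (?z ^ n) / of_nat n)) sums Re (ln (1 - ?z))"
    by (intro sums_Re) simp
  moreover have "(\<lambda>n. Re (- (?z ^ n) / of_nat n)) = (\<lambda>n. - (r ^ n / real n * cos (real n * t)))"
    by (simp add: DeMoivre2 fun_eq_iff del: of_nat_mult)
  moreover have "Re (ln (1 - ?z)) = ln (circ_dist2 r t) / 2"
  proof -
    have ne: "1 - ?z \<noteq> 0" using z by (metis eq_iff_diff_eq_0 less_irrefl norm_one)
    have "ln (circ_dist2 r t) = ln ((cmod (1 - ?z))\<^sup>2)" by (simp add: cmod_1_minus_rcis)
    also have "\<dots> = 2 * ln (cmod (1 - ?z))" using ne by (simp add: ln_realpow)
    finally show ?thesis using ne by simp
  qed
  ultimately have "(\<lambda>n. - (r ^ n / real n * cos (real n * t))) sums (ln (circ_dist2 r t) / 2)" by (simp only:)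
  from sums_minus[OF this]
  have "(\<lambda>n. r ^ n / real n * cos (real n * t)) sums (- ln (circ_dist2 r t) / 2)" by simp
  \<comment> \<open>The term of index 0 vanishes by the default value of division by 0, so the
    series may start at index 1.\<close>
  then show ?thesis by (subst sums_Suc_iff) simp
qed

text \<open>Geometrically \<open>|1 - e^(it)| \<le> |1 - r e^(it)| + (1 - r) \<le> 2 |1 - r
  e^(it)|\<close>, and squaring gives the factor 4. It is the only loss when the regularised kernel
  is compared with the logarithm.\<close>

lemma circ_dist2_ge:
  assumes "0 \<le> r" "r \<le> 1"
  shows "circ_dist2 1 t / 4 \<le> circ_dist2 r t"
proof -
  have "4 * circ_dist2 r t - circ_dist2 1 t = 2 + 2 * cos t - 8 * r * cos t + 4 * r\<^sup>2"
    by (simp add: circ_dist2_def)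
  also have "\<dots> \<ge> 0"
  proof (cases "cos t \<ge> 0")
    case True
    have "2 + 2 * cos t - 8 * r * cos t + 4 * r\<^sup>2 = 4 * (r - cos t)\<^sup>2 + 2 * (1 - cos t) * (1 + 2 * cos t)"
      by (simp add: power2_eq_square algebra_simps)
    then show ?thesis using True by simp
  next
    case False
    then have "r * cos t \<le> 0" using assms by (simp add: mult_nonneg_nonpos)
    moreover have "-1 \<le> cos t" by simp
    ultimately show ?thesis using zero_le_power2[of r] by linarith
  qed
  finally show ?thesis by simp
qed

lemma circ_dist2_le:
  assumes "0 \<le> r" "r \<le> 1"
  shows "circ_dist2 r t \<le> 4"
proof -
  have "r * (- cos t) \<le> r * 1"
    using assms cos_ge_minus_one[of t] by (intro mult_left_mono) auto
  moreover have "r\<^sup>2 \<le> 1" using assms by (simp add: power_le_one)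
  ultimately show ?thesis using assms by (simp add: circ_dist2_def)
qed

lemma circ_dist2_pos: "\<lbrakk>0 \<le> r; r < 1\<rbrakk> \<Longrightarrow> 0 < circ_dist2 r t"
proof -
  assume "0 \<le> r" "r < 1"
  then have "cmod (rcis r t) \<noteq> cmod 1" by simp
  then have "rcis r t \<noteq> 1" by metis
  then have "0 < (cmod (1 - rcis r t))\<^sup>2" by simp
  then show ?thesis by (simp only: cmod_1_minus_rcis)
qed

text \<open>The chords from \<open>e^(is)\<close> to \<open>e^(it)\<close> and to
  \<open>e^(-it)\<close> have lengths with product \<open>2 |cos s - cos t|\<close>. Hence adding
  the circular kernels at \<open>s - t\<close> and \<open>s + t\<close> produces the logarithmic
  kernel of the interval.\<close>

lemma circ_dist2_one_prod: "circ_dist2 1 (s - t) * circ_dist2 1 (s + t) = (2 * (cos s - cos t))\<^sup>2"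
proof -
  have "(sin s)\<^sup>2 * (sin t)\<^sup>2 = (1 - (cos s)\<^sup>2) * (1 - (cos t)\<^sup>2)"
    by (simp add: sin_squared_eq)
  then show ?thesis
    by (simp add: circ_dist2_def cos_add cos_diff power2_eq_square algebra_simps)
qed

text \<open>Abel regularisation of the kernel \<open>- ln (2 * \<bar>cos s - cos t\<bar>)\<close>, which is the case \<open>r = 1\<close>.\<close>
definition abel_kernel :: "real \<Rightarrow> real \<Rightarrow> real \<Rightarrow> real" where
  "abel_kernel r s t = - (ln (circ_dist2 r (s - t)) + ln (circ_dist2 r (s + t))) / 2"

lemma abel_kernel_sums:
  assumes "0 \<le> r" "r < 1"
  shows "(\<lambda>n. 2 * r ^ Suc n / real (Suc n) * (cos (real (Suc n) * s) * cos (real (Suc n) * t))) sums abel_kernel r s t"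
proof -
  have "(\<lambda>n. r ^ Suc n / real (Suc n) * cos (real (Suc n) * (s - t)) + r ^ Suc n / real (Suc n) * cos (real (Suc n) * (s + t)))
     sums (- ln (circ_dist2 r (s - t)) / 2 + - ln (circ_dist2 r (s + t)) / 2)"
    by (intro sums_add log_series_cos assms)
  moreover have "r ^ Suc n / real (Suc n) * cos (real (Suc n) * (s - t)) + r ^ Suc n / real (Suc n) * cos (real (Suc n) * (s + t))
    = 2 * r ^ Suc n / real (Suc n) * (cos (real (Suc n) * s) * cos (real (Suc n) * t))" for n
    unfolding right_diff_distrib[of "real (Suc n)"] distrib_left[of "real (Suc n)"] cos_add cos_diff
    by (simp only: distrib_left right_diff_distrib)
  moreover have "- ln (circ_dist2 r (s - t)) / 2 + - ln (circ_dist2 r (s + t)) / 2 = abel_kernel r s t"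
    by (simp add: abel_kernel_def field_simps)
  ultimately show ?thesis by simp
qed

lemma abel_kernel_ge:
  assumes "0 \<le> r" "r < 1"
  shows "- 2 * ln 2 \<le> abel_kernel r s t"
proof -
  have "ln (circ_dist2 r u) \<le> 2 * ln 2" for u
  proof -
    have "ln (circ_dist2 r u) \<le> ln (2\<^sup>2)"
      using circ_dist2_le[of r u] circ_dist2_pos[of r u] assms by (intro ln_mono) auto
    also have "\<dots> = 2 * ln 2" by (subst ln_realpow) auto
    finally show ?thesis .
  qed
  from this[of "s - t"] this[of "s + t"] show ?thesis by (simp add: abel_kernel_def)
qed

lemma circ_dist2_one_pos:
  assumes "cos s \<noteq> cos t"
  shows "circ_dist2 1 (s - t) > 0" "circ_dist2 1 (s + t) > 0"
proof -
  have "circ_dist2 1 u \<ge> 0" for u by (simp add: circ_dist2_def)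
  moreover have "circ_dist2 1 (s - t) * circ_dist2 1 (s + t) \<noteq> 0"
    using assms by (simp add: circ_dist2_one_prod)
  ultimately show "circ_dist2 1 (s - t) > 0" "circ_dist2 1 (s + t) > 0"
    by (auto simp: less_le)
qed

lemma abel_kernel_one:
  assumes "cos s \<noteq> cos t"
  shows "abel_kernel 1 s t = - ln (2 * \<bar>cos s - cos t\<bar>)"
proof -
  have "ln (circ_dist2 1 (s - t)) + ln (circ_dist2 1 (s + t)) = ln ((2 * \<bar>cos s - cos t\<bar>)\<^sup>2)"
    using circ_dist2_one_pos[OF assms] by (simp add: ln_mult_pos[symmetric] circ_dist2_one_prod power_mult_distrib del: right_diff_distrib_numeral)
  also have "\<dots> = 2 * ln (2 * \<bar>cos s - cos t\<bar>)" using assms by (subst ln_realpow) auto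
  finally show ?thesis by (simp add: abel_kernel_def)
qed

lemma abel_kernel_le:
  assumes "0 \<le> r" "r < 1" "cos s \<noteq> cos t"
  shows "abel_kernel r s t \<le> ln 2 - ln \<bar>cos s - cos t\<bar>"
proof -
  have "ln (circ_dist2 1 u) - 2 * ln 2 \<le> ln (circ_dist2 r u)" if "circ_dist2 1 u > 0" for u
  proof -
    have "ln (circ_dist2 1 u / 2\<^sup>2) \<le> ln (circ_dist2 r u)"
      using circ_dist2_ge[of r u] assms that by (intro ln_mono) auto
    moreover have "ln (circ_dist2 1 u / 2\<^sup>2) = ln (circ_dist2 1 u) - 2 * ln 2"
      using that by (simp only: ln_div ln_realpow zero_less_numeral zero_less_power of_nat_numeral) simp
    ultimately show ?thesis by simp
  qed
  note le = this[OF circ_dist2_one_pos(1)[OF assms(3)]] this[OF circ_dist2_one_pos(2)[OF assms(3)]]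
  have "- (c + d) / 2 \<le> - (a + b) / 2 + 2 * l" if "a - 2 * l \<le> c" "b - 2 * l \<le> d" for a b c d l :: real
    using that by (simp add: field_simps)
  from this[OF le] have "abel_kernel r s t \<le> abel_kernel 1 s t + 2 * ln 2"
    unfolding abel_kernel_def .
  also have "\<dots> = ln 2 - ln \<bar>cos s - cos t\<bar>"
    using assms(3) by (simp add: abel_kernel_one ln_mult)
  finally show ?thesis .
qed

text \<open>The majorant does not depend on \<open>r\<close>, as dominated convergence for
  \<open>r \<rightarrow> 1\<close> requires.\<close>

lemma abel_kernel_abs_le:
  assumes "0 \<le> r" "r < 1" "cos s \<noteq> cos t"
  shows "\<bar>abel_kernel r s t\<bar> \<le> \<bar>ln \<bar>cos s - cos t\<bar>\<bar> + 2 * ln 2"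
  using abel_kernel_le[OF assms] abel_kernel_ge[OF assms(1,2), of s t] ln_ge_zero[of 2] by linarith

lemma tendsto_abel_kernel:
  assumes "cos s \<noteq> cos t" "r \<longlonglongrightarrow> 1"
  shows "(\<lambda>k. abel_kernel (r k) s t) \<longlonglongrightarrow> - ln (2 * \<bar>cos s - cos t\<bar>)"
proof -
  have "(\<lambda>k. ln (circ_dist2 (r k) u)) \<longlonglongrightarrow> ln (circ_dist2 1 u)" if "circ_dist2 1 u > 0" for u
    using that assms(2) unfolding circ_dist2_def by (intro tendsto_intros) auto
  note lim = this[OF circ_dist2_one_pos(1)[OF assms(1)]] this[OF circ_dist2_one_pos(2)[OF assms(1)]]
  show ?thesis unfolding abel_kernel_one[OF assms(1), symmetric] unfolding abel_kernel_def
    by (intro tendsto_divide tendsto_minus tendsto_add lim tendsto_const) simp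
qed

lemma abel_kernel_measurable [measurable]:
  assumes [measurable]: "f \<in> borel_measurable M" "g \<in> borel_measurable M"
  shows "(\<lambda>x. abel_kernel r (f x) (g x)) \<in> borel_measurable M"
  unfolding abel_kernel_def circ_dist2_def by measurable

subsection \<open>The uniform measure on angles\<close>

text \<open>Its image under \<open>t \<mapsto> S cos t\<close> is the arcsine law on
  \<open>[-S, S]\<close>, the reference measure for Chebyshev orthogonality.\<close>

definition ang :: "real measure" where
  "ang = uniform_measure lborel {0..pi}"

lemma sets_ang [measurable_cong, simp]: "sets ang = sets borel"
  by (simp add: ang_def)

lemma space_ang [simp]: "space ang = UNIV"
  by (simp add: ang_def)

interpretation ang: prob_space ang
  unfolding ang_def by (rule prob_space_uniform_measure) auto

lemma measure_ang_UNIV [simp]: "measure ang UNIV = 1"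
  using ang.prob_space by simp

lemma ang_eq_density: "ang = density lborel (\<lambda>x. ennreal (indicator {0..pi} x / pi))"
  unfolding ang_def uniform_measure_def
  by (intro density_cong) (auto simp: indicator_def divide_ennreal[symmetric])

lemma integral_ang:
  fixes f :: "real \<Rightarrow> real"
  assumes [measurable]: "f \<in> borel_measurable borel"
  shows "integral\<^sup>L ang f = (LINT x:{0..pi}|lborel. f x) / pi"
proof -
  have "integral\<^sup>L ang f = (\<integral>x. (indicator {0..pi} x / pi) *\<^sub>R f x \<partial>lborel)"
    unfolding ang_eq_density by (rule integral_density) auto
  also have "\<dots> = (\<integral>x. (indicator {0..pi} x *\<^sub>R f x) / pi \<partial>lborel)"
    by (intro Bochner_Integration.integral_cong) auto
  finally show ?thesis by (simp add: set_lebesgue_integral_def)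
qed

lemma AE_ang: "AE t in ang. t \<in> {0..pi}"
  unfolding ang_def by (rule AE_uniform_measureI) auto

lemma AE_ang_neq: "AE t in ang. t \<noteq> a"
proof -
  have "AE t in lborel. t \<noteq> a" by (rule AE_lborel_singleton)
  then show ?thesis unfolding ang_eq_density by (subst AE_density) auto
qed

text \<open>Since \<open>cos\<close> is injective on \<open>[0, pi]\<close>, at most one angle is
  excluded. This removes the diagonal of the kernel and the zero of
  \<open>1 - cos t\<close>.\<close>

lemma AE_ang_cos_neq:
  shows "AE t in ang. cos t \<noteq> c"
proof (cases "c \<in> {-1..1}")
  case True
  from AE_ang AE_ang_neq[of "arccos c"] show ?thesis
    by eventually_elim (use True in \<open>auto simp: arccos_cos\<close>)
next
  case False
  then have "cos t \<noteq> c" for t by (metis atLeastAtMost_iff cos_ge_minus_one cos_le_one)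
  then show ?thesis by simp
qed

lemma integrable_ang_bounded:
  fixes f :: "real \<Rightarrow> real"
  assumes "f \<in> borel_measurable borel" "\<And>t. \<bar>f t\<bar> \<le> B"
  shows "integrable ang f"
  using assms by (intro ang.integrable_const_bound[where B = B]) auto

lemma integrable_ang_continuous:
  fixes f :: "real \<Rightarrow> real"
  assumes "continuous_on UNIV f"
  shows "integrable ang f"
proof -
  have "compact (f ` {0..pi})"
    using assms by (intro compact_continuous_image) (auto intro: continuous_on_subset)
  then obtain B where "\<And>t. t \<in> {0..pi} \<Longrightarrow> \<bar>f t\<bar> \<le> B"
    using compact_imp_bounded bounded_real by (metis imageI)
  with AE_ang have "AE t in ang. norm (f t) \<le> B" by auto
  moreover have "f \<in> borel_measurable borel" using assms by (rule borel_measurable_continuous_onI)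
  ultimately show ?thesis by (intro ang.integrable_const_bound) auto
qed

lemma integral_ang_FTC:
  assumes "\<And>t. (F has_real_derivative f t) (at t)" "continuous_on UNIV f"
  shows "integral\<^sup>L ang f = (F pi - F 0) / pi"
proof -
  have [measurable]: "f \<in> borel_measurable borel"
    using assms(2) by (rule borel_measurable_continuous_onI)
  have "(\<integral>x. f x * indicator {0..pi} x \<partial>lborel) = F pi - F 0"
    using assms by (intro integral_FTC_Icc_real) (auto simp: continuous_on_eq_continuous_at)
  then show ?thesis by (simp add: integral_ang set_lebesgue_integral_def mult.commute)
qed

lemma cos_nat_measurable [measurable]: "(\<lambda>t. cos (real n * t)) \<in> borel_measurable borel"
  by measurable

lemma integral_ang_cos: "n \<noteq> 0 \<Longrightarrow> (\<integral>t. cos (real n * t) \<partial>ang) = 0"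
proof -
  assume n: "n \<noteq> 0"
  have "(\<integral>t. cos (real n * t) \<partial>ang) = (sin (real n * pi) / n - sin (real n * 0) / n) / pi"
    by (rule integral_ang_FTC[where F = "\<lambda>t. sin (real n * t) / n"])
       (use n in \<open>auto intro!: derivative_eq_intros continuous_intros\<close>)
  then show ?thesis by simp
qed

lemma integral_ang_cos': "(\<integral>t. cos (real n * t) \<partial>ang) = (if n = 0 then 1 else 0)"
  using integral_ang_cos ang.prob_space by auto

text \<open>The conditional stands for \<open>|n - m|\<close>, since subtraction on
  \<open>nat\<close> truncates; the frequencies stay natural so that
  \<open>integral_ang_cos'\<close> applies.\<close>

lemma cos_mult_cos: "cos (real n * t) * cos (real m * t) =
    (cos (real (n + m) * t) + cos (real (if m \<le> n then n - m else m - n) * t)) / 2" for t :: real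
proof -
  have "cos (real (if m \<le> n then n - m else m - n) * t) = cos (real n * t - real m * t)"
  proof (cases "m \<le> n")
    case False
    then have "real (m - n) * t = - (real n * t - real m * t)" by (simp add: algebra_simps of_nat_diff)
    then show ?thesis using False by (simp only: cos_minus if_False)
  qed (simp add: of_nat_diff algebra_simps)
  then show ?thesis
    by (simp only: of_nat_add distrib_right cos_add cos_diff) simp
qed

lemma sin_mult_sin: "sin (real n * t) * sin (real m * t) =
    (cos (real (if m \<le> n then n - m else m - n) * t) - cos (real (n + m) * t)) / 2" for t :: real
proof -
  have "cos (real (if m \<le> n then n - m else m - n) * t) = cos (real n * t - real m * t)"
  proof (cases "m \<le> n")
    case False
    then have "real (m - n) * t = - (real n * t - real m * t)" by (simp add: algebra_simps of_nat_diff)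
    then show ?thesis using False by (simp only: cos_minus if_False)
  qed (simp add: of_nat_diff algebra_simps)
  then show ?thesis
    by (simp only: of_nat_add distrib_right cos_add cos_diff) simp
qed

lemma integrable_cos_mult_cos: "integrable ang (\<lambda>t. cos (real n * t) * cos (real m * t))"
  by (intro integrable_ang_continuous continuous_intros)

lemma integral_ang_cos_cos:
  "(\<integral>t. cos (real n * t) * cos (real m * t) \<partial>ang) = (if n = m then if n = 0 then 1 else 1/2 else 0)"
proof -
  have int: "integrable ang (\<lambda>t. cos (real k * t))" for k
    by (intro integrable_ang_continuous continuous_intros)
  have "(\<integral>t. cos (real n * t) * cos (real m * t) \<partial>ang) =
    ((\<integral>t. cos (real (n + m) * t) \<partial>ang) + (\<integral>t. cos (real (if m \<le> n then n - m else m - n) * t) \<partial>ang)) / 2"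
    unfolding cos_mult_cos by (subst Bochner_Integration.integral_add[symmetric, OF int int]) (rule integral_divide_zero)
  also have "\<dots> = (if n = m then if n = 0 then 1 else 1/2 else 0)"
    unfolding integral_ang_cos' by auto
  finally show ?thesis .
qed

lemma integral_ang_sin_sin:
  assumes "n \<noteq> 0"
  shows "(\<integral>t. sin (real n * t) * sin (real m * t) \<partial>ang) = (if n = m then 1/2 else 0)"
proof -
  have int: "integrable ang (\<lambda>t. cos (real k * t))" for k
    by (intro integrable_ang_continuous continuous_intros)
  have "(\<integral>t. sin (real n * t) * sin (real m * t) \<partial>ang) =
    ((\<integral>t. cos (real (if m \<le> n then n - m else m - n) * t) \<partial>ang) - (\<integral>t. cos (real (n + m) * t) \<partial>ang)) / 2"
    unfolding sin_mult_sin by (subst Bochner_Integration.integral_diff[symmetric, OF int int]) (rule integral_divide_zero)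
  also have "\<dots> = (if n = m then 1/2 else 0)"
    unfolding integral_ang_cos' using assms by auto
  finally show ?thesis .
qed

text \<open>The bounds \<open>B n\<close> are uniform in \<open>t\<close>, so
  \<open>(\<Sum>n. B n) * |p t|\<close> is an integrable majorant and sum and integral may be
  exchanged.\<close>

lemma integral_ang_sums:
  fixes f :: "nat \<Rightarrow> real \<Rightarrow> real"
  assumes [measurable]: "\<And>n. f n \<in> borel_measurable borel" "integrable ang p"
    and bound: "\<And>n t. \<bar>f n t\<bar> \<le> B n" and "summable B"
    and lim: "AE t in ang. (\<lambda>n. f n t) sums g t" and [measurable]: "g \<in> borel_measurable borel"
  shows "integrable ang (\<lambda>t. g t * p t)" "(\<lambda>n. \<integral>t. f n t * p t \<partial>ang) sums (\<integral>t. g t * p t \<partial>ang)"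
proof -
  have [measurable]: "p \<in> borel_measurable borel" using assms(2) by (simp add: integrable_iff_bounded)
  have B: "0 \<le> B n" for n using bound[of n 0] by linarith
  have int: "integrable ang (\<lambda>t. f n t * p t)" for n
    by (rule Bochner_Integration.integrable_bound[of _ "\<lambda>t. B n * p t"])
       (use assms(2) bound B in \<open>auto simp: abs_mult intro!: mult_right_mono\<close>)
  have sn: "summable (\<lambda>n. norm (f n t * p t))" for t
    by (rule summable_comparison_test[of _ "\<lambda>n. B n * \<bar>p t\<bar>"])
       (use bound \<open>summable B\<close> in \<open>auto simp: abs_mult intro!: mult_right_mono summable_mult2 exI[of _ 0]\<close>)
  have si: "summable (\<lambda>n. \<integral>t. norm (f n t * p t) \<partial>ang)"
  proof (rule summable_comparison_test[of _ "\<lambda>n. B n * (\<integral>t. \<bar>p t\<bar> \<partial>ang)"], intro exI[of _ 0] allI impI)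
    fix n
    have "(\<integral>t. norm (f n t * p t) \<partial>ang) \<le> (\<integral>t. B n * \<bar>p t\<bar> \<partial>ang)"
      using integrable_norm[OF int[of n]] assms(2) bound by (intro integral_mono) (auto simp: abs_mult intro!: mult_right_mono)
    then show "norm (\<integral>t. norm (f n t * p t) \<partial>ang) \<le> B n * (\<integral>t. \<bar>p t\<bar> \<partial>ang)" by simp
  qed (use \<open>summable B\<close> in \<open>auto intro: summable_mult2\<close>)
  have eq: "AE t in ang. (\<Sum>n. f n t * p t) = g t * p t"
    using lim by eventually_elim (rule sums_unique[symmetric], rule sums_mult2)
  have 1: "integrable ang (\<lambda>t. \<Sum>n. f n t * p t)"
    by (rule integrable_suminf[OF int]) (use sn si in auto)
  show "integrable ang (\<lambda>t. g t * p t)"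
    using 1 by (rule integrable_cong_AE_imp) (use eq in \<open>auto elim: AE_mp\<close>)
  have 2: "(\<lambda>n. \<integral>t. f n t * p t \<partial>ang) sums (\<integral>t. (\<Sum>n. f n t * p t) \<partial>ang)"
    by (rule sums_integral[OF int]) (use sn si in auto)
  have "(\<integral>t. (\<Sum>n. f n t * p t) \<partial>ang) = (\<integral>t. g t * p t \<partial>ang)"
    by (intro integral_cong_AE eq) measurable
  with 2 show "(\<lambda>n. \<integral>t. f n t * p t \<partial>ang) sums (\<integral>t. g t * p t \<partial>ang)" by simp
qed

text \<open>In the variable \<open>x = S cos t\<close> this is the invariance of the arcsine law
  under \<open>x \<mapsto> - x\<close>.\<close>

lemma distr_ang_reflect: "distr ang borel (\<lambda>t. pi - t) = ang"
proof -
  have "distr ang borel (\<lambda>t. pi - t) = density (distr lborel borel (\<lambda>t. pi - t)) (\<lambda>x. ennreal (indicator {0..pi} x / pi))"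
    unfolding ang_eq_density
    by (subst density_distr) (auto intro!: arg_cong2[where f = "\<lambda>a b. distr a b _"] density_cong simp: indicator_def)
  also have "distr lborel borel (\<lambda>t. pi - t) = lborel"
  proof -
    have "lborel = distr (distr lborel borel uminus) borel ((+) pi)"
      by (simp add: lborel_distr_uminus lborel_distr_plus)
    also have "\<dots> = distr lborel borel (\<lambda>t. pi - t)"
      by (subst distr_distr) (auto simp: comp_def)
    finally show ?thesis ..
  qed
  finally show ?thesis by (simp add: ang_eq_density)
qed

lemma integral_ang_reflect:
  fixes f :: "real \<Rightarrow> real"
  assumes [measurable]: "f \<in> borel_measurable borel"
  shows "(\<integral>t. f (pi - t) \<partial>ang) = (\<integral>t. f t \<partial>ang)"
proof -
  have "(\<integral>t. f t \<partial>distr ang borel (\<lambda>t. pi - t)) = (\<integral>t. f (pi - t) \<partial>ang)"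
    by (rule integral_distr) auto
  then show ?thesis by (simp add: distr_ang_reflect)
qed

subsection \<open>Logarithmic potentials and Fejer kernels\<close>

text \<open>Radii are taken along a sequence because Fatou's lemma and dominated convergence are
  applied to them.\<close>

definition abel_seq :: "nat \<Rightarrow> real" where "abel_seq k = 1 - inverse (real (Suc k))"

lemma abel_seq: "0 \<le> abel_seq k" "abel_seq k < 1" "abel_seq \<longlonglongrightarrow> 1"
proof -
  show "0 \<le> abel_seq k" "abel_seq k < 1" by (auto simp: abel_seq_def field_simps)
  have "(\<lambda>k. 1 - inverse (real (Suc k))) \<longlonglongrightarrow> 1 - 0"
    by (intro tendsto_diff tendsto_const LIMSEQ_inverse_real_of_nat)
  then show "abel_seq \<longlonglongrightarrow> 1" by (simp add: abel_seq_def[abs_def])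
qed

lemma integral_abel_kernel:
  assumes r: "0 \<le> r" "r < 1" and p: "integrable ang p"
  shows "integrable ang (\<lambda>t. abel_kernel r s t * p t)"
    "(\<lambda>n. 2 * r ^ Suc n / real (Suc n) * cos (real (Suc n) * s) * (\<integral>t. cos (real (Suc n) * t) * p t \<partial>ang))
       sums (\<integral>t. abel_kernel r s t * p t \<partial>ang)"
proof -
  have B: "\<bar>2 * r ^ Suc n / real (Suc n) * (cos (real (Suc n) * s) * cos (real (Suc n) * t))\<bar> \<le> 2 * r ^ Suc n" for n t
  proof -
    have "\<bar>2 * r ^ Suc n / real (Suc n) * (cos (real (Suc n) * s) * cos (real (Suc n) * t))\<bar> \<le> (2 * r ^ Suc n / 1) * (1 * 1)"
      using r unfolding abs_mult abs_divide
      by (intro mult_mono frac_le) (auto simp del: mult_1_right mult_1_left)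
    then show ?thesis by simp
  qed
  have sB: "summable (\<lambda>n. 2 * r ^ Suc n)"
    using r by (intro summable_mult) (simp add: summable_Suc_iff)
  note * = integral_ang_sums[OF _ p B sB AE_I2[OF abel_kernel_sums[OF r]]]
  show "integrable ang (\<lambda>t. abel_kernel r s t * p t)" by (rule *(1)) measurable
  have "(\<lambda>n. \<integral>t. 2 * r ^ Suc n / real (Suc n) * (cos (real (Suc n) * s) * cos (real (Suc n) * t)) * p t \<partial>ang)
     sums (\<integral>t. abel_kernel r s t * p t \<partial>ang)" by (rule *(2)) measurable
  then show "(\<lambda>n. 2 * r ^ Suc n / real (Suc n) * cos (real (Suc n) * s) * (\<integral>t. cos (real (Suc n) * t) * p t \<partial>ang))
       sums (\<integral>t. abel_kernel r s t * p t \<partial>ang)"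
    by (simp only: mult.assoc integral_mult_right_zero)
qed

lemma integral_abel_kernel_eq_0:
  assumes r: "0 \<le> r" "r < 1"
  shows "(\<integral>t. abel_kernel r s t \<partial>ang) = 0"
  using integral_abel_kernel(2)[OF r, of "\<lambda>_. 1" s] integral_ang_cos[of "Suc _"]
  by (auto simp del: of_nat_Suc simp: sums_iff)

text \<open>Fatou's lemma replaces an estimate near the singularity: shifted by its lower bound
  \<open>2 * ln 2\<close>, the regularised kernel is nonnegative, and its integral is
  \<open>2 * ln 2\<close> for every \<open>r\<close> because the expansion has no constant term. The
  limit \<open>r \<rightarrow> 1\<close> thus has finite integral.\<close>

lemma integrable_ln_cos_diff: "integrable ang (\<lambda>t. ln \<bar>cos s - cos t\<bar>)"
proof -
  define u where "u k t = ennreal (abel_kernel (abel_seq k) s t + 2 * ln 2)" for k t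
  have [measurable]: "u k \<in> borel_measurable borel" for k unfolding u_def by measurable
  have u: "(\<integral>\<^sup>+t. u k t \<partial>ang) = ennreal (2 * ln 2)" for k
  proof -
    have int: "integrable ang (\<lambda>t. abel_kernel (abel_seq k) s t)"
      using integral_abel_kernel(1)[OF abel_seq(1,2), of "\<lambda>_. 1"] by simp
    have "0 \<le> abel_kernel (abel_seq k) s t + 2 * ln 2" for t
      using abel_kernel_ge[OF abel_seq(1,2), of k s t] by linarith
    note nonneg = this
    have "(\<integral>\<^sup>+t. u k t \<partial>ang) = ennreal (\<integral>t. abel_kernel (abel_seq k) s t + 2 * ln 2 \<partial>ang)"
      unfolding u_def
      by (rule nn_integral_eq_integral) (use int nonneg in auto)
    also have "(\<integral>t. abel_kernel (abel_seq k) s t + 2 * ln 2 \<partial>ang) = 2 * ln 2"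
      using int by (simp add: integral_abel_kernel_eq_0[OF abel_seq(1,2)])
    finally show ?thesis .
  qed
  have "AE t in ang. liminf (\<lambda>k. u k t) = ennreal (- ln (2 * \<bar>cos s - cos t\<bar>) + 2 * ln 2)"
    using AE_ang_cos_neq[of "cos s"]
  proof eventually_elim
    case (elim t)
    then have "(\<lambda>k. u k t) \<longlonglongrightarrow> ennreal (- ln (2 * \<bar>cos s - cos t\<bar>) + 2 * ln 2)"
      unfolding u_def by (intro tendsto_ennrealI tendsto_add tendsto_abel_kernel abel_seq tendsto_const) auto
    then show ?case by (intro lim_imp_Liminf) auto
  qed
  then have "(\<integral>\<^sup>+t. ennreal (- ln (2 * \<bar>cos s - cos t\<bar>) + 2 * ln 2) \<partial>ang) = (\<integral>\<^sup>+t. liminf (\<lambda>k. u k t) \<partial>ang)"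
    by (intro nn_integral_cong_AE) (auto elim: AE_mp)
  also have "\<dots> \<le> liminf (\<lambda>k. \<integral>\<^sup>+t. u k t \<partial>ang)" by (rule nn_integral_liminf) simp
  also have "\<dots> = ennreal (2 * ln 2)" by (simp add: u Liminf_const)
  finally have fin: "(\<integral>\<^sup>+t. ennreal (- ln (2 * \<bar>cos s - cos t\<bar>) + 2 * ln 2) \<partial>ang) \<le> ennreal (2 * ln 2)" .
  have "integrable ang (\<lambda>t. - ln (2 * \<bar>cos s - cos t\<bar>) + 2 * ln 2)"
  proof (rule integrableI_nonneg)
    show "AE t in ang. 0 \<le> - ln (2 * \<bar>cos s - cos t\<bar>) + 2 * ln 2"
      using AE_ang_cos_neq[of "cos s"]
    proof eventually_elim
      case (elim t)
      have "\<bar>cos s - cos t\<bar> \<le> 2"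
        using cos_ge_minus_one[of s] cos_le_one[of s] cos_ge_minus_one[of t] cos_le_one[of t] by linarith
      then have "ln (2 * \<bar>cos s - cos t\<bar>) \<le> ln (2 * 2)" using elim by (intro ln_mono) auto
      also have "\<dots> = 2 * ln 2" by (simp only: ln_mult_pos zero_less_numeral)
      finally show ?case by simp
    qed
  qed (use fin in \<open>auto intro: order.strict_trans1\<close>)
  then have 1: "integrable ang (\<lambda>t. ln 2 - (- ln (2 * \<bar>cos s - cos t\<bar>) + 2 * ln 2))"
    by (intro Bochner_Integration.integrable_diff) simp_all
  show ?thesis
    by (rule integrable_cong_AE_imp[OF 1]) (use AE_ang_cos_neq[of "cos s"] in \<open>auto elim!: AE_mp simp: ln_mult\<close>)
qed

text \<open>The kernel is expanded for \<open>r < 1\<close> and \<open>r\<close> is sent to \<open>1\<close>.\<close>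
lemma log_potential_cos:
  assumes [measurable]: "p \<in> borel_measurable borel" and p: "\<And>t. \<bar>p t\<bar> \<le> P"
    and sq: "summable (\<lambda>n. \<bar>\<integral>t. cos (real (Suc n) * t) * p t \<partial>ang\<bar> / real (Suc n))"
  shows "integrable ang (\<lambda>t. ln \<bar>cos s - cos t\<bar> * p t)"
    "(\<integral>t. - ln (2 * \<bar>cos s - cos t\<bar>) * p t \<partial>ang) =
       (\<Sum>n. 2 / real (Suc n) * cos (real (Suc n) * s) * (\<integral>t. cos (real (Suc n) * t) * p t \<partial>ang))"
proof -
  define q where "q n = (\<integral>t. cos (real (Suc n) * t) * p t \<partial>ang)" for n
  have intp: "integrable ang p" by (rule integrable_ang_bounded) (use p in auto)
  have P: "0 \<le> P" using p[of 0] by linarith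
  define w where "w t = (\<bar>ln \<bar>cos s - cos t\<bar>\<bar> + 2 * ln 2) * P" for t
  have intw: "integrable ang w" unfolding w_def using integrable_ln_cos_diff by auto
  show "integrable ang (\<lambda>t. ln \<bar>cos s - cos t\<bar> * p t)"
    by (rule Bochner_Integration.integrable_bound[OF intw])
       (use p P in \<open>auto simp: w_def abs_mult intro!: mult_mono\<close>)
  have "(\<lambda>k. \<integral>t. abel_kernel (abel_seq k) s t * p t \<partial>ang) \<longlonglongrightarrow> (\<integral>t. - ln (2 * \<bar>cos s - cos t\<bar>) * p t \<partial>ang)"
  proof (rule integral_dominated_convergence[OF _ _ intw])
    show "AE t in ang. (\<lambda>k. abel_kernel (abel_seq k) s t * p t) \<longlonglongrightarrow> - ln (2 * \<bar>cos s - cos t\<bar>) * p t"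
      using AE_ang_cos_neq[of "cos s"]
      by eventually_elim (intro tendsto_mult tendsto_abel_kernel abel_seq tendsto_const, auto)
    show "AE t in ang. norm (abel_kernel (abel_seq k) s t * p t) \<le> w t" for k
      using AE_ang_cos_neq[of "cos s"]
    proof eventually_elim
      case (elim t)
      then show ?case unfolding w_def real_norm_def abs_mult
        by (intro mult_mono p abel_kernel_abs_le abel_seq) auto
    qed
  qed measurable
  \<comment> \<open>The powers of \<open>r\<close> are at most 1, so the absolute terms without them
    form a majorant, summable by \<open>sq\<close>, and Tannery's theorem exchanges limit and
    sum.\<close>
  moreover have "(\<lambda>k. \<Sum>n. 2 * abel_seq k ^ Suc n / real (Suc n) * cos (real (Suc n) * s) * q n)
     \<longlonglongrightarrow> (\<Sum>n. 2 / real (Suc n) * cos (real (Suc n) * s) * q n)"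
  proof (rule tannerys_theorem[where M = "\<lambda>n. 2 * (\<bar>q n\<bar> / real (Suc n))", THEN conjunct2, THEN conjunct2])
    show "summable (\<lambda>n. 2 * (\<bar>q n\<bar> / real (Suc n)))" using sq unfolding q_def by (rule summable_mult)
    show "\<forall>\<^sub>F (n, k) in at_top \<times>\<^sub>F sequentially.
       norm (2 * abel_seq k ^ Suc n / real (Suc n) * cos (real (Suc n) * s) * q n) \<le> 2 * (\<bar>q n\<bar> / real (Suc n))"
    proof (intro always_eventually allI, clarify)
      fix n k
      have "\<bar>abel_seq k ^ Suc n\<bar> \<le> 1" using abel_seq(1,2)[of k] by (simp add: power_le_one less_imp_le del: power_Suc)
      then have "\<bar>abel_seq k ^ Suc n\<bar> * \<bar>cos (real (Suc n) * s)\<bar> * (2 * \<bar>q n\<bar> / real (Suc n)) \<le> 1 * 1 * (2 * \<bar>q n\<bar> / real (Suc n))"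
        by (intro mult_right_mono mult_mono) auto
      then show "norm (2 * abel_seq k ^ Suc n / real (Suc n) * cos (real (Suc n) * s) * q n) \<le> 2 * (\<bar>q n\<bar> / real (Suc n))"
        by (simp add: abs_mult field_simps del: power_Suc of_nat_Suc)
    qed
    show "(\<lambda>k. 2 * abel_seq k ^ Suc n / real (Suc n) * cos (real (Suc n) * s) * q n)
        \<longlonglongrightarrow> 2 / real (Suc n) * cos (real (Suc n) * s) * q n" for n
    proof -
      have "(\<lambda>k. 2 * abel_seq k ^ Suc n / real (Suc n) * cos (real (Suc n) * s) * q n)
        \<longlonglongrightarrow> 2 * 1 ^ Suc n / real (Suc n) * cos (real (Suc n) * s) * q n"
        by (intro tendsto_intros abel_seq) auto
      then show ?thesis by simp
    qed
  qed auto
  moreover have "(\<Sum>n. 2 * abel_seq k ^ Suc n / real (Suc n) * cos (real (Suc n) * s) * q n) = (\<integral>t. abel_kernel (abel_seq k) s t * p t \<partial>ang)" for k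
    using integral_abel_kernel(2)[OF abel_seq(1,2) intp] unfolding q_def by (simp add: sums_iff)
  ultimately show "(\<integral>t. - ln (2 * \<bar>cos s - cos t\<bar>) * p t \<partial>ang) =
       (\<Sum>n. 2 / real (Suc n) * cos (real (Suc n) * s) * (\<integral>t. cos (real (Suc n) * t) * p t \<partial>ang))"
    unfolding q_def[symmetric] by (simp only: LIMSEQ_unique)
qed

lemma continuous_on_suminf:
  fixes f :: "nat \<Rightarrow> real \<Rightarrow> real"
  assumes "\<And>n. continuous_on UNIV (f n)" "\<And>n t. \<bar>f n t\<bar> \<le> B n" "summable B"
  shows "continuous_on UNIV (\<lambda>t. \<Sum>n. f n t)"
proof (rule uniform_limit_theorem)
  show "uniform_limit UNIV (\<lambda>n t. \<Sum>i<n. f i t) (\<lambda>t. \<Sum>n. f n t) sequentially"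
    using assms(2,3) by (intro Weierstrass_m_test) auto
qed (auto intro!: always_eventually continuous_on_sum assms(1))

section \<open>Fejer kernels as quotients by \<open>1 - cos t\<close>\<close>

definition dirichlet_kernel :: "nat \<Rightarrow> real \<Rightarrow> real" where
  "dirichlet_kernel k t = 1 + 2 * (\<Sum>j<k. cos (real (Suc j) * t))"

text \<open>This is \<open>n\<close> times the classical Fejer kernel of mean 1. Written as a
  trigonometric sum it extends \<open>(1 - cos (n t)) / (1 - cos t)\<close> continuously to the
  zeros of the denominator.\<close>

definition fejer_kernel :: "nat \<Rightarrow> real \<Rightarrow> real" where
  "fejer_kernel n t = (\<Sum>k<n. dirichlet_kernel k t)"

lemma cos_step: "2 * cos t * cos (real (Suc k) * t) = cos (real (Suc (Suc k)) * t) + cos (real k * t)"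
  using cos_mult_cos[of "Suc k" t 1] by (simp del: of_nat_Suc add: of_nat_Suc[of 0] mult.commute)

lemma dirichlet_kernel_eq: "(1 - cos t) * dirichlet_kernel k t = cos (real k * t) - cos (real (Suc k) * t)"
proof (induction k)
  case (Suc k)
  have "(1 - cos t) * dirichlet_kernel (Suc k) t = (1 - cos t) * dirichlet_kernel k t + 2 * cos (real (Suc k) * t) - 2 * cos t * cos (real (Suc k) * t)"
    by (simp add: dirichlet_kernel_def algebra_simps del: of_nat_Suc)
  also have "\<dots> = cos (real (Suc k) * t) - cos (real (Suc (Suc k)) * t)"
    unfolding Suc cos_step by simp
  finally show ?case .
qed (simp add: dirichlet_kernel_def)

lemma fejer_kernel_eq: "(1 - cos t) * fejer_kernel n t = 1 - cos (real n * t)"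
  by (induction n) (simp_all add: fejer_kernel_def distrib_left dirichlet_kernel_eq del: of_nat_Suc)

lemma abs_fejer_kernel_le: "\<bar>fejer_kernel n t\<bar> \<le> (real n)\<^sup>2"
proof -
  have "\<bar>dirichlet_kernel k t\<bar> \<le> 1 + 2 * real k" for k
  proof -
    have "\<bar>\<Sum>j<k. cos (real (Suc j) * t)\<bar> \<le> (\<Sum>j<k. 1)"
      by (rule order_trans[OF sum_abs sum_mono]) simp
    then show ?thesis by (simp add: dirichlet_kernel_def)
  qed
  then have "\<bar>fejer_kernel n t\<bar> \<le> (\<Sum>k<n. 1 + 2 * real k)"
    unfolding fejer_kernel_def by (intro order_trans[OF sum_abs sum_mono])
  also have "\<dots> = (real n)\<^sup>2" by (induction n) (auto simp: power2_eq_square algebra_simps)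
  finally show ?thesis .
qed

lemma fejer_kernel_0: "fejer_kernel n 0 = (real n)\<^sup>2"
  by (induction n) (auto simp: fejer_kernel_def dirichlet_kernel_def power2_eq_square algebra_simps)

lemma continuous_fejer_kernel: "continuous_on UNIV (fejer_kernel n)"
  unfolding fejer_kernel_def dirichlet_kernel_def by (intro continuous_intros)

lemma measurable_fejer_kernel [measurable]: "fejer_kernel n \<in> borel_measurable borel"
  by (intro borel_measurable_continuous_onI continuous_fejer_kernel)

lemma integral_fejer_kernel: "(\<integral>t. fejer_kernel n t \<partial>ang) = real n"
proof -
  have int: "integrable ang (\<lambda>t. cos (real (Suc j) * t))" for j
    by (intro integrable_ang_continuous continuous_intros)
  have "(\<integral>t. dirichlet_kernel k t \<partial>ang) = 1" "integrable ang (dirichlet_kernel k)" for k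
    unfolding dirichlet_kernel_def using int integral_ang_cos[of "Suc _"] ang.prob_space
    by (auto simp del: of_nat_Suc)
  then show ?thesis unfolding fejer_kernel_def by simp
qed

lemma fejer_kernel_nonneg: "cos t \<noteq> 1 \<Longrightarrow> 0 \<le> fejer_kernel n t"
proof -
  assume "cos t \<noteq> 1"
  then have "0 < 1 - cos t" using cos_le_one[of t] by linarith
  moreover have "0 \<le> (1 - cos t) * fejer_kernel n t" by (simp add: fejer_kernel_eq)
  ultimately show ?thesis by (simp add: zero_le_mult_iff)
qed

subsection \<open>Cosine series\<close>

definition cos_series :: "(nat \<Rightarrow> real) \<Rightarrow> real \<Rightarrow> real" where
  "cos_series d t = (\<Sum>n. d n * cos (real (Suc n) * t))"

lemma abs_mult_cos_le: "\<bar>a * cos x\<bar> \<le> \<bar>a\<bar>" for a x :: real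
  by (simp add: abs_mult mult_left_le)

lemma summable_mult_cos:
  fixes d :: "nat \<Rightarrow> real"
  assumes "summable (\<lambda>n. \<bar>d n\<bar>)"
  shows "summable (\<lambda>n. d n * cos (real (Suc n) * t))"
  by (rule summable_comparison_test[OF _ assms]) (auto intro!: exI[of _ 0] abs_mult_cos_le simp del: of_nat_Suc)

lemma continuous_cos_series:
  assumes "summable (\<lambda>n. \<bar>d n\<bar>)"
  shows "continuous_on UNIV (cos_series d)"
  unfolding cos_series_def
  by (rule continuous_on_suminf[OF _ _ assms]) (auto intro!: continuous_intros abs_mult_cos_le simp del: of_nat_Suc)

lemma integral_cos_series:
  assumes "summable (\<lambda>n. \<bar>d n\<bar>)"
  shows "(\<integral>t. cos_series d t * cos (real m * t) \<partial>ang) = (if m = 0 then 0 else d (m - 1) / 2)"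
proof -
  have [measurable]: "cos_series d \<in> borel_measurable borel"
    using continuous_cos_series[OF assms] by (rule borel_measurable_continuous_onI)
  have "(\<lambda>n. \<integral>t. d n * cos (real (Suc n) * t) * cos (real m * t) \<partial>ang) sums (\<integral>t. cos_series d t * cos (real m * t) \<partial>ang)"
  proof (rule integral_ang_sums(2)[OF _ _ _ assms])
    show "AE t in ang. (\<lambda>n. d n * cos (real (Suc n) * t)) sums cos_series d t"
      unfolding cos_series_def using summable_mult_cos[OF assms] by (intro AE_I2 summable_sums)
  qed (auto intro!: abs_mult_cos_le integrable_ang_continuous continuous_intros simp del: of_nat_Suc)
  moreover have "(\<integral>t. d n * cos (real (Suc n) * t) * cos (real m * t) \<partial>ang) = (if n = m - 1 then (if m = 0 then 0 else d (m - 1) / 2) else 0)" for n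
    unfolding mult.assoc integral_mult_right_zero integral_ang_cos_cos by auto
  ultimately have "(\<lambda>n. if n = m - 1 then (if m = 0 then 0 else d (m - 1) / 2) else 0) sums (\<integral>t. cos_series d t * cos (real m * t) \<partial>ang)"
    by (simp only:)
  moreover have "(\<lambda>n. if n = m - 1 then (if m = 0 then 0 else d (m - 1) / 2) else 0) sums (if m = 0 then 0 else d (m - 1) / 2)"
    by (rule sums_single)
  ultimately show ?thesis by (rule sums_unique2)
qed

lemma summable_weight_mono:
  fixes d :: "nat \<Rightarrow> real"
  assumes "summable (\<lambda>n. (real (Suc n))\<^sup>2 * \<bar>d n\<bar>)"
  shows "summable (\<lambda>n. \<bar>real (Suc n) * d n\<bar>)" "summable (\<lambda>n. \<bar>d n\<bar>)"
proof -
  have "real (Suc n) * \<bar>d n\<bar> \<le> (real (Suc n))\<^sup>2 * \<bar>d n\<bar>" "1 * \<bar>d n\<bar> \<le> (real (Suc n))\<^sup>2 * \<bar>d n\<bar>" for n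
    by (intro mult_right_mono self_le_power one_le_power; simp)+
  then show "summable (\<lambda>n. \<bar>real (Suc n) * d n\<bar>)" "summable (\<lambda>n. \<bar>d n\<bar>)"
    by (intro summable_comparison_test[OF _ assms]; simp add: abs_mult del: of_nat_Suc)+
qed

text \<open>Termwise, \<open>cos (n s)\<close> minus the average of \<open>cos (n (s + t))\<close>
  and \<open>cos (n (s - t))\<close> is \<open>cos (n s) (1 - cos (n t))\<close>. So this is a
  symmetric second difference of \<open>cos_series d\<close> at \<open>s\<close> divided by
  \<open>1 - cos t\<close>, in a form that remains meaningful at \<open>t = 0\<close>.\<close>

definition fejer_series :: "(nat \<Rightarrow> real) \<Rightarrow> real \<Rightarrow> real \<Rightarrow> real" where
  "fejer_series d s t = (\<Sum>n. d n * cos (real (Suc n) * s) * fejer_kernel (Suc n) t)"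

context
  fixes d :: "nat \<Rightarrow> real"
  assumes sd: "summable (\<lambda>n. (real (Suc n))\<^sup>2 * \<bar>d n\<bar>)"
begin

lemma fejer_series_bound:
  "\<bar>d n * cos (real (Suc n) * s) * fejer_kernel (Suc n) t\<bar> \<le> (real (Suc n))\<^sup>2 * \<bar>d n\<bar>"
proof -
  have "\<bar>d n * cos (real (Suc n) * s)\<bar> * \<bar>fejer_kernel (Suc n) t\<bar> \<le> \<bar>d n\<bar> * (real (Suc n))\<^sup>2"
    by (intro mult_mono abs_mult_cos_le abs_fejer_kernel_le) auto
  then show ?thesis by (simp add: abs_mult mult.commute)
qed

lemma summable_fejer_series: "summable (\<lambda>n. d n * cos (real (Suc n) * s) * fejer_kernel (Suc n) t)"
  by (rule summable_comparison_test[OF _ sd]) (auto intro!: exI[of _ 0] fejer_series_bound simp del: of_nat_Suc)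

lemma continuous_fejer_series: "continuous_on UNIV (fejer_series d s)"
  unfolding fejer_series_def
  by (rule continuous_on_suminf[OF _ fejer_series_bound sd]) (intro continuous_intros continuous_fejer_kernel)

lemma fejer_series_0_0: "fejer_series d 0 0 = (\<Sum>n. (real (Suc n))\<^sup>2 * d n)"
  by (simp add: fejer_series_def fejer_kernel_0 mult.commute del: of_nat_Suc)

lemma fejer_series_eq:
  "(1 - cos t) * fejer_series d s t = cos_series d s - (cos_series d (s + t) + cos_series d (s - t)) / 2"
proof -
  note sm = summable_mult_cos[OF summable_weight_mono(2)[OF sd]]
  have "(1 - cos t) * fejer_series d s t = (\<Sum>n. (1 - cos t) * (d n * cos (real (Suc n) * s) * fejer_kernel (Suc n) t))"
    unfolding fejer_series_def by (rule suminf_mult[OF summable_fejer_series, symmetric])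
  also have "\<dots> = (\<Sum>n. d n * cos (real (Suc n) * s) - (d n * cos (real (Suc n) * (s + t)) + d n * cos (real (Suc n) * (s - t))) / 2)"
  proof (rule suminf_cong)
    fix n
    have "(1 - cos t) * (d n * cos (real (Suc n) * s) * fejer_kernel (Suc n) t) = d n * cos (real (Suc n) * s) * (1 - cos (real (Suc n) * t))"
      unfolding fejer_kernel_eq[symmetric] by (simp only: ac_simps)
    also have "\<dots> = d n * cos (real (Suc n) * s) - (d n * cos (real (Suc n) * (s + t)) + d n * cos (real (Suc n) * (s - t))) / 2"
      unfolding distrib_left[of "real (Suc n)"] right_diff_distrib[of "real (Suc n)"] cos_add cos_diff
      by (simp add: field_simps del: of_nat_Suc)
    finally show "(1 - cos t) * (d n * cos (real (Suc n) * s) * fejer_kernel (Suc n) t) = \<dots>" .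
  qed
  also have "\<dots> = cos_series d s - (cos_series d (s + t) + cos_series d (s - t)) / 2"
    unfolding cos_series_def
    by (rule sums_unique[symmetric]) (intro sums_diff sums_divide sums_add summable_sums sm)
  finally show ?thesis .
qed

lemma integral_fejer_series:
  "integrable ang (fejer_series d s)"
  "(\<integral>t. fejer_series d s t \<partial>ang) = (\<Sum>n. real (Suc n) * d n * cos (real (Suc n) * s))"
proof -
  show "integrable ang (fejer_series d s)" by (rule integrable_ang_continuous[OF continuous_fejer_series])
  have [measurable]: "fejer_series d s \<in> borel_measurable borel"
    by (rule borel_measurable_continuous_onI[OF continuous_fejer_series])
  have "(\<lambda>n. \<integral>t. d n * cos (real (Suc n) * s) * fejer_kernel (Suc n) t * 1 \<partial>ang) sums (\<integral>t. fejer_series d s t * 1 \<partial>ang)"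
    by (rule integral_ang_sums(2)[OF _ _ fejer_series_bound sd])
       (auto simp: fejer_series_def simp del: of_nat_Suc intro: AE_I2 summable_sums[OF summable_fejer_series])
  then have "(\<lambda>n. real (Suc n) * d n * cos (real (Suc n) * s)) sums (\<integral>t. fejer_series d s t \<partial>ang)"
    by (simp add: integral_fejer_kernel mult_ac del: of_nat_Suc)
  then show "(\<integral>t. fejer_series d s t \<partial>ang) = (\<Sum>n. real (Suc n) * d n * cos (real (Suc n) * s))"
    by (simp add: sums_iff)
qed

text \<open>By \<open>one\<close>, the weight is \<open>\<Sum>n. n d_n (1 - cos (n t))\<close>, so
  division by \<open>1 - cos t\<close> turns each term into a multiple of a Fejer kernel. Exchanging
  sum and integral rests on the mean \<open>n\<close> of the kernel, not on its maximum
  \<open>n^2\<close>: the latter would ask for summability of \<open>n^3 |d_n|\<close>.\<close>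

lemma integral_weight_fejer:
  assumes one: "(\<Sum>n. real (Suc n) * d n) = 1"
  defines "p \<equiv> \<lambda>t. 1 - (\<Sum>n. real (Suc n) * d n * cos (real (Suc n) * t))"
  shows "integrable ang (\<lambda>t. p t / (1 - cos t))"
    "(\<integral>t. p t / (1 - cos t) \<partial>ang) = (\<Sum>n. (real (Suc n))\<^sup>2 * d n)"
proof -
  define f where "f n t = real (Suc n) * d n * fejer_kernel (Suc n) t" for n t
  note s1 = summable_weight_mono(1)[OF sd]
  have int: "integrable ang (f n)" for n unfolding f_def
    by (intro integrable_ang_continuous continuous_intros continuous_fejer_kernel)
  have [measurable]: "f n \<in> borel_measurable borel" for n unfolding f_def by measurable
  have "p = (\<lambda>t. 1 - cos_series (\<lambda>n. real (Suc n) * d n) t)"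
    by (simp add: p_def cos_series_def)
  then have [measurable]: "p \<in> borel_measurable borel"
    using continuous_cos_series[OF s1] by (auto intro!: borel_measurable_continuous_onI continuous_intros)
  have pt: "(\<lambda>n. f n t) sums (p t / (1 - cos t))" if "cos t \<noteq> 1" for t
  proof -
    have "(\<lambda>n. real (Suc n) * d n - real (Suc n) * d n * cos (real (Suc n) * t)) sums (1 - (\<Sum>n. real (Suc n) * d n * cos (real (Suc n) * t)))"
      using summable_mult_cos[OF s1] summable_rabs_cancel[OF s1] one
      by (intro sums_diff) (auto simp: sums_iff simp del: of_nat_Suc)
    then have "(\<lambda>n. (real (Suc n) * d n - real (Suc n) * d n * cos (real (Suc n) * t)) / (1 - cos t)) sums (p t / (1 - cos t))"
      unfolding p_def by (rule sums_divide)
    moreover have "(real (Suc n) * d n - real (Suc n) * d n * cos (real (Suc n) * t)) / (1 - cos t) = f n t" for n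
    proof -
      have "real (Suc n) * d n - real (Suc n) * d n * cos (real (Suc n) * t) = real (Suc n) * d n * (1 - cos (real (Suc n) * t))"
        by (simp add: algebra_simps del: of_nat_Suc)
      also have "\<dots> = (1 - cos t) * f n t"
        unfolding f_def fejer_kernel_eq[symmetric] by (simp only: ac_simps)
      finally show ?thesis using that by simp
    qed
    ultimately show ?thesis by simp
  qed
  have abs_f: "AE t in ang. norm (f n t) = \<bar>real (Suc n) * d n\<bar> * fejer_kernel (Suc n) t" for n
    using AE_ang_cos_neq[of 1]
    by eventually_elim (simp add: f_def abs_mult fejer_kernel_nonneg del: of_nat_Suc)
  have norm_f: "(\<integral>t. norm (f n t) \<partial>ang) = (real (Suc n))\<^sup>2 * \<bar>d n\<bar>" for n
  proof -
    have "(\<integral>t. norm (f n t) \<partial>ang) = (\<integral>t. \<bar>real (Suc n) * d n\<bar> * fejer_kernel (Suc n) t \<partial>ang)"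
      by (rule integral_cong_AE) (use abs_f in auto)
    then show ?thesis by (simp add: integral_fejer_kernel abs_mult power2_eq_square del: of_nat_Suc)
  qed
  \<comment> \<open>For a fixed \<open>t\<close> with \<open>cos t \<noteq> 1\<close> the majorant
    \<open>2 |n d_n| / (1 - cos t)\<close> suffices; it is not integrable in \<open>t\<close>, which
    is why \<open>si\<close> is obtained separately.\<close>
  have sn: "AE t in ang. summable (\<lambda>n. norm (f n t))"
    using AE_ang_cos_neq[of 1]
  proof eventually_elim
    case (elim t)
    have "norm (\<bar>real (Suc n) * d n\<bar> * (1 - cos (real (Suc n) * t))) \<le> 2 * \<bar>real (Suc n) * d n\<bar>" for n
    proof -
      have "\<bar>1 - cos (real (Suc n) * t)\<bar> \<le> 2"
        using cos_ge_minus_one[of "real (Suc n) * t"] cos_le_one[of "real (Suc n) * t"] by linarith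
      then have "\<bar>real (Suc n) * d n\<bar> * \<bar>1 - cos (real (Suc n) * t)\<bar> \<le> \<bar>real (Suc n) * d n\<bar> * 2"
        by (rule mult_left_mono) simp
      then show ?thesis by (simp only: real_norm_def abs_mult abs_abs mult.commute)
    qed
    then have "summable (\<lambda>n. \<bar>real (Suc n) * d n\<bar> * (1 - cos (real (Suc n) * t)))"
      by (intro summable_comparison_test[OF _ summable_mult[OF s1, of 2]] exI[of _ 0] allI impI)
    then have "summable (\<lambda>n. \<bar>real (Suc n) * d n\<bar> * (1 - cos (real (Suc n) * t)) / (1 - cos t))" by (rule summable_divide)
    moreover have "norm (f n t) = \<bar>real (Suc n) * d n\<bar> * (1 - cos (real (Suc n) * t)) / (1 - cos t)" for n
      using elim fejer_kernel_nonneg[OF elim, of "Suc n"]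
      by (simp add: f_def abs_mult fejer_kernel_eq[of t "Suc n", symmetric] del: of_nat_Suc)
    ultimately show ?case by (simp only:)
  qed
  have si: "summable (\<lambda>n. \<integral>t. norm (f n t) \<partial>ang)" unfolding norm_f by (rule sd)
  have eq: "AE t in ang. (\<Sum>n. f n t) = p t / (1 - cos t)"
    using AE_ang_cos_neq[of 1] by eventually_elim (rule sums_unique[symmetric, OF pt])
  have 1: "integrable ang (\<lambda>t. \<Sum>n. f n t)" by (rule integrable_suminf[OF int sn si])
  show "integrable ang (\<lambda>t. p t / (1 - cos t))"
    using 1 by (rule integrable_cong_AE_imp) (use eq in \<open>auto elim: AE_mp\<close>)
  have "(\<lambda>n. \<integral>t. f n t \<partial>ang) sums (\<integral>t. (\<Sum>n. f n t) \<partial>ang)" by (rule sums_integral[OF int sn si])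
  moreover have "(\<integral>t. (\<Sum>n. f n t) \<partial>ang) = (\<integral>t. p t / (1 - cos t) \<partial>ang)"
    by (intro integral_cong_AE eq) measurable
  moreover have "(\<integral>t. f n t \<partial>ang) = (real (Suc n))\<^sup>2 * d n" for n
    by (simp add: f_def integral_fejer_kernel power2_eq_square mult_ac del: of_nat_Suc)
  ultimately show "(\<integral>t. p t / (1 - cos t) \<partial>ang) = (\<Sum>n. (real (Suc n))\<^sup>2 * d n)" by (simp add: sums_iff)
qed

end

section \<open>Chebyshev polynomials and the completeness of their moments\<close>

lemma cheb_cos: "cheb n (cos t) = cos (real n * t)"
proof (induction n rule: induct_nat_012)
  case (ge2 n)
  then show ?case using cos_step[of t n] by (simp del: of_nat_Suc)
qed auto

lemma continuous_cheb: "continuous_on UNIV (cheb n)"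
proof (induction n rule: induct_nat_012)
  case (ge2 n)
  then show ?case by (auto intro!: continuous_intros)
qed (auto intro!: continuous_intros)

lemma abs_cheb_le: "\<bar>x\<bar> \<le> 1 \<Longrightarrow> \<bar>cheb n x\<bar> \<le> 1"
  using cheb_cos[of n "arccos x"] by (simp add: abs_le_iff)

text \<open>Chebyshev polynomials span all polynomials, so vanishing Chebyshev moments pass to powers.\<close>
lemma cheb_moments_imp_power_moments:
  fixes L :: "(real \<Rightarrow> real) \<Rightarrow> real"
  assumes add: "\<And>f g. continuous_on UNIV f \<Longrightarrow> continuous_on UNIV g \<Longrightarrow> L (\<lambda>x. f x + g x) = L f + L g"
    and scale: "\<And>c f. continuous_on UNIV f \<Longrightarrow> L (\<lambda>x. c * f x) = c * L f"
    and zero: "\<And>n. L (cheb n) = 0"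
  shows "L (\<lambda>x. x ^ m) = 0"
proof -
  \<comment> \<open>The Chebyshev factor makes the induction on \<open>m\<close> close:
    \<open>x T_n = (T_(n+1) + T_(n-1)) / 2\<close> trades one power of \<open>x\<close> for
    neighbouring indices. At \<open>n = 0\<close> the index \<open>n - 1\<close> would truncate, and
    \<open>x T_0 = T_1\<close> is used instead.\<close>
  have "L (\<lambda>x. x ^ m * cheb n x) = 0" for n
  proof (induction m arbitrary: n)
    case (Suc m)
    have x: "x * cheb n x = (cheb (Suc n) x + cheb (n - 1) x) / 2" if "n > 0" for x
      using that by (cases n) auto
    show ?case
    proof (cases "n = 0")
      case True
      have "(\<lambda>x. x ^ Suc m * cheb n x) = (\<lambda>x. x ^ m * cheb 1 x)" by (simp add: True fun_eq_iff mult.commute)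
      then show ?thesis by (simp only: Suc)
    next
      case False
      have "(\<lambda>x. x ^ Suc m * cheb n x) = (\<lambda>x. (1/2) * (x ^ m * cheb (Suc n) x) + (1/2) * (x ^ m * cheb (n - 1) x))"
      proof
        fix y
        have "y ^ Suc m * cheb n y = y ^ m * (y * cheb n y)" by simp
        then show "y ^ Suc m * cheb n y = (1/2) * (y ^ m * cheb (Suc n) y) + (1/2) * (y ^ m * cheb (n - 1) y)"
          using False by (simp add: x field_simps del: cheb.simps)
      qed
      moreover have "continuous_on UNIV (\<lambda>x. x ^ m * cheb k x)" for k
        by (intro continuous_intros continuous_cheb)
      then have "L (\<lambda>x. (1/2) * (x ^ m * cheb (Suc n) x) + (1/2) * (x ^ m * cheb (n - 1) x)) =
          (1/2) * L (\<lambda>x. x ^ m * cheb (Suc n) x) + (1/2) * L (\<lambda>x. x ^ m * cheb (n - 1) x)"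
        by (subst add; (intro continuous_intros continuous_cheb)?) (simp only: scale)
      ultimately show ?thesis by (simp only: Suc)
    qed
  qed (use zero in simp)
  from this[of 0] show ?thesis by simp
qed

text \<open>\<open>G (cos t)\<close> is orthogonal to all polynomials in \<open>cos t\<close>, so
  its squared norm equals the integral of \<open>G (G - g)\<close> for any polynomial
  \<open>g\<close>. Choosing \<open>g\<close> uniformly close to \<open>G\<close> makes this
  arbitrarily small, and a continuous function of norm 0 vanishes.\<close>

lemma cheb_moments_imp_zero:
  assumes G: "continuous_on {-1..1} G"
    and zero: "\<And>n. (\<integral>t. G (cos t) * cos (real n * t) \<partial>ang) = 0" and x: "x \<in> {-1..1}"
  shows "G x = 0"
proof -
  have contG: "continuous_on UNIV (\<lambda>t. G (cos t))"
    by (rule continuous_on_compose2[OF G]) (auto intro!: continuous_intros)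
  have int: "integrable ang (\<lambda>t. G (cos t) * f (cos t))" if "continuous_on UNIV f" for f
    by (intro integrable_ang_continuous continuous_intros contG continuous_on_compose2[OF that]) auto
  have pow: "(\<integral>t. G (cos t) * (cos t) ^ m \<partial>ang) = 0" for m
    by (rule cheb_moments_imp_power_moments[of "\<lambda>f. \<integral>t. G (cos t) * f (cos t) \<partial>ang"])
       (use zero int in \<open>auto simp: cheb_cos distrib_left mult.left_commute\<close>)
  define K where "K = (\<integral>t. \<bar>G (cos t)\<bar> \<partial>ang)"
  have K: "0 \<le> K" by (simp add: K_def)
  have "(\<integral>t. (G (cos t))\<^sup>2 \<partial>ang) \<le> e" if e: "e > 0" for e
  proof -
    \<comment> \<open>The \<open>+ 1\<close> covers the case \<open>K = 0\<close>.\<close>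
    define e' where "e' = e / (K + 1)"
    have e': "e' > 0" "K * e' \<le> e" using e K by (auto simp: e'_def field_simps)
    obtain g where g: "real_polynomial_function g" "\<And>y. y \<in> {-1..1} \<Longrightarrow> \<bar>G y - g y\<bar> < e'"
      using Stone_Weierstrass_real_polynomial_function[OF _ G e'(1)] by auto
    then obtain a N where gs: "g = (\<lambda>x. \<Sum>i\<le>N. a i * x ^ i)" by (auto simp: real_polynomial_function_iff_sum)
    have [continuous_intros]: "continuous_on A g" for A unfolding gs by (intro continuous_intros)
    have intp: "integrable ang (\<lambda>t. G (cos t) * cos t ^ i)" for i by (intro int[of "\<lambda>x. x ^ i"] continuous_intros)
    have "(\<integral>t. G (cos t) * g (cos t) \<partial>ang) = (\<integral>t. (\<Sum>i\<le>N. a i * (G (cos t) * cos t ^ i)) \<partial>ang)"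
      by (simp add: gs sum_distrib_left mult_ac)
    also have "\<dots> = 0" using intp pow by simp
    finally have g0: "(\<integral>t. G (cos t) * g (cos t) \<partial>ang) = 0" .
    have "(\<integral>t. (G (cos t))\<^sup>2 \<partial>ang) = (\<integral>t. (G (cos t))\<^sup>2 \<partial>ang) - (\<integral>t. G (cos t) * g (cos t) \<partial>ang)"
      by (simp add: g0)
    also have "\<dots> = (\<integral>t. (G (cos t))\<^sup>2 - G (cos t) * g (cos t) \<partial>ang)"
      by (rule Bochner_Integration.integral_diff[symmetric]) (intro integrable_ang_continuous continuous_intros contG int)+
    also have "\<dots> \<le> (\<integral>t. \<bar>G (cos t)\<bar> * e' \<partial>ang)"
    proof (rule integral_mono)
      fix t
      have "(G (cos t))\<^sup>2 - G (cos t) * g (cos t) = G (cos t) * (G (cos t) - g (cos t))"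
        by (simp add: power2_eq_square algebra_simps)
      also have "\<dots> \<le> \<bar>G (cos t)\<bar> * \<bar>G (cos t) - g (cos t)\<bar>" by (metis abs_ge_self abs_mult)
      also have "\<dots> \<le> \<bar>G (cos t)\<bar> * e'" using g(2)[of "cos t"] by (intro mult_left_mono) auto
      finally show "(G (cos t))\<^sup>2 - G (cos t) * g (cos t) \<le> \<bar>G (cos t)\<bar> * e'" .
    next
      show "integrable ang (\<lambda>t. (G (cos t))\<^sup>2 - G (cos t) * g (cos t))"
        by (intro integrable_ang_continuous continuous_intros contG continuous_on_compose2[of UNIV g]) auto
      show "integrable ang (\<lambda>t. \<bar>G (cos t)\<bar> * e')"
        by (intro integrable_ang_continuous continuous_intros contG)
    qed
    also have "\<dots> = K * e'" by (simp add: K_def)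
    finally show ?thesis using e' by linarith
  qed
  then have "(\<integral>t. (G (cos t))\<^sup>2 \<partial>ang) \<le> 0" by (rule field_le_epsilon[where y = 0, simplified])
  moreover have "(\<integral>t. (G (cos t))\<^sup>2 \<partial>ang) \<ge> 0" by simp
  ultimately have "(\<integral>t. (G (cos t))\<^sup>2 \<partial>ang) = 0" by linarith
  moreover have "(\<lambda>t. (G (cos t))\<^sup>2) \<in> borel_measurable borel"
    by (intro borel_measurable_continuous_onI continuous_intros contG)
  moreover have cont: "continuous_on A (\<lambda>t. (G (cos t))\<^sup>2)" for A
    by (intro continuous_intros continuous_on_subset[OF contG]) auto
  \<comment> \<open>The gauge integral is used to pass from a zero integral of a nonnegative
    continuous function to its vanishing at the single angle \<open>arccos x\<close>.\<close>
  moreover have "(LINT t:{0..pi}|lborel. (G (cos t))\<^sup>2) = integral {0..pi} (\<lambda>t. (G (cos t))\<^sup>2)"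
    by (intro set_borel_integral_eq_integral) (unfold set_integrable_def, rule borel_integrable_compact[OF compact_Icc cont])
  ultimately have "integral {0..pi} (\<lambda>t. (G (cos t))\<^sup>2) = 0" by (simp add: integral_ang)
  moreover have "(\<lambda>t. (G (cos t))\<^sup>2) integrable_on {0..pi}" by (intro integrable_continuous_real cont)
  ultimately have hi: "((\<lambda>t. (G (cos t))\<^sup>2) has_integral 0) (cbox 0 pi)"
    by (metis box_real(2) integrable_integral)
  have "(G (cos (arccos x)))\<^sup>2 = 0"
    by (rule has_integral_0_cbox_imp_0[OF cont _ hi]) (use x arccos_bounded[of x] pi_gt_zero in \<open>auto simp: box_real not_le\<close>)
  then show ?thesis using x by simp
qed

subsection \<open>Even convex potentials on an interval\<close>

lemma integral_ang_sum_sin: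
  assumes "K \<le> n"
  shows "(\<integral>t. (\<Sum>k<K. a k * sin (real (Suc k) * t)) * sin (real (Suc n) * t) \<partial>ang) = 0"
proof -
  have int: "integrable ang (\<lambda>t. a k * (sin (real (Suc k) * t) * sin (real (Suc n) * t)))" for k
    by (intro integrable_ang_continuous continuous_intros)
  have "(\<integral>t. (\<Sum>k<K. a k * sin (real (Suc k) * t)) * sin (real (Suc n) * t) \<partial>ang)
     = (\<integral>t. (\<Sum>k<K. a k * (sin (real (Suc k) * t) * sin (real (Suc n) * t))) \<partial>ang)"
    by (simp only: sum_distrib_right mult.assoc)
  also have "\<dots> = (\<Sum>k<K. a k * (\<integral>t. sin (real (Suc k) * t) * sin (real (Suc n) * t) \<partial>ang))"
    by (subst Bochner_Integration.integral_sum[OF int]) (simp only: integral_mult_right_zero)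
  also have "\<dots> = 0" using assms by (intro sum.neutral) (auto simp: integral_ang_sin_sin simp del: of_nat_Suc)
  finally show ?thesis .
qed

text \<open>Bessel's inequality. The sines are orthogonal with squared norm 1/2, so subtracting the
  partial sum lowers the squared norm of \<open>g\<close> by half the sum of the squared
  coefficients.\<close>

lemma summable_sin_coeff_squares:
  assumes g: "continuous_on UNIV g"
  shows "summable (\<lambda>n. (2 * (\<integral>t. g t * sin (real (Suc n) * t) \<partial>ang))\<^sup>2)"
proof -
  define a where "a n = 2 * (\<integral>t. g t * sin (real (Suc n) * t) \<partial>ang)" for n
  define h where "h K t = g t - (\<Sum>k<K. a k * sin (real (Suc k) * t))" for K t
  have ch: "continuous_on UNIV (h K)" for K unfolding h_def by (intro continuous_intros g)
  have eq: "(\<integral>t. (h K t)\<^sup>2 \<partial>ang) = (\<integral>t. (g t)\<^sup>2 \<partial>ang) - (\<Sum>k<K. (a k)\<^sup>2) / 2" for K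
  proof (induction K)
    case (Suc K)
    let ?s = "\<lambda>t. sin (real (Suc K) * t)"
    have i1: "integrable ang (\<lambda>t. (h K t)\<^sup>2)" "integrable ang (\<lambda>t. 2 * a K * (h K t * ?s t))"
       "integrable ang (\<lambda>t. (a K)\<^sup>2 * (?s t * ?s t))" "integrable ang (\<lambda>t. g t * ?s t)"
       "integrable ang (\<lambda>t. (\<Sum>k<K. a k * sin (real (Suc k) * t)) * ?s t)"
      by (intro integrable_ang_continuous continuous_intros ch g)+
    have "(\<integral>t. h K t * ?s t \<partial>ang) = (\<integral>t. g t * ?s t - (\<Sum>k<K. a k * sin (real (Suc k) * t)) * ?s t \<partial>ang)"
      by (simp add: h_def left_diff_distrib)
    also have "\<dots> = (\<integral>t. g t * ?s t \<partial>ang) - (\<integral>t. (\<Sum>k<K. a k * sin (real (Suc k) * t)) * ?s t \<partial>ang)"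
      by (rule Bochner_Integration.integral_diff[OF i1(4,5)])
    also have "\<dots> = a K / 2" unfolding integral_ang_sum_sin[OF order_refl] by (simp add: a_def)
    finally have hs: "(\<integral>t. h K t * ?s t \<partial>ang) = a K / 2" .
    have "(h (Suc K) t)\<^sup>2 = (h K t)\<^sup>2 - 2 * a K * (h K t * ?s t) + (a K)\<^sup>2 * (?s t * ?s t)" for t
      unfolding h_def by (simp add: power2_eq_square algebra_simps del: of_nat_Suc)
    then have "(\<integral>t. (h (Suc K) t)\<^sup>2 \<partial>ang) = (\<integral>t. (h K t)\<^sup>2 \<partial>ang) - 2 * a K * (\<integral>t. h K t * ?s t \<partial>ang) + (a K)\<^sup>2 * (\<integral>t. ?s t * ?s t \<partial>ang)"
      using i1 by (simp add: Bochner_Integration.integral_add Bochner_Integration.integral_diff del: of_nat_Suc)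
    also have "(\<integral>t. ?s t * ?s t \<partial>ang) = 1/2" by (subst integral_ang_sin_sin) auto
    also have "(\<integral>t. (h K t)\<^sup>2 \<partial>ang) - 2 * a K * (\<integral>t. h K t * ?s t \<partial>ang) + (a K)\<^sup>2 * (1/2)
        = (\<integral>t. (g t)\<^sup>2 \<partial>ang) - (\<Sum>k<Suc K. (a k)\<^sup>2) / 2"
      unfolding Suc hs by (simp add: power2_eq_square add_divide_distrib)
    finally show ?case .
  qed (simp add: h_def)
  have "(\<Sum>k<K. (a k)\<^sup>2) \<le> 2 * (\<integral>t. (g t)\<^sup>2 \<partial>ang)" for K
  proof -
    have "0 \<le> (\<integral>t. (h K t)\<^sup>2 \<partial>ang)" by simp
    then show ?thesis by (simp add: eq)
  qed
  then have "summable (\<lambda>k. (a k)\<^sup>2)" by (intro summableI_nonneg_bounded) auto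
  then show ?thesis by (simp add: a_def)
qed

locale even_convex_potential =
  fixes V V1 V2 V3 :: "real \<Rightarrow> real"
  assumes deriv1: "(V has_real_derivative V1 x) (at x)"
    and deriv2: "(V1 has_real_derivative V2 x) (at x)"
    and deriv3: "(V2 has_real_derivative V3 x) (at x)"
    and cont3: "continuous_on UNIV V3"
    and even: "V (- x) = V x"
    and convex: "convex_on UNIV V"
begin

lemma cont: "continuous_on UNIV V" "continuous_on UNIV V1" "continuous_on UNIV V2"
  using deriv1 deriv2 deriv3 by (auto simp: continuous_on_eq_continuous_at intro: DERIV_isCont)

lemma cont_comp:
  assumes "continuous_on A f"
  shows "continuous_on A (\<lambda>x. V (f x))" "continuous_on A (\<lambda>x. V1 (f x))" "continuous_on A (\<lambda>x. V2 (f x))" "continuous_on A (\<lambda>x. V3 (f x))"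
  using assms cont cont3 by (auto intro: continuous_on_compose2)

lemma measurable_V [measurable]: "V \<in> borel_measurable borel"
  by (rule borel_measurable_continuous_onI[OF cont(1)])

lemma V_abs: "V \<bar>x\<bar> = V x"
  using even[of x] by (simp add: abs_if)

lemma above_tangent: "V1 c * (x - c) \<le> V x - V c"
  by (rule convex_on_imp_above_tangent[OF convex]) (auto intro: deriv1)

lemma V1_mono: "x \<le> y \<Longrightarrow> V1 x \<le> V1 y"
proof (cases "x = y")
  case False
  assume "x \<le> y"
  with False have "x < y" by simp
  moreover have "V1 x * (y - x) \<le> V1 y * (y - x)"
    using above_tangent[of x y] above_tangent[of y x] by (simp add: algebra_simps)
  ultimately show ?thesis by simp
qed simp

lemma V1_odd: "V1 (- x) = - V1 x"
proof -
  have "((\<lambda>x. V (- x)) has_real_derivative V1 (- (- x)) * (- 1)) (at (- x))"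
    by (rule DERIV_chain2[where f = V, OF deriv1]) (auto intro!: derivative_eq_intros)
  then have "(V has_real_derivative - V1 x) (at (- x))" by (simp add: even)
  then show ?thesis using deriv1 DERIV_unique by blast
qed

lemma V1_nonneg: "0 \<le> x \<Longrightarrow> 0 \<le> V1 x"
  using V1_mono[of "- x" x] by (simp add: V1_odd)

text \<open>For \<open>0 \<le> t \<le> 1\<close> the derivative in the radius is
  \<open>V1 s - t V1 (s t)\<close>, which is nonnegative because \<open>V1\<close> is increasing and
  nonnegative on the right half-line; evenness covers negative \<open>t\<close>.\<close>

lemma V_diff_scaled_mono:
  assumes "0 \<le> a" "a \<le> b" "\<bar>t\<bar> \<le> 1"
  shows "V a - V (a * t) \<le> V b - V (b * t)"
proof -
  have *: "V a - V (a * t) \<le> V b - V (b * t)" if "0 \<le> t" "t \<le> 1" for t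
  proof (rule DERIV_nonneg_imp_nondecreasing[OF assms(2), of "\<lambda>s. V s - V (s * t)"])
    fix s assume s: "a \<le> s" "s \<le> b"
    have "((\<lambda>s. V s - V (s * t)) has_real_derivative V1 s - V1 (s * t) * t) (at s)"
      by (intro derivative_intros deriv1 DERIV_chain2[where f = V, OF deriv1]) (auto intro!: derivative_eq_intros)
    moreover have "V1 (s * t) * t \<le> V1 s"
    proof -
      have "s * t \<le> s" "0 \<le> s * t" using s assms that by (auto intro: mult_left_le)
      then have "V1 (s * t) * t \<le> V1 (s * t) * 1" by (intro mult_left_mono V1_nonneg that)
      also have "\<dots> \<le> V1 s" using V1_mono[OF \<open>s * t \<le> s\<close>] by simp
      finally show ?thesis .
    qed
    ultimately show "\<exists>y. ((\<lambda>s. V s - V (s * t)) has_real_derivative y) (at s) \<and> 0 \<le> y"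
      by (intro exI[of _ "V1 s - V1 (s * t) * t"]) simp
  qed
  have abs: "V (c * \<bar>t\<bar>) = V (c * t)" if "0 \<le> c" for c
    using V_abs[of "c * t"] that by (simp add: abs_mult)
  show ?thesis using *[of "\<bar>t\<bar>"] assms abs[of a] abs[of b] by simp
qed

lemma V_mono: "0 \<le> a \<Longrightarrow> a \<le> b \<Longrightarrow> V a \<le> V b"
  using V_diff_scaled_mono[of a b 0] by simp

section \<open>Chebyshev coefficients of the potential and their decay\<close>

definition coef0 :: "real \<Rightarrow> real" where
  "coef0 S = (\<integral>t. V (S * cos t) \<partial>ang)"

text \<open>The index is shifted: this is the coefficient of order \<open>Suc n\<close>, the
  constant one being \<open>coef0\<close>. The factor 2 is \<open>pi / h_n\<close> for positive
  order.\<close>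

definition coef :: "real \<Rightarrow> nat \<Rightarrow> real" where
  "coef S n = 2 * (\<integral>t. V (S * cos t) * cos (real (Suc n) * t) \<partial>ang)"

text \<open>The function differentiated is \<open>t \<mapsto> V (S * cos t)\<close>.\<close>

definition third_deriv :: "real \<Rightarrow> real \<Rightarrow> real" where
  "third_deriv S t = S * sin t * V1 (S * cos t) + 3 * S\<^sup>2 * sin t * cos t * V2 (S * cos t)
     - S ^ 3 * (sin t) ^ 3 * V3 (S * cos t)"

lemma continuous_third_deriv: "continuous_on UNIV (third_deriv S)"
  unfolding third_deriv_def by (intro continuous_intros cont_comp)

lemma coef_eq: "real (Suc n) ^ 3 * coef S n = 2 * (\<integral>t. third_deriv S t * sin (real (Suc n) * t) \<partial>ang)"
proof -
  define N where "N = real (Suc n)"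
  define f1 where "f1 t = - (S * sin t * V1 (S * cos t))" for t
  define f2 where "f2 t = - (S * cos t * V1 (S * cos t)) + (S * sin t)\<^sup>2 * V2 (S * cos t)" for t
  have D: "((\<lambda>t. V (S * cos t)) has_real_derivative f1 t) (at t)"
     "(f1 has_real_derivative f2 t) (at t)" "(f2 has_real_derivative third_deriv S t) (at t)" for t
  proof -
    have c: "((\<lambda>t. S * cos t) has_real_derivative - (S * sin t)) (at t)"
      by (auto intro!: derivative_eq_intros)
    note d = DERIV_chain2[where f = V, OF deriv1 c] DERIV_chain2[where f = V1, OF deriv2 c] DERIV_chain2[where f = V2, OF deriv3 c]
    show "((\<lambda>t. V (S * cos t)) has_real_derivative f1 t) (at t)"
      by (rule DERIV_cong[OF d(1)]) (simp add: f1_def)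
    show "(f1 has_real_derivative f2 t) (at t)" unfolding f1_def
      by (rule DERIV_cong, (rule derivative_intros d)+) (simp add: f2_def power2_eq_square algebra_simps)
    show "(f2 has_real_derivative third_deriv S t) (at t)" unfolding f2_def
      by (rule DERIV_cong, (rule derivative_intros d)+)
         (simp add: third_deriv_def, algebra)
  qed
  have s: "((\<lambda>t. sin (N * t)) has_real_derivative N * cos (N * t)) (at t)"
    "((\<lambda>t. cos (N * t)) has_real_derivative - (N * sin (N * t))) (at t)" for t
    by (auto intro!: derivative_eq_intros)
  \<comment> \<open>\<open>F\<close> collects the boundary terms of three integrations by parts. It
    vanishes at 0 and \<open>pi\<close>, since \<open>sin (N * t)\<close> does and \<open>f1\<close>
    contains the factor \<open>sin t\<close>.\<close>
  define F where "F t = N\<^sup>2 * (V (S * cos t) * sin (N * t)) + N * (f1 t * cos (N * t)) - f2 t * sin (N * t)" for t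
  have "(F has_real_derivative N ^ 3 * (V (S * cos t) * cos (N * t)) - third_deriv S t * sin (N * t)) (at t)" for t
    unfolding F_def
    by (rule DERIV_cong, (rule derivative_intros D s)+) (simp add: power2_eq_square power3_eq_cube algebra_simps)
  then have "(\<integral>t. N ^ 3 * (V (S * cos t) * cos (N * t)) - third_deriv S t * sin (N * t) \<partial>ang) = (F pi - F 0) / pi"
    by (rule integral_ang_FTC) (intro continuous_intros cont_comp continuous_third_deriv)
  also have "sin (N * pi) = 0" unfolding N_def by (rule sin_npi)
  then have "F pi - F 0 = 0" by (simp add: F_def f1_def)
  finally have "(\<integral>t. N ^ 3 * (V (S * cos t) * cos (N * t)) - third_deriv S t * sin (N * t) \<partial>ang) = 0" by simp
  moreover have "integrable ang (\<lambda>t. N ^ 3 * (V (S * cos t) * cos (N * t)))" "integrable ang (\<lambda>t. third_deriv S t * sin (N * t))"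
    by (intro integrable_ang_continuous continuous_intros cont_comp continuous_third_deriv)+
  ultimately have "N ^ 3 * (\<integral>t. V (S * cos t) * cos (N * t) \<partial>ang) = (\<integral>t. third_deriv S t * sin (N * t) \<partial>ang)"
    by (simp add: Bochner_Integration.integral_diff)
  then show ?thesis by (simp add: coef_def N_def)
qed

text \<open>With \<open>a n\<close> the sine coefficients of \<open>third_deriv\<close>, the terms
  are \<open>|a n| / (n + 1)\<close>, bounded by \<open>(a n)^2 + 1 / (n + 1)^2\<close> through the
  inequality of arithmetic and geometric means; the first part is summable by Bessel.\<close>

lemma summable_coef: "summable (\<lambda>n. (real (Suc n))\<^sup>2 * \<bar>coef S n\<bar>)"
proof -
  define a where "a n = 2 * (\<integral>t. third_deriv S t * sin (real (Suc n) * t) \<partial>ang)" for n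
  have "summable (\<lambda>n. (a n)\<^sup>2 + 1 / (real (Suc n))\<^sup>2)"
  proof (rule summable_add)
    show "summable (\<lambda>n. (a n)\<^sup>2)" unfolding a_def by (rule summable_sin_coeff_squares[OF continuous_third_deriv])
    show "summable (\<lambda>n. 1 / (real (Suc n))\<^sup>2)"
      using inverse_power_summable[of 2, where 'a = real] by (subst summable_Suc_iff) (simp add: field_simps)
  qed
  then show ?thesis
  proof (rule summable_comparison_test[rotated], intro exI[of _ 0] allI impI)
    fix n
    let ?N = "real (Suc n)"
    have "?N * (?N\<^sup>2 * \<bar>coef S n\<bar>) = \<bar>a n\<bar>"
      unfolding a_def coef_eq[symmetric] by (simp add: abs_mult power2_eq_square power3_eq_cube del: of_nat_Suc)
    then have eq: "?N\<^sup>2 * \<bar>coef S n\<bar> = \<bar>a n\<bar> * (1 / ?N)" by (simp add: field_simps del: of_nat_Suc)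
    have "2 * (\<bar>a n\<bar> * (1 / ?N)) \<le> (a n)\<^sup>2 + (1 / ?N)\<^sup>2"
      using zero_le_power2[of "\<bar>a n\<bar> - 1 / ?N"] by (simp only: power2_diff power2_abs)
    moreover have "0 \<le> \<bar>a n\<bar> * (1 / ?N)" by simp
    ultimately have "\<bar>a n\<bar> * (1 / ?N) \<le> (a n)\<^sup>2 + (1 / ?N)\<^sup>2" by linarith
    then show "norm (?N\<^sup>2 * \<bar>coef S n\<bar>) \<le> (a n)\<^sup>2 + 1 / ?N\<^sup>2"
      using eq by (simp add: power_divide del: of_nat_Suc)
  qed
qed

lemmas summable_coef' = summable_weight_mono[OF summable_coef]

text \<open>The series converges uniformly, so the difference of the two sides is a continuous
  function of \<open>cos t\<close>; its Chebyshev moments vanish by orthogonality, hence so does the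
  function.\<close>

lemma V_eq_cos_series: "V (S * cos t) = coef0 S + cos_series (coef S) t"
proof -
  \<comment> \<open>Clamping to \<open>[-1, 1]\<close> keeps the Chebyshev polynomials bounded by 1,
    so that the series is continuous on the whole line; at \<open>x = cos t\<close> it changes
    nothing.\<close>
  define G where "G x = V (S * x) - coef0 S - (\<Sum>n. coef S n * cheb (Suc n) (max (-1) (min 1 x)))" for x
  have Gc: "G (cos t) = V (S * cos t) - coef0 S - cos_series (coef S) t" for t
  proof -
    have "max (-1) (min 1 (cos t)) = cos t" using cos_ge_minus_one[of t] cos_le_one[of t] by simp
    then show ?thesis by (simp only: G_def cos_series_def cheb_cos)
  qed
  have "\<bar>coef S n * cheb (Suc n) (max (-1) (min 1 x))\<bar> \<le> \<bar>coef S n\<bar>" for n x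
    using abs_cheb_le[of "max (-1) (min 1 x)" "Suc n"] by (simp add: abs_mult mult_left_le del: cheb.simps)
  then have "continuous_on UNIV G" unfolding G_def
    by (intro continuous_on_diff cont_comp continuous_intros continuous_on_suminf[OF _ _ summable_coef'(2)]
        continuous_on_compose2[OF continuous_cheb]) auto
  then have cG: "continuous_on {-1..1} G" by (rule continuous_on_subset) simp
  have int: "integrable ang (\<lambda>t. V (S * cos t) * cos (real n * t))" "integrable ang (\<lambda>t. coef0 S * cos (real n * t))"
    "integrable ang (\<lambda>t. cos_series (coef S) t * cos (real n * t))" for n
    by (intro integrable_ang_continuous continuous_intros cont_comp continuous_cos_series summable_coef')+
  have "(\<integral>t. G (cos t) * cos (real n * t) \<partial>ang) = 0" for n
  proof -
    have "(\<integral>t. G (cos t) * cos (real n * t) \<partial>ang) = (\<integral>t. V (S * cos t) * cos (real n * t) \<partial>ang)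
       - coef0 S * (\<integral>t. cos (real n * t) \<partial>ang) - (\<integral>t. cos_series (coef S) t * cos (real n * t) \<partial>ang)"
      unfolding Gc left_diff_distrib using int[of n] by (simp add: Bochner_Integration.integral_diff)
    also have "\<dots> = 0"
      unfolding integral_cos_series[OF summable_coef'(2)] integral_ang_cos'
      by (cases n) (simp_all add: coef0_def coef_def del: of_nat_Suc)
    finally show ?thesis .
  qed
  from cheb_moments_imp_zero[OF cG this, of "cos t"] show ?thesis by (simp add: Gc)
qed

section \<open>The density in the angle variable and its logarithmic potential\<close>

definition pushed_weight :: "real \<Rightarrow> real \<Rightarrow> real" where
  "pushed_weight S s = 1 - cos_series (\<lambda>n. real (Suc n) * coef S n) s"

definition crit :: "real \<Rightarrow> real" where
  "crit S = (\<Sum>n. real (Suc n) * coef S n)"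

lemma continuous_pushed_weight: "continuous_on UNIV (pushed_weight S)"
  unfolding pushed_weight_def by (intro continuous_intros continuous_cos_series summable_coef')

lemma measurable_pushed_weight [measurable]: "pushed_weight S \<in> borel_measurable borel"
  by (rule borel_measurable_continuous_onI[OF continuous_pushed_weight])

lemma pushed_weight_bounded: "\<exists>B. \<forall>t. \<bar>pushed_weight S t\<bar> \<le> B"
proof -
  define d where "d n = real (Suc n) * coef S n" for n
  have s: "summable (\<lambda>n. \<bar>d n\<bar>)" unfolding d_def by (rule summable_coef')
  have "\<bar>cos_series d t\<bar> \<le> (\<Sum>n. \<bar>d n\<bar>)" for t
  proof -
    have s2: "summable (\<lambda>n. \<bar>d n * cos (real (Suc n) * t)\<bar>)"
      by (rule summable_comparison_test[OF _ s]) (auto intro!: exI[of _ 0] abs_mult_cos_le simp del: of_nat_Suc)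
    have "\<bar>cos_series d t\<bar> \<le> (\<Sum>n. \<bar>d n * cos (real (Suc n) * t)\<bar>)"
      unfolding cos_series_def by (rule summable_rabs[OF s2])
    also have "\<dots> \<le> (\<Sum>n. \<bar>d n\<bar>)" by (rule suminf_le[OF abs_mult_cos_le s2 s])
    finally show ?thesis .
  qed
  note le = this
  have "\<bar>pushed_weight S t\<bar> \<le> 1 + (\<Sum>n. \<bar>d n\<bar>)" for t
    unfolding pushed_weight_def d_def[abs_def, symmetric] using le[of t] by linarith
  then show ?thesis by blast
qed

lemma integral_pushed_weight_cos:
  "(\<integral>t. cos (real m * t) * pushed_weight S t \<partial>ang) = (if m = 0 then 1 else - (real m * coef S (m - 1)) / 2)"
proof -
  define d where "d n = real (Suc n) * coef S n" for n
  have s: "summable (\<lambda>n. \<bar>d n\<bar>)" unfolding d_def by (rule summable_coef')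
  have int: "integrable ang (\<lambda>t. cos (real m * t))" "integrable ang (\<lambda>t. cos_series d t * cos (real m * t))"
    by (intro integrable_ang_continuous continuous_intros continuous_cos_series s)+
  have "(\<integral>t. cos (real m * t) * pushed_weight S t \<partial>ang) = (\<integral>t. cos (real m * t) - cos_series d t * cos (real m * t) \<partial>ang)"
    by (simp add: pushed_weight_def d_def[abs_def] algebra_simps del: of_nat_Suc)
  also have "\<dots> = (\<integral>t. cos (real m * t) \<partial>ang) - (\<integral>t. cos_series d t * cos (real m * t) \<partial>ang)"
    by (rule Bochner_Integration.integral_diff[OF int])
  also have "\<dots> = (if m = 0 then 1 else - (real m * coef S (m - 1)) / 2)"
    unfolding integral_cos_series[OF s] integral_ang_cos' by (cases m) (simp_all add: d_def)
  finally show ?thesis .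
qed

lemma integral_pushed_weight: "(\<integral>t. pushed_weight S t \<partial>ang) = 1"
  using integral_pushed_weight_cos[of 0 S] by simp

text \<open>An even index \<open>n\<close> means the odd order \<open>Suc n\<close>, for which the
  cosine changes sign under \<open>t \<mapsto> pi - t\<close> while \<open>V (S * cos t)\<close>
  does not.\<close>

lemma coef_even: "even n \<Longrightarrow> coef S n = 0"
proof -
  assume n: "Parity.even n"
  have "cos (real (Suc n) * (pi - t)) = - cos (real (Suc n) * t)" for t
  proof -
    have "cos (real (Suc n) * (pi - t)) = cos (real (Suc n) * pi - real (Suc n) * t)" by (simp add: algebra_simps)
    also have "\<dots> = cos (real (Suc n) * pi) * cos (real (Suc n) * t)"
      unfolding cos_diff sin_npi by simp
    also have "cos (real (Suc n) * pi) = - 1" using n unfolding cos_npi by simp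
    finally show ?thesis by simp
  qed
  moreover have "V (S * cos (pi - t)) = V (S * cos t)" for t using even[of "S * cos t"] by simp
  ultimately have "(\<integral>t. V (S * cos (pi - t)) * cos (real (Suc n) * (pi - t)) \<partial>ang) = - (\<integral>t. V (S * cos t) * cos (real (Suc n) * t) \<partial>ang)"
    by simp
  moreover have "(\<integral>t. V (S * cos (pi - t)) * cos (real (Suc n) * (pi - t)) \<partial>ang) = (\<integral>t. V (S * cos t) * cos (real (Suc n) * t) \<partial>ang)"
    by (rule integral_ang_reflect) measurable
  ultimately show ?thesis by (simp add: coef_def)
qed

lemma pushed_weight_reflect: "pushed_weight S (pi - t) = pushed_weight S t"
proof -
  have "real (Suc n) * coef S n * cos (real (Suc n) * (pi - t)) = real (Suc n) * coef S n * cos (real (Suc n) * t)" for n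
  proof (cases "Parity.even n")
    case False
    have "cos (real (Suc n) * (pi - t)) = cos (real (Suc n) * pi - real (Suc n) * t)" by (simp add: algebra_simps)
    also have "\<dots> = cos (real (Suc n) * t)"
      using False unfolding cos_diff sin_npi cos_npi by simp
    finally show ?thesis by simp
  qed (simp add: coef_even)
  then show ?thesis by (simp only: pushed_weight_def cos_series_def)
qed

text \<open>The moments of the weight are \<open>- n c_n / 2\<close>, and the factor
  \<open>2 / n\<close> of the kernel turns them into \<open>- c_n\<close>: this cancellation is the
  origin of the factor \<open>n\<close> in \<open>P_R\<close>. What remains is the cosine series of
  \<open>V\<close> with its sign reversed, and \<open>ln 2 - ln S\<close> comes from the scale of
  the kernel.\<close>

lemma log_potential_inside:
  assumes S: "S > 0"
  shows "integrable ang (\<lambda>t. ln \<bar>S * cos s - S * cos t\<bar> * pushed_weight S t)"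
    "(\<integral>t. - ln \<bar>S * cos s - S * cos t\<bar> * pushed_weight S t \<partial>ang) = ln 2 - ln S + coef0 S - V (S * cos s)"
proof -
  obtain B where B: "\<And>t. \<bar>pushed_weight S t\<bar> \<le> B" using pushed_weight_bounded by blast
  have q: "(\<integral>t. cos (real (Suc n) * t) * pushed_weight S t \<partial>ang) = - (real (Suc n) * coef S n) / 2" for n
    unfolding integral_pushed_weight_cos by simp
  have "summable (\<lambda>n. \<bar>\<integral>t. cos (real (Suc n) * t) * pushed_weight S t \<partial>ang\<bar> / real (Suc n))"
    unfolding q using summable_coef'(2)[of S, THEN summable_divide, of 2]
    by (simp add: abs_mult del: of_nat_Suc)
  note pot = log_potential_cos[OF measurable_pushed_weight B this, of s]
  have ip: "integrable ang (pushed_weight S)" by (rule integrable_ang_continuous[OF continuous_pushed_weight])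
  have ae: "AE t in ang. ln \<bar>S * cos s - S * cos t\<bar> * pushed_weight S t = ln \<bar>cos s - cos t\<bar> * pushed_weight S t + ln S * pushed_weight S t"
    using AE_ang_cos_neq[of "cos s"]
  proof eventually_elim
    case (elim t)
    have "\<bar>S * cos s - S * cos t\<bar> = S * \<bar>cos s - cos t\<bar>"
      using S by (simp add: right_diff_distrib[symmetric] abs_mult)
    then show ?case using elim S by (simp add: ln_mult algebra_simps)
  qed
  have i1: "integrable ang (\<lambda>t. ln \<bar>cos s - cos t\<bar> * pushed_weight S t + ln S * pushed_weight S t)"
    using pot(1) ip by simp
  show i: "integrable ang (\<lambda>t. ln \<bar>S * cos s - S * cos t\<bar> * pushed_weight S t)"
    by (rule integrable_cong_AE_imp[OF i1]) (use ae in \<open>auto elim: AE_mp\<close>)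
  have ae2: "AE t in ang. - ln \<bar>S * cos s - S * cos t\<bar> * pushed_weight S t = - ln (2 * \<bar>cos s - cos t\<bar>) * pushed_weight S t + (ln 2 - ln S) * pushed_weight S t"
    using ae AE_ang_cos_neq[of "cos s"]
    by eventually_elim (simp add: ln_mult algebra_simps)
  have i2: "integrable ang (\<lambda>t. - ln (2 * \<bar>cos s - cos t\<bar>) * pushed_weight S t)"
    by (rule integrable_cong_AE_imp[of _ "\<lambda>t. - (ln \<bar>cos s - cos t\<bar> * pushed_weight S t) - ln 2 * pushed_weight S t"])
       (use pot(1) ip AE_ang_cos_neq[of "cos s"] in \<open>auto simp: ln_mult algebra_simps elim!: AE_mp\<close>)
  have "(\<integral>t. - ln \<bar>S * cos s - S * cos t\<bar> * pushed_weight S t \<partial>ang) =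
    (\<integral>t. - ln (2 * \<bar>cos s - cos t\<bar>) * pushed_weight S t + (ln 2 - ln S) * pushed_weight S t \<partial>ang)"
    by (rule integral_cong_AE) (use ae2 in auto)
  also have "\<dots> = (\<integral>t. - ln (2 * \<bar>cos s - cos t\<bar>) * pushed_weight S t \<partial>ang) + (ln 2 - ln S)"
    using i2 ip by (subst Bochner_Integration.integral_add) (simp_all add: integral_pushed_weight)
  also have "(\<integral>t. - ln (2 * \<bar>cos s - cos t\<bar>) * pushed_weight S t \<partial>ang) = - cos_series (coef S) s"
  proof -
    have "2 / real (Suc n) * cos (real (Suc n) * s) * (- (real (Suc n) * coef S n) / 2) = - (coef S n * cos (real (Suc n) * s))" for n
      by (simp add: field_simps del: of_nat_Suc)
    then show ?thesis unfolding pot(2) q cos_series_def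
      by (simp only: suminf_minus[OF summable_mult_cos[OF summable_coef'(2)]])
  qed
  finally show "(\<integral>t. - ln \<bar>S * cos s - S * cos t\<bar> * pushed_weight S t \<partial>ang) = ln 2 - ln S + coef0 S - V (S * cos s)"
    by (simp add: V_eq_cos_series)
qed

section \<open>Consequences of convexity for the weight and the critical sum\<close>

lemma fejer_series_coef_eq:
  "(1 - cos t) * fejer_series (coef S) s t = V (S * cos s) - (V (S * cos (s + t)) + V (S * cos (s - t))) / 2"
  by (simp add: fejer_series_eq[OF summable_coef] V_eq_cos_series field_simps)

lemma integral_fejer_coef:
  "(\<integral>t. fejer_series (coef S) s t \<partial>ang) = 1 - pushed_weight S s"
  unfolding integral_fejer_series(2)[OF summable_coef] by (simp add: pushed_weight_def cos_series_def)

lemma pushed_weight_0: "pushed_weight S 0 = 1 - crit S"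
  by (simp add: pushed_weight_def cos_series_def crit_def)

lemma fejer_series_coef_0_eq: "(1 - cos t) * fejer_series (coef S) 0 t = V S - V (S * cos t)"
  using fejer_series_coef_eq[of t S 0] by simp

lemma integral_fejer_coef_0: "(\<integral>t. fejer_series (coef S) 0 t \<partial>ang) = crit S"
  by (simp add: integral_fejer_coef pushed_weight_0)

text \<open>The Fejer series is accessible through \<open>V\<close> only after multiplication by
  \<open>1 - cos t\<close>; cancelling this factor is harmless off a null set.\<close>

lemma integral_mono_off_1:
  assumes "integrable ang f" "integrable ang g"
    and "\<And>t. cos t < 1 \<Longrightarrow> (1 - cos t) * f t \<le> (1 - cos t) * g t"
  shows "(\<integral>t. f t \<partial>ang) \<le> (\<integral>t. g t \<partial>ang)"
proof (rule integral_mono_AE[OF assms(1,2)])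
  show "AE t in ang. f t \<le> g t"
    using AE_ang_cos_neq[of 1]
  proof eventually_elim
    case (elim t)
    then have "cos t < 1" using cos_le_one[of t] by linarith
    with assms(3)[OF this] show ?case by simp
  qed
qed

text \<open>Convexity bounds the symmetric second difference of \<open>V (S * cos s)\<close> by its value at the edge \<open>s = 0\<close>.\<close>
lemma pushed_weight_ge:
  assumes S: "S \<ge> 0"
  shows "1 - crit S \<le> pushed_weight S s"
proof -
  have "(\<integral>t. fejer_series (coef S) s t \<partial>ang) \<le> (\<integral>t. fejer_series (coef S) 0 t \<partial>ang)"
  proof (rule integral_mono_off_1)
    fix t
    \<comment> \<open>\<open>?a - ?b\<close> and \<open>?a + ?b\<close> are
      \<open>S cos (s + t)\<close> and \<open>S cos (s - t)\<close>; their midpoint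
      \<open>?a\<close> is \<open>S cos s\<close> scaled by \<open>cos t\<close>.\<close>
    let ?a = "S * (cos s * cos t)" and ?b = "S * (sin s * sin t)"
    have "V ((1/2) *\<^sub>R (?a - ?b) + (1/2) *\<^sub>R (?a + ?b)) \<le> (1/2) * V (?a - ?b) + (1/2) * V (?a + ?b)"
      using convex_onD[OF convex, of "1/2" "?a - ?b" "?a + ?b"] by simp
    then have 1: "V ?a \<le> (V (S * cos (s + t)) + V (S * cos (s - t))) / 2"
      by (simp add: cos_add cos_diff field_simps)
    \<comment> \<open>Scaling by \<open>cos t\<close> costs less at radius \<open>|S cos s|\<close>
      than at the larger radius \<open>S\<close>.\<close>
    have "V (\<bar>S * cos s\<bar>) - V (\<bar>S * cos s\<bar> * cos t) \<le> V S - V (S * cos t)"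
      using S by (intro V_diff_scaled_mono) (auto simp: abs_mult mult_left_le abs_le_iff)
    moreover have "V (\<bar>S * cos s\<bar> * cos t) = V ?a"
      using V_abs[of "\<bar>S * cos s\<bar> * cos t"] V_abs[of ?a] by (simp add: abs_mult mult.assoc)
    ultimately have 2: "V (S * cos s) - V ?a \<le> V S - V (S * cos t)" by (simp only: V_abs)
    show "(1 - cos t) * fejer_series (coef S) s t \<le> (1 - cos t) * fejer_series (coef S) 0 t"
      unfolding fejer_series_coef_eq[of t S s] fejer_series_coef_0_eq using 1 2 by linarith
  qed (intro integral_fejer_series(1) summable_coef)+
  then show ?thesis unfolding integral_fejer_coef pushed_weight_0 by linarith
qed

lemma crit_mono:
  assumes "0 \<le> a" "a \<le> b"
  shows "crit a \<le> crit b"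
  unfolding integral_fejer_coef_0[symmetric]
  by (rule integral_mono_off_1)
     (use assms V_diff_scaled_mono[of a b "cos _"] in \<open>auto simp: fejer_series_coef_0_eq abs_le_iff intro!: integral_fejer_series(1) summable_coef\<close>)

text \<open>The tangent at \<open>S\<close> bounds \<open>(V S - V (S cos t)) / (1 - cos t)\<close>
  by \<open>S * V1 S\<close>. The second bound avoids \<open>V1\<close> and tends to 0 with
  \<open>S\<close> by continuity of \<open>V\<close>, which gives \<open>crit < 1\<close> at small
  radii.\<close>

lemma crit_le:
  assumes "S \<ge> 0"
  shows "crit S \<le> S * V1 S" "crit S \<le> V (2 * S) - V S"
proof -
  have "crit S \<le> (\<integral>t. S * V1 S \<partial>ang)"
    unfolding integral_fejer_coef_0[symmetric]
  proof (rule integral_mono_off_1)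
    show "(1 - cos t) * fejer_series (coef S) 0 t \<le> (1 - cos t) * (S * V1 S)" for t
      unfolding fejer_series_coef_0_eq using above_tangent[of S "S * cos t"] by (simp add: algebra_simps)
  qed (auto intro!: integral_fejer_series(1) summable_coef)
  then show "crit S \<le> S * V1 S" by simp
  also have "\<dots> \<le> V (2 * S) - V S" using above_tangent[of S "2 * S"] by (simp add: mult.commute)
  finally show "crit S \<le> V (2 * S) - V S" .
qed

text \<open>With \<open>c = cos t\<close>, the chord from 0 to \<open>S\<close> gives
  \<open>V S - V (S c) \<ge> (V S - V 0) (1 - |c|)\<close>. The function
  \<open>(1 - c^2) / 4\<close> lies below \<open>(1 - |c|) / (1 - c)\<close> and has mean 1/8,
  whence the constant.\<close>

lemma crit_ge:
  assumes S: "S \<ge> 0"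
  shows "(V S - V 0) / 8 \<le> crit S"
proof -
  have "(\<integral>t. (V S - V 0) * (1 - cos t * cos t) / 4 \<partial>ang) \<le> crit S"
    unfolding integral_fejer_coef_0[symmetric]
  proof (rule integral_mono_off_1)
    fix t :: real
    have nn: "0 \<le> V S - V 0" using V_mono[of 0 S] S by simp
    have c: "\<bar>cos t\<bar> \<le> 1" by (rule abs_cos_le_one)
    have "V ((1 - \<bar>cos t\<bar>) *\<^sub>R 0 + \<bar>cos t\<bar> *\<^sub>R S) \<le> (1 - \<bar>cos t\<bar>) * V 0 + \<bar>cos t\<bar> * V S"
      using convex_onD[OF convex, of "\<bar>cos t\<bar>" 0 S] c by simp
    moreover have "V (\<bar>cos t\<bar> * S) = V (S * cos t)" using V_abs[of "S * cos t"] S by (simp add: abs_mult mult.commute)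
    ultimately have 1: "(V S - V 0) * (1 - \<bar>cos t\<bar>) \<le> V S - V (S * cos t)" by (simp add: algebra_simps)
    have "(1 - cos t) * ((V S - V 0) * (1 - cos t * cos t) / 4) = (V S - V 0) * (((1 - cos t) / 2) * ((1 - cos t * cos t) / 2))"
      by simp
    also have "\<dots> \<le> (V S - V 0) * (1 * (1 - \<bar>cos t\<bar>))"
    proof (intro mult_left_mono[OF _ nn] mult_mono)
      show "(1 - cos t) / 2 \<le> 1" using cos_ge_minus_one[of t] by simp
      have "(1 - \<bar>cos t\<bar>) * (1 + \<bar>cos t\<bar>) \<le> (1 - \<bar>cos t\<bar>) * 2" using c by (intro mult_left_mono) auto
      then show "(1 - cos t * cos t) / 2 \<le> 1 - \<bar>cos t\<bar>" by (simp add: field_simps)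
      show "0 \<le> (1 - cos t * cos t) / 2"
        using abs_square_le_1[of "cos t"] c by (simp add: power2_eq_square)
    qed auto
    finally show "(1 - cos t) * ((V S - V 0) * (1 - cos t * cos t) / 4) \<le> (1 - cos t) * fejer_series (coef S) 0 t"
      using 1 by (simp add: fejer_series_coef_0_eq)
  qed (intro integral_fejer_series(1) summable_coef integrable_ang_continuous continuous_intros; simp)+
  moreover have "(\<integral>t. (V S - V 0) * (1 - cos t * cos t) / 4 \<partial>ang) = (V S - V 0) / 8"
  proof -
    have "(\<integral>t. 1 - cos t * cos t \<partial>ang) = 1/2"
      using integral_ang_cos_cos[of 1 1] integrable_cos_mult_cos[of 1 1] by simp
    then show ?thesis by simp
  qed
  ultimately show ?thesis by (simp only:)
qed

text \<open>The integral is the value of the Fejer series at \<open>t = 0\<close>, which is the limit of difference quotients of \<open>V\<close> at \<open>S\<close>.\<close>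
lemma integral_pushed_weight_edge:
  assumes S: "S \<ge> 0" and crit: "crit S = 1"
  shows "integrable ang (\<lambda>t. pushed_weight S t / (1 - cos t))"
    "(\<integral>t. pushed_weight S t / (1 - cos t) \<partial>ang) \<le> S * V1 S"
proof -
  note * = integral_weight_fejer[OF summable_coef, of S, folded crit_def cos_series_def, OF crit]
  show "integrable ang (\<lambda>t. pushed_weight S t / (1 - cos t))"
    using *(1) by (simp add: pushed_weight_def cos_series_def)
  have "(\<integral>t. pushed_weight S t / (1 - cos t) \<partial>ang) = fejer_series (coef S) 0 0"
    using *(2) by (simp add: pushed_weight_def cos_series_def fejer_series_0_0[OF summable_coef])
  also have "\<dots> \<le> S * V1 S"
  proof (rule tendsto_le[where F = "at 0"])
    show "(fejer_series (coef S) 0 \<longlongrightarrow> fejer_series (coef S) 0 0) (at 0)"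
      using continuous_fejer_series[OF summable_coef, of S 0] by (simp add: continuous_on_eq_continuous_at isCont_def)
    have "\<forall>\<^sub>F t in at (0::real). t \<in> {-1<..<1} - {0}"
      by (intro eventually_at_in_open) auto
    then show "\<forall>\<^sub>F t in at 0. fejer_series (coef S) 0 t \<le> S * V1 S"
    proof eventually_elim
      case (elim t)
      have "cos t < 1"
      proof -
        have "sin (t / 2) \<noteq> 0" using elim sin_gt_zero2[of "\<bar>t\<bar> / 2"] pi_ge_two
          by (cases "t > 0") (auto simp: abs_if)
        then have "0 < 2 * (sin (t / 2))\<^sup>2" by simp
        then show ?thesis using cos_double_sin[of "t / 2"] by simp
      qed
      moreover have "(1 - cos t) * fejer_series (coef S) 0 t \<le> (1 - cos t) * (S * V1 S)"
        unfolding fejer_series_coef_0_eq using above_tangent[of S "S * cos t"] by (simp add: algebra_simps)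
      ultimately show ?case by simp
    qed
  qed auto
  finally show "(\<integral>t. pushed_weight S t / (1 - cos t) \<partial>ang) \<le> S * V1 S" .
qed

section \<open>Continuity in the radius\<close>

lemma bounded_on_interval:
  fixes f :: "real \<Rightarrow> real"
  assumes "continuous_on UNIV f"
  obtains M where "0 \<le> M" "\<And>x. \<bar>x\<bar> \<le> B \<Longrightarrow> \<bar>f x\<bar> \<le> M"
proof -
  have "compact (f ` {-B..B})"
    using assms by (intro compact_continuous_image) (auto intro: continuous_on_subset)
  then obtain M where M: "\<And>x. x \<in> {-B..B} \<Longrightarrow> \<bar>f x\<bar> \<le> M"
    using compact_imp_bounded bounded_real by (metis imageI)
  show ?thesis by (rule that[of "\<bar>M\<bar>"]) (use M in \<open>auto simp: abs_le_iff intro: order_trans[OF _ abs_ge_self]\<close>)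
qed

text \<open>\<open>third_deriv\<close> is bounded uniformly for \<open>|S| \<le> B\<close>, which
  gains three powers of the order; one is spent on the factor \<open>Suc n\<close>, and a summable
  majorant independent of \<open>S\<close> remains.\<close>

lemma coef_bound:
  obtains M where "\<And>S n. \<bar>S\<bar> \<le> B \<Longrightarrow> real (Suc n) * \<bar>coef S n\<bar> \<le> M / (real (Suc n))\<^sup>2"
proof -
  obtain M1 where M1: "0 \<le> M1" "\<And>x. \<bar>x\<bar> \<le> B \<Longrightarrow> \<bar>V1 x\<bar> \<le> M1" using bounded_on_interval[OF cont(2)] by blast
  obtain M2 where M2: "0 \<le> M2" "\<And>x. \<bar>x\<bar> \<le> B \<Longrightarrow> \<bar>V2 x\<bar> \<le> M2" using bounded_on_interval[OF cont(3)] by blast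
  obtain M3 where M3: "0 \<le> M3" "\<And>x. \<bar>x\<bar> \<le> B \<Longrightarrow> \<bar>V3 x\<bar> \<le> M3" using bounded_on_interval[OF cont3] by blast
  define M where "M = B * 1 * M1 + 3 * B\<^sup>2 * 1 * 1 * M2 + B ^ 3 * 1 ^ 3 * M3"
  have td: "\<bar>third_deriv S t\<bar> \<le> M" if S: "\<bar>S\<bar> \<le> B" for S t
  proof -
    have x: "\<bar>S * cos t\<bar> \<le> B" using S abs_mult_cos_le[of S t] by linarith
    have st: "\<bar>sin t\<bar> \<le> 1" "\<bar>cos t\<bar> \<le> 1" by (rule abs_sin_le_one abs_cos_le_one)+
    have "\<bar>third_deriv S t\<bar> \<le> \<bar>S * sin t * V1 (S * cos t)\<bar> + \<bar>3 * S\<^sup>2 * sin t * cos t * V2 (S * cos t)\<bar> + \<bar>S ^ 3 * (sin t) ^ 3 * V3 (S * cos t)\<bar>"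
      unfolding third_deriv_def by linarith
    also have "\<dots> \<le> M"
      unfolding M_def abs_mult power_abs abs_numeral
      by (intro add_mono mult_mono power_mono S st M1 M2 M3 x order_refl) (auto intro!: mult_nonneg_nonneg order_trans[OF abs_ge_zero S])
    finally show ?thesis .
  qed
  show ?thesis
  proof (rule that[of "2 * M"])
    fix S n assume S: "\<bar>S\<bar> \<le> B"
    have "\<bar>\<integral>t. third_deriv S t * sin (real (Suc n) * t) \<partial>ang\<bar> \<le> (\<integral>t. M \<partial>ang)"
    proof (rule order_trans[OF integral_abs_bound], rule integral_mono)
      show "\<bar>third_deriv S t * sin (real (Suc n) * t)\<bar> \<le> M" for t
        using mult_mono[OF td[OF S, of t] abs_sin_le_one[of "real (Suc n) * t"]] td[OF S, of t]
        by (simp add: abs_mult)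
    qed (auto intro!: integrable_ang_continuous continuous_intros continuous_third_deriv)
    then have "\<bar>real (Suc n) ^ 3 * coef S n\<bar> \<le> 2 * M" unfolding coef_eq by simp
    then show "real (Suc n) * \<bar>coef S n\<bar> \<le> 2 * M / (real (Suc n))\<^sup>2"
      by (simp add: abs_mult field_simps power2_eq_square power3_eq_cube del: of_nat_Suc)
  qed
qed

lemma isCont_coef: "isCont (\<lambda>S. coef S n) S0"
  unfolding continuous_at_sequentially comp_def
proof (intro allI impI)
  fix X assume X: "X \<longlonglongrightarrow> S0"
  then obtain B where B: "\<And>k. \<bar>X k\<bar> \<le> B"
    by (metis BseqE convergentI convergent_imp_Bseq real_norm_def)
  obtain M where M: "0 \<le> M" "\<And>x. \<bar>x\<bar> \<le> B \<Longrightarrow> \<bar>V x\<bar> \<le> M" using bounded_on_interval[OF cont(1)] by blast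
  have "(\<lambda>k. \<integral>t. V (X k * cos t) * cos (real (Suc n) * t) \<partial>ang) \<longlonglongrightarrow> (\<integral>t. V (S0 * cos t) * cos (real (Suc n) * t) \<partial>ang)"
  proof (rule integral_dominated_convergence[where w = "\<lambda>_. M"])
    show "AE t in ang. (\<lambda>k. V (X k * cos t) * cos (real (Suc n) * t)) \<longlonglongrightarrow> V (S0 * cos t) * cos (real (Suc n) * t)"
      using DERIV_isCont[OF deriv1] by (intro AE_I2 tendsto_mult isCont_tendsto_compose[of _ V] X tendsto_const) auto
    show "AE t in ang. norm (V (X k * cos t) * cos (real (Suc n) * t)) \<le> M" for k
    proof (rule AE_I2)
      fix t
      have "\<bar>X k * cos t\<bar> \<le> B" using B[of k] abs_mult_cos_le[of "X k" t] by linarith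
      then show "norm (V (X k * cos t) * cos (real (Suc n) * t)) \<le> M"
        using M(2)[of "X k * cos t"] abs_mult_cos_le[of "V (X k * cos t)" "real (Suc n) * t"] by simp
    qed
  qed auto
  then show "(\<lambda>k. coef (X k) n) \<longlonglongrightarrow> coef S0 n" unfolding coef_def by (intro tendsto_mult tendsto_const)
qed

text \<open>The multipliers \<open>g\<close> let one argument serve twice: \<open>g = 1\<close>
  gives continuity of \<open>crit\<close>, Chebyshev values at \<open>x / S\<close> give convergence
  of \<open>P_R\<close>. The general filter \<open>F\<close> admits the one-sided limit.\<close>

lemma tendsto_coef_series:
  assumes S0: "F \<le> nhds S0" "F \<noteq> bot" and lim: "\<And>n. ((\<lambda>S. g S n) \<longlongrightarrow> g0 n) F"
    and g: "\<forall>\<^sub>F S in F. \<forall>n. \<bar>g S n\<bar> \<le> 1"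
  shows "((\<lambda>S. \<Sum>n. real (Suc n) * coef S n * g S n) \<longlongrightarrow> (\<Sum>n. real (Suc n) * coef S0 n * g0 n)) F"
proof -
  obtain M where M: "\<And>S n. \<bar>S\<bar> \<le> \<bar>S0\<bar> + 1 \<Longrightarrow> real (Suc n) * \<bar>coef S n\<bar> \<le> M / (real (Suc n))\<^sup>2"
    using coef_bound by blast
  have "\<forall>\<^sub>F S in nhds S0. S \<in> {- (\<bar>S0\<bar> + 1) <..< \<bar>S0\<bar> + 1}"
    by (rule eventually_nhds_in_open) auto
  then have ev: "\<forall>\<^sub>F S in F. \<bar>S\<bar> \<le> \<bar>S0\<bar> + 1"
    by (rule eventually_mono[OF filter_leD[OF S0(1)]]) auto
  show ?thesis
  proof (rule tannerys_theorem[where M = "\<lambda>n. M / (real (Suc n))\<^sup>2", THEN conjunct2, THEN conjunct2])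
    have "\<forall>\<^sub>F S in F. \<forall>n. norm (real (Suc n) * coef S n * g S n) \<le> M / (real (Suc n))\<^sup>2"
      using ev g
    proof eventually_elim
      case (elim S)
      show ?case
      proof
        fix n
        have "real (Suc n) * \<bar>coef S n\<bar> * \<bar>g S n\<bar> \<le> real (Suc n) * \<bar>coef S n\<bar> * 1"
          using elim by (intro mult_left_mono) auto
        also have "\<dots> \<le> M / (real (Suc n))\<^sup>2" using M[OF elim(1)] by simp
        finally show "norm (real (Suc n) * coef S n * g S n) \<le> M / (real (Suc n))\<^sup>2" by (simp add: abs_mult del: of_nat_Suc)
      qed
    qed
    from eventually_compose_filterlim[OF this filterlim_snd]
    show "\<forall>\<^sub>F (n, S) in at_top \<times>\<^sub>F F. norm (real (Suc n) * coef S n * g S n) \<le> M / (real (Suc n))\<^sup>2"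
      by (rule eventually_mono) auto
    show "summable (\<lambda>n. M / (real (Suc n))\<^sup>2)"
      using inverse_power_summable[of 2, where 'a = real, THEN summable_mult, of M] by (subst summable_Suc_iff) (simp add: field_simps)
    show "((\<lambda>S. real (Suc n) * coef S n * g S n) \<longlongrightarrow> real (Suc n) * coef S0 n * g0 n) F" for n
      using isCont_coef[of S0 n] by (intro tendsto_mult tendsto_const lim tendsto_mono[OF S0(1)])
        (simp add: isCont_def tendsto_at_iff_tendsto_nhds[of "\<lambda>S. coef S n"])
  qed (rule S0)
qed

lemma isCont_crit: "isCont crit S0"
proof -
  have "((\<lambda>S. \<Sum>n. real (Suc n) * coef S n * 1) \<longlongrightarrow> (\<Sum>n. real (Suc n) * coef S0 n * 1)) (at S0)"
    by (rule tendsto_coef_series) (auto simp: at_within_def[of S0 UNIV, symmetric] intro: at_within_le_nhds)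
  then show ?thesis by (simp add: isCont_def crit_def[abs_def])
qed

end

subsection \<open>Energy and the Euler--Lagrange conditions\<close>

lemma eint_cong_AE: "AE x in M. f x = g x \<Longrightarrow> eint M f = eint M g"
  unfolding eint_def by (intro arg_cong2[where f = minus] arg_cong[where f = enn2ereal] nn_integral_cong_AE) (auto elim: AE_mp)

lemma eint_ereal:
  assumes "integrable M f"
  shows "eint M (\<lambda>x. ereal (f x)) = ereal (\<integral>x. f x \<partial>M)"
proof -
  have fin: "(\<integral>\<^sup>+x. ennreal (f x) \<partial>M) \<noteq> \<infinity>" "(\<integral>\<^sup>+x. ennreal (- f x) \<partial>M) \<noteq> \<infinity>"
    using assms by (auto simp: real_integrable_def)
  have e: "enn2ereal a = ereal (enn2real a)" if "a \<noteq> \<infinity>" for a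
    using that by (cases a) (auto simp: enn2ereal_ennreal)
  have "eint M (\<lambda>x. ereal (f x)) = enn2ereal (\<integral>\<^sup>+x. ennreal (f x) \<partial>M) - enn2ereal (\<integral>\<^sup>+x. ennreal (- f x) \<partial>M)"
    unfolding eint_def by (simp add: ennreal.abs_eq[symmetric] e2ennreal_ereal)
  then show ?thesis using fin by (simp add: e real_lebesgue_integral_def[OF assms])
qed

lemma probs_onD:
  assumes "M \<in> probs_on R"
  shows "prob_space M" "sets M = sets borel" "space M = UNIV" "AE x in M. x \<in> {-R..R}"
proof -
  show 1: "prob_space M" and 2: "sets M = sets borel" using assms by (auto simp: probs_on_def)
  show "space M = UNIV" using sets_eq_imp_space_eq[OF 2] by simp
  interpret prob_space M by fact
  have "prob {-R..R} = 1" using assms by (simp add: probs_on_def measure_def)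
  moreover have "{-R..R} \<in> events" by (simp add: 2)
  ultimately show "AE x in M. x \<in> {-R..R}" by (simp add: prob_eq_1)
qed

text \<open>Since \<open>ln 0 = 0\<close>, integrability of the real kernel does not see mass on the
  diagonal, where \<open>log_kernel\<close> is infinite; the first conjunct excludes such
  mass.\<close>

definition log_finite :: "real measure \<Rightarrow> real measure \<Rightarrow> bool" where
  "log_finite M N \<longleftrightarrow> (AE p in M \<Otimes>\<^sub>M N. fst p \<noteq> snd p) \<and> integrable (M \<Otimes>\<^sub>M N) (\<lambda>p. - ln \<bar>fst p - snd p\<bar>)"

definition log_energy :: "real measure \<Rightarrow> real measure \<Rightarrow> real" where
  "log_energy M N = (\<integral>p. - ln \<bar>fst p - snd p\<bar> \<partial>(M \<Otimes>\<^sub>M N))"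

lemma AE_pair_in_interval:
  assumes "M \<in> probs_on R" "N \<in> probs_on R"
  shows "AE p in M \<Otimes>\<^sub>M N. fst p \<in> {-R..R} \<and> snd p \<in> {-R..R}"
proof -
  note M = probs_onD[OF assms(1)] and N = probs_onD[OF assms(2)]
  note [measurable_cong] = M(2) N(2)
  interpret M: prob_space M by fact
  interpret N: prob_space N by fact
  interpret pair_prob_space M N ..
  show ?thesis
    by (rule AE_pair_measure) (use M(4) N(4) in \<open>auto elim!: AE_mp\<close>)
qed

text \<open>The absolute value on the right makes the bound valid on the diagonal too, where the
  left side is the default value 0.\<close>

lemma ln_abs_diff_le:
  fixes x y R :: real
  assumes "x \<in> {-R..R}" "y \<in> {-R..R}"
  shows "ln \<bar>x - y\<bar> \<le> \<bar>ln (2 * R)\<bar>"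
proof (cases "x = y")
  case False
  then have "ln \<bar>x - y\<bar> \<le> ln (2 * R)" using assms by (intro ln_mono) auto
  then show ?thesis by linarith
qed simp

lemma integrable_V_probs_on:
  fixes V :: "real \<Rightarrow> real"
  assumes "M \<in> probs_on R" "continuous_on UNIV V"
  shows "integrable M V"
proof -
  note M = probs_onD[OF assms(1)]
  interpret M: prob_space M by fact
  have [measurable]: "V \<in> borel_measurable borel" using assms(2) by (rule borel_measurable_continuous_onI)
  have "compact (V ` {-R..R})"
    using assms by (intro compact_continuous_image) (auto intro: continuous_on_subset)
  then obtain B where "\<And>t. t \<in> {-R..R} \<Longrightarrow> \<bar>V t\<bar> \<le> B"
    using compact_imp_bounded bounded_real by (metis imageI)
  with M(4) have "AE t in M. norm (V t) \<le> B" by (auto elim!: AE_mp)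
  then show ?thesis
    by (rule M.integrable_const_bound) (simp add: measurable_cong_sets[OF M(2) refl])
qed

lemma energy_eq:
  assumes M: "M \<in> probs_on R" and V: "continuous_on UNIV V" and fin: "log_finite M M"
  shows "energy V M = ereal (log_energy M M / 2 + (\<integral>x. V x \<partial>M))"
proof -
  have "eint (M \<Otimes>\<^sub>M M) (\<lambda>(x, y). log_kernel x y) = eint (M \<Otimes>\<^sub>M M) (\<lambda>p. ereal (- ln \<bar>fst p - snd p\<bar>))"
    using fin by (intro eint_cong_AE) (auto simp: log_finite_def log_kernel_def elim!: AE_mp)
  also have "\<dots> = ereal (log_energy M M)"
    using fin by (simp add: eint_ereal log_finite_def log_energy_def del: uminus_ereal.simps)
  finally show ?thesis
    using integrable_V_probs_on[OF M V] by (simp add: energy_def eint_ereal)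
qed

text \<open>The kernel is bounded below on \<open>[-R, R]\<close>, so its negative part has finite
  integral and no \<open>\<infinity> - \<infinity>\<close> arises. A finite positive part would
  force a null diagonal and integrability, that is \<open>log_finite\<close>.\<close>

lemma energy_infinite:
  assumes M: "M \<in> probs_on R" and V: "continuous_on UNIV V" and inf: "\<not> log_finite M M"
  shows "energy V M = \<infinity>"
proof -
  note pr = probs_onD[OF M]
  note [measurable_cong] = pr(2)
  interpret prob_space M by fact
  interpret pair_prob_space M M ..
  note box = AE_pair_in_interval[OF M M]
  define k where "k p = (case p of (x, y) \<Rightarrow> log_kernel x y)" for p
  have k: "k p = (if fst p = snd p then \<infinity> else ereal (- ln \<bar>fst p - snd p\<bar>))" for p
    by (simp add: k_def log_kernel_def case_prod_unfold)
  have [measurable]: "k \<in> borel_measurable (M \<Otimes>\<^sub>M M)" unfolding k by measurable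
  have neg: "(\<integral>\<^sup>+p. e2ennreal (- k p) \<partial>(M \<Otimes>\<^sub>M M)) \<noteq> \<infinity>"
  proof -
    have "(\<integral>\<^sup>+p. e2ennreal (- k p) \<partial>(M \<Otimes>\<^sub>M M)) \<le> (\<integral>\<^sup>+p. ennreal \<bar>ln (2 * R)\<bar> \<partial>(M \<Otimes>\<^sub>M M))"
    proof (rule nn_integral_mono_AE)
      show "AE p in M \<Otimes>\<^sub>M M. e2ennreal (- k p) \<le> ennreal \<bar>ln (2 * R)\<bar>"
        using box
      proof eventually_elim
        case (elim p)
        then show ?case using ln_abs_diff_le[of "fst p" R "snd p"]
          by (auto simp: k e2ennreal_neg e2ennreal_ereal intro: ennreal_leI)
      qed
    qed
    also have "\<dots> = ennreal \<bar>ln (2 * R)\<bar>" by (simp add: P.emeasure_space_1)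
    finally show ?thesis by (auto simp: top_unique)
  qed
  have pos: "(\<integral>\<^sup>+p. e2ennreal (k p) \<partial>(M \<Otimes>\<^sub>M M)) = \<infinity>"
  proof (rule ccontr)
    assume fin: "(\<integral>\<^sup>+p. e2ennreal (k p) \<partial>(M \<Otimes>\<^sub>M M)) \<noteq> \<infinity>"
    have "AE p in M \<Otimes>\<^sub>M M. e2ennreal (k p) \<noteq> \<infinity>"
      by (rule nn_integral_PInf_AE[OF _ fin]) measurable
    then have neq: "AE p in M \<Otimes>\<^sub>M M. fst p \<noteq> snd p"
      by (auto simp: k elim!: AE_mp)
    have "(\<integral>\<^sup>+p. e2ennreal (k p) \<partial>(M \<Otimes>\<^sub>M M)) = (\<integral>\<^sup>+p. ennreal (- ln \<bar>fst p - snd p\<bar>) \<partial>(M \<Otimes>\<^sub>M M))"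
      "(\<integral>\<^sup>+p. e2ennreal (- k p) \<partial>(M \<Otimes>\<^sub>M M)) = (\<integral>\<^sup>+p. ennreal (ln \<bar>fst p - snd p\<bar>) \<partial>(M \<Otimes>\<^sub>M M))"
      using neq by (auto intro!: nn_integral_cong_AE simp: k e2ennreal_ereal elim!: AE_mp)
    with fin neg have "integrable (M \<Otimes>\<^sub>M M) (\<lambda>p. - ln \<bar>fst p - snd p\<bar>)"
      by (simp add: real_integrable_def)
    with neq inf show False by (simp add: log_finite_def)
  qed
  have "eint (M \<Otimes>\<^sub>M M) k = \<infinity>"
    using pos neg by (cases "\<integral>\<^sup>+p. e2ennreal (- k p) \<partial>(M \<Otimes>\<^sub>M M)") (simp_all add: eint_def enn2ereal_ennreal)
  then show ?thesis
    using integrable_V_probs_on[OF M V] by (simp add: energy_def eint_ereal k_def[abs_def])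
qed

section \<open>Chebyshev moments of measures and positive definiteness of the logarithmic
  energy\<close>

definition clamp_arccos :: "real \<Rightarrow> real \<Rightarrow> real" where
  "clamp_arccos R x = arccos (max (-1) (min 1 (x / R)))"

lemma measurable_clamp_arccos [measurable]: "clamp_arccos R \<in> borel_measurable borel"
proof -
  have "continuous_on UNIV (\<lambda>x. arccos (max (-1) (min 1 (x / R))))"
    by (rule continuous_on_compose2[OF continuous_on_arccos'])
       (auto intro!: continuous_intros simp: divide_inverse)
  then show ?thesis unfolding clamp_arccos_def[abs_def] by (rule borel_measurable_continuous_onI)
qed

lemma cos_clamp_arccos:
  assumes "x \<in> {-R..R}" "R > 0"
  shows "cos (clamp_arccos R x) = x / R"
proof -
  have "x / R \<in> {-1..1}" using assms by (auto simp: field_simps)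
  then show ?thesis by (simp add: clamp_arccos_def)
qed

text \<open>For \<open>R > 0\<close> and a measure on \<open>[-R, R]\<close> this is the integral of
  \<open>T_n (x / R)\<close>. The clamped angle makes the integrand continuous and bounded on the
  whole line.\<close>

definition cheb_moment :: "real \<Rightarrow> real measure \<Rightarrow> nat \<Rightarrow> real" where
  "cheb_moment R M n = (\<integral>x. cos (real n * clamp_arccos R x) \<partial>M)"

lemma abel_energy_sums:
  assumes M: "M \<in> probs_on R" and N: "N \<in> probs_on R" and r: "0 \<le> r" "r < 1"
  shows "(\<lambda>n. 2 * r ^ Suc n / real (Suc n) * (cheb_moment R M (Suc n) * cheb_moment R N (Suc n)))
    sums (\<integral>p. abel_kernel r (clamp_arccos R (fst p)) (clamp_arccos R (snd p)) \<partial>(M \<Otimes>\<^sub>M N))"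
proof -
  note pM = probs_onD[OF M] and pN = probs_onD[OF N]
  note [measurable_cong] = pM(2) pN(2)
  interpret M: prob_space M by fact
  interpret N: prob_space N by fact
  interpret pair_prob_space M N ..
  let ?c = "\<lambda>n x. cos (real (Suc n) * clamp_arccos R x)"
  let ?f = "\<lambda>n p. 2 * r ^ Suc n / real (Suc n) * (?c n (fst p) * ?c n (snd p))"
  have B: "norm (?f n p) \<le> 2 * r ^ Suc n" for n p
  proof -
    have "\<bar>?f n p\<bar> \<le> (2 * r ^ Suc n / 1) * (1 * 1)"
      using r unfolding abs_mult abs_divide
      by (intro mult_mono frac_le) (auto simp del: mult_1_right mult_1_left)
    then show ?thesis by simp
  qed
  have sB: "summable (\<lambda>n. 2 * r ^ Suc n)"
    using r by (intro summable_mult) (simp add: summable_Suc_iff)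
  have int: "integrable (M \<Otimes>\<^sub>M N) (?f n)" for n
    by (rule P.integrable_const_bound[OF AE_I2[OF B]]) measurable
  have sn: "summable (\<lambda>n. norm (?f n p))" for p
    by (rule summable_comparison_test[OF _ sB]) (use B in auto)
  have si: "summable (\<lambda>n. \<integral>p. norm (?f n p) \<partial>(M \<Otimes>\<^sub>M N))"
  proof (rule summable_comparison_test[OF _ sB], intro exI[of _ 0] allI impI)
    fix n
    have "(\<integral>p. norm (?f n p) \<partial>(M \<Otimes>\<^sub>M N)) \<le> (\<integral>p. 2 * r ^ Suc n \<partial>(M \<Otimes>\<^sub>M N))"
      by (rule integral_mono[OF integrable_norm[OF int] _ B]) simp
    then show "norm (\<integral>p. norm (?f n p) \<partial>(M \<Otimes>\<^sub>M N)) \<le> 2 * r ^ Suc n" by (simp add: P.prob_space)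
  qed
  have "(\<lambda>n. \<integral>p. ?f n p \<partial>(M \<Otimes>\<^sub>M N)) sums (\<integral>p. (\<Sum>n. ?f n p) \<partial>(M \<Otimes>\<^sub>M N))"
    by (rule sums_integral[OF int]) (use sn si in auto)
  moreover have "(\<Sum>n. ?f n p) = abel_kernel r (clamp_arccos R (fst p)) (clamp_arccos R (snd p))" for p
    by (rule sums_unique[symmetric, OF abel_kernel_sums[OF r]])
  moreover have "(\<integral>p. ?f n p \<partial>(M \<Otimes>\<^sub>M N)) = 2 * r ^ Suc n / real (Suc n) * (cheb_moment R M (Suc n) * cheb_moment R N (Suc n))" for n
  proof -
    have i: "integrable (M \<Otimes>\<^sub>M N) (case_prod (\<lambda>x y. ?c n x * ?c n y))"
      by (rule P.integrable_const_bound[where B = 1])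
         (auto simp: case_prod_unfold abs_mult intro!: AE_I2 mult_le_one simp del: of_nat_Suc)
    have "(\<integral>p. ?c n (fst p) * ?c n (snd p) \<partial>(M \<Otimes>\<^sub>M N)) = (\<integral>x. (\<integral>y. ?c n x * ?c n y \<partial>N) \<partial>M)"
      using integral_fst[OF i] by (simp add: case_prod_unfold)
    then show ?thesis by (simp add: cheb_moment_def del: of_nat_Suc)
  qed
  ultimately show ?thesis by (simp only:)
qed

text \<open>The shift \<open>ln R - ln 2\<close> is the scale of the limit kernel
  \<open>- ln (2 |x - y| / R)\<close>. It is the same for every pair of probability measures and
  cancels in the energy of a difference.\<close>

lemma tendsto_abel_energy:
  assumes M: "M \<in> probs_on R" and N: "N \<in> probs_on R" and R: "R > 0" and fin: "log_finite M N"
  shows "(\<lambda>k. \<integral>p. abel_kernel (abel_seq k) (clamp_arccos R (fst p)) (clamp_arccos R (snd p)) \<partial>(M \<Otimes>\<^sub>M N))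
    \<longlonglongrightarrow> log_energy M N + ln R - ln 2"
proof -
  note pM = probs_onD[OF M] and pN = probs_onD[OF N]
  note [measurable_cong] = pM(2) pN(2)
  interpret M: prob_space M by fact
  interpret N: prob_space N by fact
  interpret pair_prob_space M N ..
  let ?a = "\<lambda>p. clamp_arccos R (fst p)" and ?b = "\<lambda>p. clamp_arccos R (snd p)"
  have ae: "AE p in M \<Otimes>\<^sub>M N. cos (?a p) \<noteq> cos (?b p) \<and> ln \<bar>cos (?a p) - cos (?b p)\<bar> = ln \<bar>fst p - snd p\<bar> - ln R"
    using AE_pair_in_interval[OF M N] fin[unfolded log_finite_def, THEN conjunct1]
  proof eventually_elim
    case (elim p)
    have "\<bar>fst p / R - snd p / R\<bar> = \<bar>fst p - snd p\<bar> / R" using R by (simp add: diff_divide_distrib[symmetric] abs_divide)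
    then show ?case using elim R by (simp add: cos_clamp_arccos ln_div)
  qed
  have int: "integrable (M \<Otimes>\<^sub>M N) (\<lambda>p. - ln \<bar>fst p - snd p\<bar>)" using fin by (simp add: log_finite_def)
  define w where "w p = \<bar>- ln \<bar>fst p - snd p\<bar>\<bar> + (\<bar>ln R\<bar> + 2 * ln 2)" for p :: "real \<times> real"
  have intw: "integrable (M \<Otimes>\<^sub>M N) w" unfolding w_def[abs_def]
    by (intro Bochner_Integration.integrable_add integrable_abs int P.integrable_const)
  have "(\<lambda>k. \<integral>p. abel_kernel (abel_seq k) (?a p) (?b p) \<partial>(M \<Otimes>\<^sub>M N)) \<longlonglongrightarrow> (\<integral>p. - ln \<bar>fst p - snd p\<bar> + (ln R - ln 2) \<partial>(M \<Otimes>\<^sub>M N))"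
  proof (rule integral_dominated_convergence[OF _ _ intw])
    show "AE p in M \<Otimes>\<^sub>M N. (\<lambda>k. abel_kernel (abel_seq k) (?a p) (?b p)) \<longlonglongrightarrow> - ln \<bar>fst p - snd p\<bar> + (ln R - ln 2)"
      using ae
    proof eventually_elim
      case (elim p)
      then have "- ln (2 * \<bar>cos (?a p) - cos (?b p)\<bar>) = - ln \<bar>fst p - snd p\<bar> + (ln R - ln 2)"
        by (simp add: ln_mult)
      then show ?case using tendsto_abel_kernel[OF _ abel_seq(3), of "?a p" "?b p"] elim by simp
    qed
    show "AE p in M \<Otimes>\<^sub>M N. norm (abel_kernel (abel_seq k) (?a p) (?b p)) \<le> w p" for k
      using ae
    proof eventually_elim
      case (elim p)
      then show ?case using abel_kernel_abs_le[OF abel_seq(1,2), of "?a p" "?b p" k] unfolding w_def real_norm_def by linarith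
    qed
  qed measurable
  also have "(\<integral>p. - ln \<bar>fst p - snd p\<bar> + (ln R - ln 2) \<partial>(M \<Otimes>\<^sub>M N)) = log_energy M N + (ln R - ln 2)"
    using int by (subst Bochner_Integration.integral_add) (simp_all add: log_energy_def P.prob_space)
  finally show ?thesis by (simp add: algebra_simps)
qed

text \<open>The regularised energy of \<open>M - N\<close> is a series of nonnegative terms, hence
  at least any one of them, and this survives \<open>r \<rightarrow> 1\<close>. Keeping the term,
  rather than only 0, is what makes uniqueness readable from the inequality.\<close>

lemma log_energy_diff_ge:
  assumes M: "M \<in> probs_on R" and N: "N \<in> probs_on R" and R: "R > 0"
    and fin: "log_finite M M" "log_finite M N" "log_finite N N"
  shows "2 / real (Suc n) * (cheb_moment R M (Suc n) - cheb_moment R N (Suc n))\<^sup>2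
     \<le> log_energy M M - 2 * log_energy M N + log_energy N N"
proof -
  define K where "K A B r = (\<integral>p. abel_kernel r (clamp_arccos R (fst p)) (clamp_arccos R (snd p)) \<partial>(A \<Otimes>\<^sub>M B))" for A B r
  let ?m = "\<lambda>n. cheb_moment R M (Suc n)" and ?n = "\<lambda>n. cheb_moment R N (Suc n)"
  have "2 * r ^ Suc n / real (Suc n) * (?m n - ?n n)\<^sup>2 \<le> K M M r - 2 * K M N r + K N N r" if r: "0 \<le> r" "r < 1" for r
  proof -
    have "(\<lambda>n. 2 * r ^ Suc n / real (Suc n) * (?m n * ?m n) - 2 * (2 * r ^ Suc n / real (Suc n) * (?m n * ?n n))
       + 2 * r ^ Suc n / real (Suc n) * (?n n * ?n n)) sums (K M M r - 2 * K M N r + K N N r)"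
      unfolding K_def by (intro sums_add sums_diff sums_mult abel_energy_sums M N r)
    moreover have "2 * r ^ Suc n / real (Suc n) * (?m n * ?m n) - 2 * (2 * r ^ Suc n / real (Suc n) * (?m n * ?n n))
       + 2 * r ^ Suc n / real (Suc n) * (?n n * ?n n) = 2 * r ^ Suc n / real (Suc n) * (?m n - ?n n)\<^sup>2" for n
      unfolding power2_eq_square by algebra
    ultimately have s: "(\<lambda>n. 2 * r ^ Suc n / real (Suc n) * (?m n - ?n n)\<^sup>2) sums (K M M r - 2 * K M N r + K N N r)"
      by (simp only:)
    have "(\<Sum>i\<in>{n}. 2 * r ^ Suc i / real (Suc i) * (?m i - ?n i)\<^sup>2) \<le> (\<Sum>i. 2 * r ^ Suc i / real (Suc i) * (?m i - ?n i)\<^sup>2)"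
      by (rule sum_le_suminf) (use s r in \<open>auto simp: sums_iff simp del: of_nat_Suc power_Suc\<close>)
    then show ?thesis using s by (simp add: sums_iff del: of_nat_Suc power_Suc)
  qed
  then have le: "2 * abel_seq k ^ Suc n / real (Suc n) * (?m n - ?n n)\<^sup>2
     \<le> K M M (abel_seq k) - 2 * K M N (abel_seq k) + K N N (abel_seq k)" for k
    using abel_seq by blast
  have "(\<lambda>k. 2 * abel_seq k ^ Suc n / real (Suc n) * (?m n - ?n n)\<^sup>2) \<longlonglongrightarrow> 2 * 1 ^ Suc n / real (Suc n) * (?m n - ?n n)\<^sup>2"
    by (intro tendsto_intros abel_seq) auto
  moreover have "(\<lambda>k. K M M (abel_seq k) - 2 * K M N (abel_seq k) + K N N (abel_seq k)) \<longlonglongrightarrow>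
     (log_energy M M + ln R - ln 2) - 2 * (log_energy M N + ln R - ln 2) + (log_energy N N + ln R - ln 2)"
    unfolding K_def by (intro tendsto_intros tendsto_abel_energy M N R fin)
  ultimately have "2 * 1 ^ Suc n / real (Suc n) * (?m n - ?n n)\<^sup>2 \<le>
     (log_energy M M + ln R - ln 2) - 2 * (log_energy M N + ln R - ln 2) + (log_energy N N + ln R - ln 2)"
    by (rule LIMSEQ_le) (use le in blast)
  then show ?thesis by simp
qed

text \<open>Order 0 needs no hypothesis since both masses are 1. Agreement passes from Chebyshev
  polynomials to powers, to continuous functions by Weierstrass approximation, and to characteristic
  functions, where Levy's uniqueness theorem applies.\<close>

lemma cheb_moments_determine:
  assumes M: "M \<in> probs_on R" and N: "N \<in> probs_on R" and R: "R > 0"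
    and eq: "\<And>n. cheb_moment R M (Suc n) = cheb_moment R N (Suc n)"
  shows "M = N"
proof -
  have cont_int: "integrable A (\<lambda>x. f (cos (clamp_arccos R x)))" if A: "A \<in> probs_on R" and f: "continuous_on UNIV f" for A and f :: "real \<Rightarrow> real"
  proof -
    note pA = probs_onD[OF A]
    note [measurable_cong] = pA(2)
    interpret prob_space A by fact
    have [measurable]: "f \<in> borel_measurable borel" using f by (rule borel_measurable_continuous_onI)
    have "compact (f ` {-1..1})"
      using f by (intro compact_continuous_image) (auto intro: continuous_on_subset)
    then obtain B where "\<And>t. t \<in> {-1..1} \<Longrightarrow> \<bar>f t\<bar> \<le> B"
      using compact_imp_bounded bounded_real by (metis imageI)
    then show ?thesis by (intro integrable_const_bound[of _ B]) (auto intro!: AE_I2)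
  qed
  define L where "L f = (\<integral>x. f (cos (clamp_arccos R x)) \<partial>M) - (\<integral>x. f (cos (clamp_arccos R x)) \<partial>N)" for f :: "real \<Rightarrow> real"
  interpret M: prob_space M by (rule probs_onD[OF M])
  interpret N: prob_space N by (rule probs_onD[OF N])
  have zero: "L (cheb n) = 0" for n
    using eq[of "n - 1"] M.prob_space N.prob_space by (cases n) (simp_all add: L_def cheb_cos cheb_moment_def del: of_nat_Suc cheb.simps(2,3))
  have add: "L (\<lambda>x. f x + g x) = L f + L g" if "continuous_on UNIV f" "continuous_on UNIV g" for f g
    using cont_int[OF M that(1)] cont_int[OF M that(2)] cont_int[OF N that(1)] cont_int[OF N that(2)] by (simp add: L_def)
  have scale: "L (\<lambda>x. c * f x) = c * L f" if "continuous_on UNIV f" for c f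
    by (simp add: L_def algebra_simps)
  have pow: "L (\<lambda>x. x ^ m) = 0" for m
    by (rule cheb_moments_imp_power_moments[of L]) (fact add scale zero)+
  have L0: "L f = 0" if f: "continuous_on UNIV f" for f
  proof -
    have "\<bar>L f\<bar> \<le> 2 * e" if e: "e > 0" for e
    proof -
      obtain g where g: "real_polynomial_function g" "\<And>y. y \<in> {-1..1} \<Longrightarrow> \<bar>f y - g y\<bar> < e"
        using Stone_Weierstrass_real_polynomial_function[of "{-1..1}" f e] continuous_on_subset[OF f] e by auto
      then obtain a n where gs: "g = (\<lambda>x. \<Sum>i\<le>n. a i * x ^ i)" by (auto simp: real_polynomial_function_iff_sum)
      have "L (\<lambda>x. \<Sum>i\<le>k. a i * x ^ i) = 0" for k
      proof (induction k)
        case 0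
        show ?case using scale[of "\<lambda>x. x ^ 0" "a 0"] pow[of 0] by simp
      next
        case (Suc k)
        have "L (\<lambda>x. \<Sum>i\<le>Suc k. a i * x ^ i) = L (\<lambda>x. (\<Sum>i\<le>k. a i * x ^ i)) + L (\<lambda>x. a (Suc k) * x ^ Suc k)"
          unfolding sum.atMost_Suc by (rule add) (intro continuous_intros)+
        also have "L (\<lambda>x. a (Suc k) * x ^ Suc k) = a (Suc k) * L (\<lambda>x. x ^ Suc k)"
          by (rule scale) (intro continuous_intros)
        finally show ?case by (simp only: Suc pow mult_zero_right add_0_right)
      qed
      then have Lg: "L g = 0" by (simp add: gs)
      have cg: "continuous_on UNIV g" unfolding gs by (intro continuous_intros)
      have d: "\<bar>(\<integral>x. f (cos (clamp_arccos R x)) \<partial>A) - (\<integral>x. g (cos (clamp_arccos R x)) \<partial>A)\<bar> \<le> e" if A: "A \<in> probs_on R" for A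
      proof -
        interpret prob_space A by (rule probs_onD[OF A])
        have "(\<integral>x. f (cos (clamp_arccos R x)) \<partial>A) - (\<integral>x. g (cos (clamp_arccos R x)) \<partial>A) = (\<integral>x. f (cos (clamp_arccos R x)) - g (cos (clamp_arccos R x)) \<partial>A)"
          by (rule Bochner_Integration.integral_diff[symmetric]) (intro cont_int A f cg)+
        also have "\<bar>\<dots>\<bar> \<le> (\<integral>x. e \<partial>A)"
          by (rule order_trans[OF integral_abs_bound], rule integral_mono)
             (use g(2)[of "cos _"] in \<open>auto intro!: integrable_abs Bochner_Integration.integrable_diff cont_int A f cg less_imp_le continuous_on_diff\<close>)
        finally show ?thesis by (simp add: prob_space)
      qed
      show ?thesis using d[OF M] d[OF N] Lg unfolding L_def by linarith
    qed
    note le = this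
    have "\<bar>L f\<bar> \<le> 0"
    proof (rule field_le_epsilon)
      show "\<bar>L f\<bar> \<le> 0 + e" if "0 < e" for e using le[of "e / 2"] that by simp
    qed
    then show ?thesis by simp
  qed
  have same: "(\<integral>x. f x \<partial>M) = (\<integral>x. f x \<partial>N)" if f: "continuous_on UNIV f" for f :: "real \<Rightarrow> real"
  proof -
    have [measurable]: "f \<in> borel_measurable borel" using f by (rule borel_measurable_continuous_onI)
    have "(\<integral>x. f (R * cos (clamp_arccos R x)) \<partial>A) = (\<integral>x. f x \<partial>A)" if A: "A \<in> probs_on R" for A
    proof (rule integral_cong_AE)
      note [measurable_cong] = probs_onD(2)[OF A]
      show "(\<lambda>x. f (R * cos (clamp_arccos R x))) \<in> borel_measurable A" "f \<in> borel_measurable A" by measurable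
      show "AE x in A. f (R * cos (clamp_arccos R x)) = f x"
        using probs_onD(4)[OF A] by eventually_elim (use R in \<open>simp add: cos_clamp_arccos\<close>)
    qed
    moreover have "L (\<lambda>y. f (R * y)) = 0"
      by (rule L0, rule continuous_on_compose2[OF f]) (auto intro!: continuous_intros)
    ultimately show ?thesis using M N by (simp add: L_def)
  qed
  have rdM: "real_distribution M" and rdN: "real_distribution N"
    using probs_onD[OF M] probs_onD[OF N] by (auto simp: real_distribution_def real_distribution_axioms_def)
  \<comment> \<open>Splitting into cosine and sine integrals makes \<open>same\<close>, which
    concerns real functions, applicable.\<close>
  have char_eq: "char A t = Complex (\<integral>x. cos (t * x) \<partial>A) (\<integral>x. sin (t * x) \<partial>A)" if "real_distribution A" for A t
  proof -
    interpret real_distribution A by fact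
    have "integrable A (\<lambda>x. iexp (t * x))"
      by (rule integrable_iexp) auto
    then show ?thesis
      unfolding char_def by (intro complex_eqI) (simp_all flip: integral_Re integral_Im add: Re_exp Im_exp)
  qed
  have "char M = char N"
  proof
    fix t
    show "char M t = char N t"
      unfolding char_eq[OF rdM] char_eq[OF rdN]
      by (intro arg_cong2[where f = Complex] same continuous_intros)
  qed
  then show ?thesis by (rule Levy_uniqueness[OF rdM rdN])
qed

text \<open>The energy difference is half the (positive definite)
  logarithmic energy of \<open>\<nu> - \<rho>\<close> plus the integral of the effective potential \<open>U + V\<close> against \<open>\<nu> - \<rho>\<close>.\<close>
lemma euler_lagrange_unique_minimiser:
  assumes \<rho>: "\<rho> \<in> probs_on R" and R: "R > 0" and V: "continuous_on UNIV V"
    and noatom: "\<And>x. AE y in \<rho>. x \<noteq> y"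
    and int: "\<And>x. x \<in> {-R..R} \<Longrightarrow> integrable \<rho> (\<lambda>y. - ln \<bar>x - y\<bar>)"
    and Ub: "\<And>x. x \<in> {-R..R} \<Longrightarrow> (\<integral>y. - ln \<bar>x - y\<bar> \<partial>\<rho>) \<le> B"
    and ge: "\<And>x. x \<in> {-R..R} \<Longrightarrow> C \<le> (\<integral>y. - ln \<bar>x - y\<bar> \<partial>\<rho>) + V x"
    and eq: "AE x in \<rho>. (\<integral>y. - ln \<bar>x - y\<bar> \<partial>\<rho>) + V x = C"
  shows "constrained_minimiser V R \<rho>" "\<And>\<nu>. constrained_minimiser V R \<nu> \<Longrightarrow> \<nu> = \<rho>"
proof -
  define U where "U x = (\<integral>y. - ln \<bar>x - y\<bar> \<partial>\<rho>)" for x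
  have fin: "log_finite \<nu> \<rho>" "integrable \<nu> U" "log_energy \<nu> \<rho> = (\<integral>x. U x \<partial>\<nu>)" if \<nu>: "\<nu> \<in> probs_on R" for \<nu>
  proof -
    note pM = probs_onD[OF \<nu>] and pN = probs_onD[OF \<rho>]
    note [measurable_cong] = pM(2) pN(2)
    interpret M: prob_space \<nu> by fact
    interpret N: prob_space \<rho> by fact
    interpret pair_prob_space \<nu> \<rho> ..
    have ae: "AE p in \<nu> \<Otimes>\<^sub>M \<rho>. fst p \<noteq> snd p"
      by (rule AE_pair_measure) (use noatom in auto)
    \<comment> \<open>If \<open>u \<ge> - c\<close> with \<open>c \<ge> 0\<close>, then
      \<open>|u| \<le> u + 2 c\<close>. With \<open>c = |ln (2 R)|\<close> the upper bound on the
      potential therefore bounds the integral of the absolute kernel, as Fubini's theorem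
      requires.\<close>
    let ?c = "2 * \<bar>ln (2 * R)\<bar>"
    have i: "integrable (\<nu> \<Otimes>\<^sub>M \<rho>) (\<lambda>p. - ln \<bar>fst p - snd p\<bar>)"
    proof (rule Fubini_integrable)
      show "AE x in \<nu>. integrable \<rho> (\<lambda>y. - ln \<bar>fst (x, y) - snd (x, y)\<bar>)"
        using pM(4) by eventually_elim (use int in simp)
      show "integrable \<nu> (\<lambda>x. \<integral>y. norm (- ln \<bar>fst (x, y) - snd (x, y)\<bar>) \<partial>\<rho>)"
      proof (rule M.integrable_const_bound[where B = "B + ?c"])
        show "AE x in \<nu>. norm (\<integral>y. norm (- ln \<bar>fst (x, y) - snd (x, y)\<bar>) \<partial>\<rho>) \<le> B + ?c"
          using pM(4)
        proof eventually_elim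
          case (elim x)
          have "(\<integral>y. \<bar>- ln \<bar>x - y\<bar>\<bar> \<partial>\<rho>) \<le> (\<integral>y. - ln \<bar>x - y\<bar> + ?c \<partial>\<rho>)"
          proof (rule integral_mono_AE)
            show "AE y in \<rho>. \<bar>- ln \<bar>x - y\<bar>\<bar> \<le> - ln \<bar>x - y\<bar> + ?c"
              using pN(4)
            proof eventually_elim
              case (elim y)
              with ln_abs_diff_le[of x R y] \<open>x \<in> {-R..R}\<close> show ?case by (auto simp: abs_if)
            qed
          qed (use int[OF elim] in auto)
          also have "\<dots> = (\<integral>y. - ln \<bar>x - y\<bar> \<partial>\<rho>) + ?c"
            using int[OF elim] by (subst Bochner_Integration.integral_add) (simp_all add: N.prob_space)
          also have "\<dots> \<le> B + ?c" using Ub[OF elim] by simp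
          finally show ?case by simp
        qed
      qed measurable
    qed measurable
    show "log_finite \<nu> \<rho>" using ae i by (simp add: log_finite_def)
    have i': "integrable (\<nu> \<Otimes>\<^sub>M \<rho>) (case_prod (\<lambda>x y. - ln \<bar>x - y\<bar>))" using i by (simp add: case_prod_unfold)
    show "integrable \<nu> U" unfolding U_def[abs_def] by (rule integrable_fst[OF i'])
    show "log_energy \<nu> \<rho> = (\<integral>x. U x \<partial>\<nu>)"
      unfolding U_def log_energy_def integral_fst[OF i'] by (simp add: case_prod_unfold)
  qed
  note f\<rho> = fin[OF \<rho>]
  have E\<rho>: "energy V \<rho> = ereal (log_energy \<rho> \<rho> / 2 + (\<integral>x. V x \<partial>\<rho>))"
    by (rule energy_eq[OF \<rho> V f\<rho>(1)])
  define D where "D \<nu> n = 2 / real (Suc n) * (cheb_moment R \<nu> (Suc n) - cheb_moment R \<rho> (Suc n))\<^sup>2" for \<nu> n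
  have D_nonneg: "0 \<le> D \<nu> n" for \<nu> n by (simp add: D_def)
  have diff: "D \<nu> n / 2 + (log_energy \<rho> \<rho> / 2 + (\<integral>x. V x \<partial>\<rho>)) \<le> log_energy \<nu> \<nu> / 2 + (\<integral>x. V x \<partial>\<nu>)"
    if \<nu>: "\<nu> \<in> probs_on R" and f: "log_finite \<nu> \<nu>" for \<nu> n
  proof -
    interpret M: prob_space \<nu> by (rule probs_onD[OF \<nu>])
    interpret N: prob_space \<rho> by (rule probs_onD[OF \<rho>])
    have iV: "integrable \<nu> V" "integrable \<rho> V" by (rule integrable_V_probs_on[OF _ V]; fact)+
    have "(\<integral>x. C \<partial>\<nu>) \<le> (\<integral>x. U x + V x \<partial>\<nu>)"
    proof (rule integral_mono_AE)
      show "AE x in \<nu>. C \<le> U x + V x"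
        using probs_onD(4)[OF \<nu>] by eventually_elim (use ge in \<open>simp add: U_def\<close>)
    qed (use fin(2)[OF \<nu>] iV in auto)
    then have 1: "C \<le> (\<integral>x. U x \<partial>\<nu>) + (\<integral>x. V x \<partial>\<nu>)"
      using fin(2)[OF \<nu>] iV by (simp add: M.prob_space)
    have "(\<integral>x. U x + V x \<partial>\<rho>) = (\<integral>x. C \<partial>\<rho>)"
      by (rule integral_cong_AE) (use eq[folded U_def] f\<rho>(2) iV in auto)
    then have 2: "(\<integral>x. U x \<partial>\<rho>) + (\<integral>x. V x \<partial>\<rho>) = C"
      using f\<rho>(2) iV by (simp add: N.prob_space)
    have "D \<nu> n \<le> log_energy \<nu> \<nu> - 2 * log_energy \<nu> \<rho> + log_energy \<rho> \<rho>"
      unfolding D_def by (rule log_energy_diff_ge[OF \<nu> \<rho> R f fin(1)[OF \<nu>] f\<rho>(1)])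
    then show ?thesis using 1 2 fin(3)[OF \<nu>] f\<rho>(3) by linarith
  qed
  show min: "constrained_minimiser V R \<rho>"
    unfolding constrained_minimiser_def
  proof (intro conjI ballI \<rho>)
    fix \<nu> assume \<nu>: "\<nu> \<in> probs_on R"
    show "energy V \<rho> \<le> energy V \<nu>"
    proof (cases "log_finite \<nu> \<nu>")
      case True
      have "log_energy \<rho> \<rho> / 2 + (\<integral>x. V x \<partial>\<rho>) \<le> log_energy \<nu> \<nu> / 2 + (\<integral>x. V x \<partial>\<nu>)"
        using diff[OF \<nu> True, of 0] D_nonneg[of \<nu> 0] by linarith
      then show ?thesis unfolding energy_eq[OF \<nu> V True] E\<rho> by simp
    qed (simp add: energy_infinite[OF \<nu> V])
  qed
  fix \<nu> assume "constrained_minimiser V R \<nu>"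
  then have \<nu>: "\<nu> \<in> probs_on R" and le: "energy V \<nu> \<le> energy V \<rho>"
    using \<rho> by (auto simp: constrained_minimiser_def)
  \<comment> \<open>A minimiser does at least as well as \<open>\<rho>\<close>, whose energy is
    finite.\<close>
  have f: "log_finite \<nu> \<nu>" using le energy_infinite[OF \<nu> V] E\<rho> by (cases "log_finite \<nu> \<nu>") auto
  have "log_energy \<nu> \<nu> / 2 + (\<integral>x. V x \<partial>\<nu>) \<le> log_energy \<rho> \<rho> / 2 + (\<integral>x. V x \<partial>\<rho>)"
    using le unfolding energy_eq[OF \<nu> V f] E\<rho> by simp
  then have "D \<nu> n = 0" for n
    using diff[OF \<nu> f, of n] D_nonneg[of \<nu> n] by linarith
  then have "cheb_moment R \<nu> (Suc n) = cheb_moment R \<rho> (Suc n)" for n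
    by (simp add: D_def del: of_nat_Suc)
  then show "\<nu> = \<rho>" by (rule cheb_moments_determine[OF \<nu> \<rho> R])
qed

subsection \<open>Equilibrium measures\<close>

text \<open>The substitution rule wants an increasing map, hence \<open>x = - S cos t\<close>; the
  sign is removed by the reflection invariance of \<open>ang\<close>. Since
  \<open>sqrt (S^2 - x^2) = S sin t\<close>, the derivative cancels and the constant density
  \<open>1 / pi\<close> remains.\<close>

lemma distr_ang_cos:
  assumes S: "S > 0"
  shows "distr ang borel (\<lambda>t. S * cos t) = density lborel (\<lambda>x. ennreal (indicator {-S<..<S} x / (pi * sqrt (S\<^sup>2 - x\<^sup>2))))"
    (is "_ = density lborel (\<lambda>x. ennreal (?w x))")
proof (rule measure_eqI)
  fix A assume "A \<in> sets (distr ang borel (\<lambda>t. S * cos t))"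
  then have [measurable]: "A \<in> sets borel" by simp
  define f where "f x = indicator A x * ?w x" for x
  have [measurable]: "f \<in> borel_measurable borel" unfolding f_def by measurable
  have w: "?w (- S * cos t) * (S * sin t) = 1 / pi" if "0 < t" "t < pi" for t
  proof -
    have s: "sin t > 0" using that by (simp add: sin_gt_zero)
    have "S\<^sup>2 - (- S * cos t)\<^sup>2 = (S * sin t)\<^sup>2"
      by (simp add: power_mult_distrib sin_squared_eq algebra_simps)
    then have q: "sqrt (S\<^sup>2 - (- S * cos t)\<^sup>2) = S * sin t" using s S by (simp only: real_sqrt_abs) simp
    have "\<bar>cos t\<bar> < 1"
    proof -
      have "(cos t)\<^sup>2 < 1" using s by (simp add: cos_squared_eq)
      then show ?thesis by (simp add: abs_square_less_1)
    qed
    then have "S * \<bar>cos t\<bar> < S * 1" using S by (intro mult_strict_left_mono)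
    then have "\<bar>- S * cos t\<bar> < S" using S by (simp add: abs_mult)
    then have "- S * cos t \<in> {-S<..<S}" by (auto simp: abs_less_iff)
    then show ?thesis using s S unfolding q by simp
  qed
  have "emeasure (density lborel (\<lambda>x. ennreal (?w x))) A = (\<integral>\<^sup>+x. ennreal (?w x) * indicator A x \<partial>lborel)"
    by (rule emeasure_density) auto
  also have "\<dots> = (\<integral>\<^sup>+x. ennreal (f x * indicator {- S * cos 0..- S * cos pi} x) \<partial>lborel)"
    by (intro nn_integral_cong) (auto simp: f_def indicator_def)
  also have "\<dots> = (\<integral>\<^sup>+t. ennreal (f (- S * cos t) * (S * sin t) * indicator {0..pi} t) \<partial>lborel)"
    by (rule nn_integral_substitution)
       (auto intro!: derivative_eq_intros continuous_intros simp: set_borel_measurable_def S less_imp_le sin_ge_zero)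
  also have "\<dots> = (\<integral>\<^sup>+t. ennreal (indicator {0..pi} t / pi) * indicator A (- S * cos t) \<partial>lborel)"
  proof (rule nn_integral_cong_AE)
    have "AE t in lborel. t \<noteq> 0" "AE t in lborel. t \<noteq> pi" by (rule AE_lborel_singleton)+
    then show "AE t in lborel. ennreal (f (- S * cos t) * (S * sin t) * indicator {0..pi} t) = ennreal (indicator {0..pi} t / pi) * indicator A (- S * cos t)"
    proof eventually_elim
      case (elim t)
      show ?case
      proof (cases "t \<in> {0..pi}")
        case True
        then have "f (- S * cos t) * (S * sin t) = indicator A (- S * cos t) * (1 / pi)"
          using w[of t] elim unfolding f_def by (simp only: mult.assoc) (simp add: less_le)
        then show ?thesis using True by (auto simp: indicator_def)
      qed simp
    qed
  qed
  also have "\<dots> = (\<integral>\<^sup>+t. indicator A (- S * cos t) \<partial>ang)"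
    unfolding ang_eq_density by (subst nn_integral_density) auto
  also have "\<dots> = (\<integral>\<^sup>+t. indicator A (S * cos t) \<partial>distr ang borel (\<lambda>t. pi - t))"
    by (subst nn_integral_distr) auto
  also have "\<dots> = emeasure (distr ang borel (\<lambda>t. S * cos t)) A"
    unfolding distr_ang_reflect
    by (subst emeasure_distr) (auto simp: nn_integral_indicator[symmetric] indicator_def vimage_def simp del: nn_integral_indicator intro!: nn_integral_cong)
  finally show "emeasure (distr ang borel (\<lambda>t. S * cos t)) A = emeasure (density lborel (\<lambda>x. ennreal (?w x))) A" ..
qed simp

lemma measurable_cheb [measurable]: "cheb n \<in> borel_measurable borel"
  by (rule borel_measurable_continuous_onI[OF continuous_cheb])

context even_convex_potential
begin

lemma cheb_coeff_eq_coef: "cheb_coeff V (Suc n) S = coef S n"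
proof -
  let ?g = "\<lambda>x. V (S * x) * cheb (Suc n) x"
  have [measurable]: "?g \<in> borel_measurable borel" by measurable
  \<comment> \<open>The factor 1 is the radius in \<open>distr_ang_cos\<close>: the coefficients are
    integrals over \<open>(-1, 1)\<close>, and \<open>S\<close> stays inside
    \<open>?g\<close>.\<close>
  have "(\<integral>t. ?g (1 * cos t) \<partial>ang) = (\<integral>x. ?g x \<partial>distr ang borel (\<lambda>t. 1 * cos t))"
    by (rule integral_distr[symmetric]) measurable
  also have "\<dots> = (\<integral>x. (indicator {-1<..<1} x / (pi * sqrt (1\<^sup>2 - x\<^sup>2))) *\<^sub>R ?g x \<partial>lborel)"
    by (subst distr_ang_cos, simp, rule integral_density)
       (auto intro!: AE_I2 divide_nonneg_nonneg simp: indicator_def abs_square_le_1 abs_le_iff)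
  also have "\<dots> = (\<integral>x. (indicator {-1<..<1} x *\<^sub>R (?g x / sqrt (1 - x\<^sup>2))) / pi \<partial>lborel)"
    by (intro Bochner_Integration.integral_cong) auto
  also have "\<dots> = (LINT x:{-1<..<1}|lborel. ?g x / sqrt (1 - x\<^sup>2)) / pi"
    unfolding set_lebesgue_integral_def by (rule integral_divide_zero)
  finally have "(LINT x:{-1<..<1}|lborel. ?g x / sqrt (1 - x\<^sup>2)) = pi * (\<integral>t. V (S * cos t) * cos (real (Suc n) * t) \<partial>ang)"
    by (simp add: cheb_cos del: cheb.simps of_nat_Suc)
  then show ?thesis by (simp add: cheb_coeff_def cheb_h_def coef_def del: cheb.simps)
qed

lemma crit_sum_eq: "crit_sum V S = crit S"
  by (simp add: crit_sum_def crit_def cheb_coeff_eq_coef del: of_nat_Suc)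

lemma P_R_eq: "P_R V S x = 1 - (\<Sum>n. real (Suc n) * coef S n * cheb (Suc n) (x / S))"
  by (simp add: P_R_def cheb_coeff_eq_coef del: of_nat_Suc cheb.simps)

lemma P_R_cos: "S \<noteq> 0 \<Longrightarrow> P_R V S (S * cos t) = pushed_weight S t"
  by (simp add: P_R_eq pushed_weight_def cos_series_def cheb_cos del: of_nat_Suc cheb.simps)

lemma measurable_P_R [measurable]: "P_R V S \<in> borel_measurable borel"
  unfolding P_R_eq by measurable

lemma P_R_nonneg:
  assumes "S > 0" "crit S \<le> 1" "x \<in> {-S..S}"
  shows "0 \<le> P_R V S x"
proof -
  have "x = S * cos (arccos (x / S))" using assms by (simp add: field_simps)
  then have "P_R V S x = pushed_weight S (arccos (x / S))" using P_R_cos[of S "arccos (x / S)"] assms(1) by simp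
  then show ?thesis using pushed_weight_ge[of S "arccos (x / S)"] assms by linarith
qed

text \<open>For \<open>S\<close> close to \<open>S0\<close> the point \<open>x / S\<close> lies in
  \<open>[-1, 1]\<close>, where Chebyshev polynomials are bounded by 1; this is the bound on
  multipliers that \<open>tendsto_coef_series\<close> demands.\<close>

lemma tendsto_P_R:
  assumes "\<bar>x\<bar> < S0"
  shows "((\<lambda>S. P_R V S x) \<longlongrightarrow> P_R V S0 x) (at_left S0)"
  unfolding P_R_eq
proof (intro tendsto_diff tendsto_const tendsto_coef_series)
  show "at_left S0 \<le> nhds S0" by (rule at_within_le_nhds)
  show "((\<lambda>S. cheb (Suc n) (x / S)) \<longlongrightarrow> cheb (Suc n) (x / S0)) (at_left S0)" for n
  proof -
    have "isCont (cheb (Suc n)) (x / S0)" using continuous_cheb[of "Suc n"] by (simp add: continuous_on_eq_continuous_at del: cheb.simps)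
    then show ?thesis by (rule isCont_tendsto_compose) (use assms in \<open>auto intro!: tendsto_intros\<close>)
  qed
  have "\<forall>\<^sub>F S in at_left S0. S \<in> {\<bar>x\<bar><..<S0}"
    using assms by (intro eventually_at_leftI[of "\<bar>x\<bar>"]) auto
  then show "\<forall>\<^sub>F S in at_left S0. \<forall>n. \<bar>cheb (Suc n) (x / S)\<bar> \<le> 1"
  proof eventually_elim
    case (elim S)
    then have "0 < S" using abs_ge_zero[of x] by (auto simp del: abs_ge_zero)
    with elim have "\<bar>x / S\<bar> \<le> 1" by (simp add: abs_divide)
    then show ?case by (auto intro: abs_cheb_le simp del: cheb.simps)
  qed
qed simp

text \<open>As an image of a weighted law on angles, its moments and potentials are integrals
  against \<open>ang\<close>. A negative weight would be truncated by \<open>ennreal\<close>, so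
  \<open>crit S \<le> 1\<close> accompanies the facts that integrate against it.\<close>

definition equilibrium :: "real \<Rightarrow> real measure" where
  "equilibrium S = distr (density ang (\<lambda>t. ennreal (pushed_weight S t))) borel (\<lambda>t. S * cos t)"

lemma equilibrium_eq_density:
  assumes S: "S > 0" and c: "crit S \<le> 1"
  shows "equilibrium S = density lborel (\<lambda>x. ennreal (P_R V S x / (pi * sqrt (S\<^sup>2 - x\<^sup>2)) * indicator {-S<..<S} x))"
proof -
  have "equilibrium S = distr (density ang (\<lambda>t. ennreal (P_R V S (S * cos t)))) borel (\<lambda>t. S * cos t)"
    using S by (simp add: equilibrium_def P_R_cos)
  also have "\<dots> = density (distr ang borel (\<lambda>t. S * cos t)) (\<lambda>x. ennreal (P_R V S x))"
    by (rule density_distr[symmetric]) measurable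
  also have "\<dots> = density lborel (\<lambda>x. ennreal (indicator {-S<..<S} x / (pi * sqrt (S\<^sup>2 - x\<^sup>2))) * ennreal (P_R V S x))"
    unfolding distr_ang_cos[OF S] by (rule density_density_eq) measurable
  also have "\<dots> = density lborel (\<lambda>x. ennreal (P_R V S x / (pi * sqrt (S\<^sup>2 - x\<^sup>2)) * indicator {-S<..<S} x))"
    using P_R_nonneg[OF S c]
    by (intro density_cong) (auto simp: indicator_def ennreal_mult''[symmetric])
  finally show ?thesis .
qed

lemma pushed_weight_nonneg: "S \<ge> 0 \<Longrightarrow> crit S \<le> 1 \<Longrightarrow> 0 \<le> pushed_weight S t"
  using pushed_weight_ge[of S t] by linarith

lemma integral_equilibrium:
  fixes h :: "real \<Rightarrow> real"
  assumes "S \<ge> 0" "crit S \<le> 1" and [measurable]: "h \<in> borel_measurable borel"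
  shows "integrable (equilibrium S) h \<longleftrightarrow> integrable ang (\<lambda>t. h (S * cos t) * pushed_weight S t)"
    "(\<integral>x. h x \<partial>equilibrium S) = (\<integral>t. h (S * cos t) * pushed_weight S t \<partial>ang)"
proof -
  have [measurable]: "(\<lambda>t. S * cos t) \<in> borel_measurable (density ang (\<lambda>t. ennreal (pushed_weight S t)))"
    by measurable
  show "integrable (equilibrium S) h \<longleftrightarrow> integrable ang (\<lambda>t. h (S * cos t) * pushed_weight S t)"
    unfolding equilibrium_def using pushed_weight_nonneg[OF assms(1,2)]
    by (subst integrable_distr_eq, measurable, subst integrable_density) (auto simp: mult.commute)
  show "(\<integral>x. h x \<partial>equilibrium S) = (\<integral>t. h (S * cos t) * pushed_weight S t \<partial>ang)"
    unfolding equilibrium_def using pushed_weight_nonneg[OF assms(1,2)]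
    by (subst integral_distr, measurable, subst integral_density) (auto simp: mult.commute)
qed

lemma AE_equilibrium:
  assumes "AE t in ang. P (S * cos t)" and [measurable]: "Measurable.pred borel P"
  shows "AE x in equilibrium S. P x"
proof -
  have "AE t in density ang (\<lambda>t. ennreal (pushed_weight S t)). P (S * cos t)"
    using assms(1) by (subst AE_density) (auto elim!: AE_mp)
  then show ?thesis unfolding equilibrium_def by (subst AE_distr_iff) auto
qed

lemma equilibrium_probs_on:
  assumes S: "0 < S" "S \<le> R" and c: "crit S \<le> 1"
  shows "equilibrium S \<in> probs_on R"
proof -
  have e: "emeasure (equilibrium S) UNIV = 1"
  proof -
    have "emeasure (equilibrium S) UNIV = (\<integral>\<^sup>+t. ennreal (pushed_weight S t) \<partial>ang)"
      unfolding equilibrium_def by (subst emeasure_distr) (auto simp: emeasure_density)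
    also have "\<dots> = ennreal (\<integral>t. pushed_weight S t \<partial>ang)"
      by (rule nn_integral_eq_integral[OF integrable_ang_continuous[OF continuous_pushed_weight]])
         (use pushed_weight_nonneg S c in auto)
    finally show ?thesis by (simp add: integral_pushed_weight)
  qed
  have sets: "sets (equilibrium S) = sets borel" and sp: "space (equilibrium S) = UNIV"
    by (simp_all add: equilibrium_def)
  interpret E: prob_space "equilibrium S" by (rule prob_spaceI) (simp add: sp e)
  have "AE x in equilibrium S. x \<in> {-R..R}"
  proof (rule AE_equilibrium[OF AE_I2])
    fix t
    have "\<bar>S * cos t\<bar> \<le> S" using abs_mult_cos_le[of S t] S by simp
    then show "S * cos t \<in> {-R..R}" using S unfolding atLeastAtMost_iff by linarith
  qed measurable
  then have "emeasure (equilibrium S) {-R..R} = 1"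
    using E.emeasure_eq_1_AE[of "{-R..R}"] sets by simp
  then show ?thesis using sets E.prob_space_axioms by (simp add: probs_on_def)
qed

section \<open>The potential on and off the support\<close>

definition log_potential :: "real \<Rightarrow> real \<Rightarrow> real" where
  "log_potential S x = (\<integral>t. - ln \<bar>x - S * cos t\<bar> * pushed_weight S t \<partial>ang)"

lemma log_potential_eq_inside:
  assumes S: "S > 0" and x: "x \<in> {-S..S}"
  shows "integrable ang (\<lambda>t. - ln \<bar>x - S * cos t\<bar> * pushed_weight S t)"
    "log_potential S x = ln 2 - ln S + coef0 S - V x"
proof -
  have "x = S * cos (arccos (x / S))" using S x by (simp add: field_simps)
  then show "integrable ang (\<lambda>t. - ln \<bar>x - S * cos t\<bar> * pushed_weight S t)"
    "log_potential S x = ln 2 - ln S + coef0 S - V x"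
    using log_potential_inside[OF S, of "arccos (x / S)"] by (simp_all add: log_potential_def)
qed

lemma integrable_log_potential_outside:
  assumes "S > 0" "S < \<bar>x\<bar>"
  shows "integrable ang (\<lambda>t. - ln \<bar>x - S * cos t\<bar> * pushed_weight S t)"
proof (rule integrable_ang_continuous, intro continuous_intros continuous_pushed_weight ballI)
  fix t
  have "\<bar>S * cos t\<bar> \<le> S" using abs_mult_cos_le[of S t] assms by simp
  then show "\<bar>x - S * cos t\<bar> \<noteq> 0" using assms by auto
qed

lemma log_potential_even: "log_potential S (- x) = log_potential S x"
proof -
  have "log_potential S x = (\<integral>t. - ln \<bar>x - S * cos (pi - t)\<bar> * pushed_weight S (pi - t) \<partial>ang)"
    unfolding log_potential_def by (rule integral_ang_reflect[symmetric]) measurable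
  also have "\<dots> = log_potential S (- x)"
    unfolding log_potential_def pushed_weight_reflect
    by (intro Bochner_Integration.integral_cong refl arg_cong2[where f = "(*)"] arg_cong[where f = uminus] arg_cong[where f = ln]) auto
  finally show ?thesis ..
qed

text \<open>The lower bound limits the decrease of the potential beyond the edge and yields the
  Euler--Lagrange inequality there; the upper bound supplies the boundedness that Fubini's theorem
  requires.\<close>

lemma log_potential_outside:
  assumes S: "S > 0" "S < x" and c: "crit S = 1"
  shows "log_potential S S - (x - S) * V1 S \<le> log_potential S x" "log_potential S x \<le> log_potential S S"
proof -
  note edge = integral_pushed_weight_edge[OF less_imp_le[OF S(1)] c]
  note nn = pushed_weight_nonneg[OF less_imp_le[OF S(1)] eq_refl[OF c]]
  have Sin: "S \<in> {-S..S}" using S by simp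
  note i = log_potential_eq_inside(1)[OF S(1) Sin] integrable_log_potential_outside[of S x]
  have ix: "integrable ang (\<lambda>t. - ln \<bar>x - S * cos t\<bar> * pushed_weight S t)" using i(2) S by simp
  have pt: "0 < S - S * cos t" "S - S * cos t < x - S * cos t" if "cos t \<noteq> 1" for t
  proof -
    have "cos t < 1" using that cos_le_one[of t] by linarith
    then have "S * cos t < S * 1" using S by (intro mult_strict_left_mono)
    then show "0 < S - S * cos t" "S - S * cos t < x - S * cos t" using S by auto
  qed
  show "log_potential S x \<le> log_potential S S"
    unfolding log_potential_def
  proof (rule integral_mono_AE[OF ix i(1)])
    show "AE t in ang. - ln \<bar>x - S * cos t\<bar> * pushed_weight S t \<le> - ln \<bar>S - S * cos t\<bar> * pushed_weight S t"
      using AE_ang_cos_neq[of 1]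
    proof eventually_elim
      case (elim t)
      then show ?case using pt[OF elim] by (intro mult_right_mono nn) (simp add: abs_of_pos)
    qed
  qed
  have "(\<integral>t. - ln \<bar>S - S * cos t\<bar> * pushed_weight S t - (x - S) / S * (pushed_weight S t / (1 - cos t)) \<partial>ang) \<le> log_potential S x"
    unfolding log_potential_def
  proof (rule integral_mono_AE[OF _ ix])
    show "integrable ang (\<lambda>t. - ln \<bar>S - S * cos t\<bar> * pushed_weight S t - (x - S) / S * (pushed_weight S t / (1 - cos t)))"
      by (intro Bochner_Integration.integrable_diff i(1) integrable_mult_right edge(1))
    show "AE t in ang. - ln \<bar>S - S * cos t\<bar> * pushed_weight S t - (x - S) / S * (pushed_weight S t / (1 - cos t)) \<le> - ln \<bar>x - S * cos t\<bar> * pushed_weight S t"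
      using AE_ang_cos_neq[of 1]
    proof eventually_elim
      case (elim t)
      let ?a = "S - S * cos t" and ?b = "x - S * cos t"
      have p: "0 < ?a" "0 < ?b" using pt[OF elim] by auto
      \<comment> \<open>The inequality \<open>ln u \<le> u - 1\<close> at \<open>u = ?b / ?a\<close>
        gives the loss \<open>(x - S) / (S (1 - cos t))\<close>, whose weighted mean is controlled
        by the edge integral.\<close>
      have "ln ?b - ln ?a = ln (?b / ?a)" using ln_divide_pos[OF p(2,1)] by (simp only:)
      also have "\<dots> \<le> ?b / ?a - 1" using p by (intro ln_le_minus_one) simp
      also have "\<dots> = (?b - ?a) / ?a"
        using diff_divide_distrib[of ?b ?a ?a] divide_self[OF less_imp_neq[OF p(1), symmetric]] by (simp only:)
      also have "?b - ?a = x - S" by simp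
      finally have "(ln ?b - ln ?a) * pushed_weight S t \<le> (x - S) / ?a * pushed_weight S t"
        by (intro mult_right_mono nn)
      also have "(x - S) / ?a * pushed_weight S t = (x - S) / S * (pushed_weight S t / (1 - cos t))"
      proof -
        have "?a = S * (1 - cos t)" by (simp add: algebra_simps)
        then show ?thesis by simp
      qed
      finally show ?case using p by (simp add: abs_of_pos algebra_simps)
    qed
  qed
  moreover have "(\<integral>t. - ln \<bar>S - S * cos t\<bar> * pushed_weight S t - (x - S) / S * (pushed_weight S t / (1 - cos t)) \<partial>ang)
     = log_potential S S - (x - S) / S * (\<integral>t. pushed_weight S t / (1 - cos t) \<partial>ang)"
    unfolding log_potential_def
    by (subst Bochner_Integration.integral_diff[OF i(1)]) (intro integrable_mult_right edge(1), simp only: integral_mult_right_zero)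
  moreover have "(x - S) / S * (\<integral>t. pushed_weight S t / (1 - cos t) \<partial>ang) \<le> (x - S) / S * (S * V1 S)"
    using S by (intro mult_left_mono edge(2)) auto
  moreover have "(x - S) / S * (S * V1 S) = (x - S) * V1 S" using S by simp
  ultimately show "log_potential S S - (x - S) * V1 S \<le> log_potential S x" by linarith
qed

theorem equilibrium_unique_minimiser:
  assumes S: "0 < S" "S \<le> R" and c: "crit S \<le> 1" and pulled: "S < R \<Longrightarrow> crit S = 1"
  shows "constrained_minimiser V R (equilibrium S)" "\<And>\<nu>. constrained_minimiser V R \<nu> \<Longrightarrow> \<nu> = equilibrium S"
proof -
  define C where "C = ln 2 - ln S + coef0 S"
  have pot: "(\<integral>y. - ln \<bar>x - y\<bar> \<partial>equilibrium S) = log_potential S x" for x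
    unfolding log_potential_def using S by (subst integral_equilibrium(2)[OF _ c]) auto
  have int: "integrable (equilibrium S) (\<lambda>y. - ln \<bar>x - y\<bar>)" for x
  proof -
    have "integrable ang (\<lambda>t. - ln \<bar>x - S * cos t\<bar> * pushed_weight S t)"
    proof (cases "S < \<bar>x\<bar>")
      case True
      then show ?thesis by (rule integrable_log_potential_outside[OF S(1)])
    next
      case False
      then have "x \<in> {-S..S}" unfolding atLeastAtMost_iff by linarith
      then show ?thesis by (rule log_potential_eq_inside(1)[OF S(1)])
    qed
    then show ?thesis using S by (subst integral_equilibrium(1)[OF _ c]) auto
  qed
  have Sin: "S \<in> {-S..S}" using S by simp
  have out: "log_potential S x \<le> C - V 0 \<and> C \<le> log_potential S x + V x" if x: "x \<in> {-R..R}" for x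
  proof (cases "x \<in> {-S..S}")
    case True
    have "V 0 \<le> V x" using V_mono[of 0 "\<bar>x\<bar>"] by (simp add: V_abs)
    then show ?thesis by (simp add: log_potential_eq_inside(2)[OF S(1) True] C_def)
  next
    case False
    then have ax: "S < \<bar>x\<bar>" by (auto simp: abs_if)
    with x have "S < R" by auto
    then have c1: "crit S = 1" by (rule pulled)
    have e: "log_potential S \<bar>x\<bar> = log_potential S x" by (simp add: abs_if log_potential_even)
    note o = log_potential_outside[OF S(1) ax c1, unfolded e log_potential_eq_inside(2)[OF S(1) Sin] C_def[symmetric]]
    \<comment> \<open>The tangent of \<open>V\<close> at \<open>S\<close> rises at the rate
      \<open>V1 S\<close>, exactly the largest rate at which the potential may fall outside the
      support.\<close>
    have "V1 S * (\<bar>x\<bar> - S) \<le> V x - V S" using above_tangent[of S "\<bar>x\<bar>"] by (simp add: V_abs)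
    moreover have "V 0 \<le> V S" using V_mono[of 0 S] S by simp
    ultimately show ?thesis using o by (simp add: mult.commute)
  qed
  have noatom: "AE y in equilibrium S. x \<noteq> y" for x
  proof (rule AE_equilibrium)
    show "AE t in ang. x \<noteq> S * cos t"
      using AE_ang_cos_neq[of "x / S"] by eventually_elim (use S in auto)
  qed measurable
  have [measurable]: "log_potential S \<in> borel_measurable borel"
  proof -
    have "(\<lambda>x. \<integral>t. - ln \<bar>x - S * cos t\<bar> * pushed_weight S t \<partial>ang) \<in> borel_measurable borel"
      by (rule ang.borel_measurable_lebesgue_integral) measurable
    then show ?thesis unfolding log_potential_def[abs_def] .
  qed
  have eq: "AE x in equilibrium S. log_potential S x + V x = C"
  proof (rule AE_equilibrium[OF AE_I2])
    fix t
    have "\<bar>S * cos t\<bar> \<le> S" using abs_mult_cos_le[of S t] S by simp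
    then have "S * cos t \<in> {-S..S}" unfolding atLeastAtMost_iff by linarith
    then show "log_potential S (S * cos t) + V (S * cos t) = C"
      by (simp add: log_potential_eq_inside(2)[OF S(1)] C_def)
  qed measurable
  have R: "R > 0" using S by simp
  note el = euler_lagrange_unique_minimiser[OF equilibrium_probs_on[OF S c] R cont(1) noatom int, unfolded pot, of "C - V 0" C]
  show "constrained_minimiser V R (equilibrium S)" "\<And>\<nu>. constrained_minimiser V R \<nu> \<Longrightarrow> \<nu> = equilibrium S"
    using out by (auto intro: el eq)
qed

section \<open>Existence of the critical radius\<close>

lemma critical_radius_exists:
  assumes V0: "V 0 < V 1"
  obtains Rs where "Rs > 0" "crit Rs = 1" "\<And>r. 0 < r \<Longrightarrow> r < Rs \<Longrightarrow> crit r < 1"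
proof -
  have "((\<lambda>S. V (2 * S) - V S) \<longlongrightarrow> V (2 * 0) - V 0) (at_right 0)"
    using cont(1) by (intro tendsto_diff isCont_tendsto_compose[of _ V] tendsto_intros)
      (auto simp: continuous_on_eq_continuous_at)
  then have "\<forall>\<^sub>F S in at_right 0. V (2 * S) - V S < 1" by (rule order_tendstoD) simp
  then obtain e where "0 < e" "\<And>y. 0 < y \<Longrightarrow> y < e \<Longrightarrow> V (2 * y) - V y < 1"
    unfolding eventually_at_right_field by blast
  then obtain a where a: "0 < a" "V (2 * a) - V a < 1" using dense[OF \<open>0 < e\<close>] by blast
  then have ca: "crit a < 1" using crit_le(2)[of a] by linarith
  \<comment> \<open>By convexity \<open>V b - V 0 \<ge> b (V 1 - V 0)\<close> for
    \<open>b \<ge> 1\<close>; the 8 compensates the constant in \<open>crit_ge\<close>, so that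
    \<open>crit b \<ge> 1\<close>.\<close>
  define b where "b = max 1 (max a (8 / (V 1 - V 0)))"
  have b: "1 \<le> b" "a \<le> b" "8 / (V 1 - V 0) \<le> b" by (auto simp: b_def)
  have "V 1 - V 0 \<le> (V b - V 0) / b"
  proof -
    have "V ((1 - 1 / b) *\<^sub>R 0 + (1 / b) *\<^sub>R b) \<le> (1 - 1 / b) * V 0 + (1 / b) * V b"
      using convex_onD[OF convex, of "1 / b" 0 b] b by simp
    then show ?thesis using b by (simp add: field_simps)
  qed
  then have "b * (V 1 - V 0) \<le> V b - V 0" using b by (simp add: field_simps)
  moreover have "8 \<le> b * (V 1 - V 0)" using b(3) V0 by (simp add: field_simps)
  ultimately have cb: "1 \<le> crit b" using crit_ge[of b] b by simp
  \<comment> \<open>Weak monotonicity of \<open>crit\<close> does not single out a root, so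
    compactness of the root set provides the least one; below \<open>a\<close> the value stays under
    \<open>crit a < 1\<close>.\<close>
  define Z where "Z = {r \<in> {a..b}. crit r = 1}"
  have cc: "continuous_on A crit" for A using isCont_crit by (auto intro: continuous_at_imp_continuous_on)
  have "\<exists>r\<ge>a. r \<le> b \<and> crit r = 1" by (rule IVT') (use ca cb b cc in auto)
  then have Zne: "Z \<noteq> {}" by (auto simp: Z_def)
  have "closed Z" unfolding Z_def
    using continuous_closed_preimage_constant[OF cc closed_atLeastAtMost[of a b], of 1] by (simp add: Collect_conj_eq)
  moreover have "Z = {a..b} \<inter> Z" by (auto simp: Z_def)
  ultimately have "compact Z" by (metis compact_Icc compact_Int_closed)
  then obtain Rs where Rs: "Rs \<in> Z" "\<And>r. r \<in> Z \<Longrightarrow> Rs \<le> r"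
    using compact_attains_inf[OF _ Zne] by blast
  show ?thesis
  proof (rule that[of Rs])
    show "Rs > 0" "crit Rs = 1" using Rs a by (auto simp: Z_def)
    fix r assume r: "0 < r" "r < Rs"
    show "crit r < 1"
    proof (cases "r < a")
      case True
      then show ?thesis using crit_mono[of r a] r ca by simp
    next
      case False
      have "crit r \<le> 1" using crit_mono[of r Rs] r Rs by (simp add: Z_def)
      moreover have "crit r \<noteq> 1" using Rs(2)[of r] Rs(1) r False by (auto simp: Z_def)
      ultimately show ?thesis by simp
    qed
  qed
qed

end

section \<open>The pushed and the pulled phase\<close>

theorem theorem1:
  fixes V :: "real \<Rightarrow> real"
  assumes smooth: "\<forall>k<3. \<forall>x. ((deriv ^^ k) V) differentiable (at x)"
      and smooth3: "continuous_on UNIV ((deriv ^^ 3) V)"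
      and even: "\<forall>x. V (- x) = V x"
      and convex: "strictly_convex V"
      and growth: "Liminf at_infinity (\<lambda>x. ereal (V x / ln \<bar>x\<bar>)) > 1"
  shows "\<exists>Rs > 0. crit_sum V Rs = 1 \<and> (\<forall>r. 0 < r \<and> r < Rs \<longrightarrow> crit_sum V r \<noteq> 1) \<and>
     (\<exists>Q. (\<forall>x. \<bar>x\<bar> < Rs \<longrightarrow> ((\<lambda>R. P_R V R x / (R\<^sup>2 - x\<^sup>2)) \<longlongrightarrow> Q x) (at_left Rs)) \<and>
          (\<forall>x \<in> {-Rs..Rs}. Q x \<ge> 0) \<and>
          (\<forall>R > 0.
             (R < Rs \<longrightarrow> (\<forall>x \<in> {-R..R}. P_R V R x \<ge> 0)) \<and>
             (\<exists>!\<rho>. constrained_minimiser V R \<rho>) \<and>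
             constrained_minimiser V R
               (if R < Rs
                then density lborel (\<lambda>x. ennreal (P_R V R x / (pi * sqrt (R\<^sup>2 - x\<^sup>2))
                                             * indicator {-R<..<R} x))
                else density lborel (\<lambda>x. ennreal (Q x * sqrt (Rs\<^sup>2 - x\<^sup>2) / pi
                                             * indicator {-Rs..Rs} x)))))"
proof -
  have D: "((deriv ^^ k) V has_real_derivative (deriv ^^ Suc k) V x) (at x)" if "k < 3" for k x
    using smooth that by (simp add: DERIV_deriv_iff_real_differentiable)
  have sc: "V (t * x + (1 - t) * y) < t * V x + (1 - t) * V y" if "x \<noteq> y" "0 < t" "t < 1" for x y t
    using convex that by (simp add: strictly_convex_def)
  have conv: "convex_on UNIV V"
  proof (rule convex_onI)
    fix t x y :: real assume t: "0 < t" "t < 1"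
    show "V ((1 - t) *\<^sub>R x + t *\<^sub>R y) \<le> (1 - t) * V x + t * V y"
    proof (cases "x = y")
      case True
      then show ?thesis by (simp add: algebra_simps)
    next
      case False
      with sc[of y x t] t have "V (t * y + (1 - t) * x) < t * V y + (1 - t) * V x" by simp
      then show ?thesis by (simp add: add.commute)
    qed
  qed simp
  interpret even_convex_potential V "deriv V" "deriv (deriv V)" "(deriv ^^ 3) V"
  proof
    show "(V has_real_derivative deriv V x) (at x)" for x using D[of 0] by simp
    show "(deriv V has_real_derivative deriv (deriv V) x) (at x)" for x using D[of 1] by simp
    show "(deriv (deriv V) has_real_derivative (deriv ^^ 3) V x) (at x)" for x
      using D[of 2] by (simp add: numeral_2_eq_2 numeral_3_eq_3)
    show "V (- x) = V x" for x using even by simp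
  qed (fact smooth3 conv)+
  \<comment> \<open>Strict convexity at the midpoint 0 of -1 and 1, together with evenness, gives
    the growth from which the critical radius is obtained.\<close>
  have "V ((1/2) * 1 + (1 - 1/2) * (-1)) < (1/2) * V 1 + (1 - 1/2) * V (-1)"
    by (rule sc) simp_all
  then have "V 0 < V 1" using even by simp
  then obtain Rs where Rs: "Rs > 0" "crit Rs = 1" "\<And>r. 0 < r \<Longrightarrow> r < Rs \<Longrightarrow> crit r < 1"
    using critical_radius_exists by blast
  \<comment> \<open>At the endpoints division by 0 gives the value 0; the limit concerns interior
    points only, and nonnegativity persists there.\<close>
  define Q where "Q x = P_R V Rs x / (Rs\<^sup>2 - x\<^sup>2)" for x
  have sq: "0 < Rs\<^sup>2 - x\<^sup>2" if "\<bar>x\<bar> < Rs" for x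
    using that power_strict_mono[of "\<bar>x\<bar>" Rs 2] by simp
  have lim: "((\<lambda>R. P_R V R x / (R\<^sup>2 - x\<^sup>2)) \<longlongrightarrow> Q x) (at_left Rs)" if x: "\<bar>x\<bar> < Rs" for x
    unfolding Q_def using sq[OF x] by (intro tendsto_intros tendsto_P_R x) auto
  have Q_nonneg: "0 \<le> Q x" if x: "x \<in> {-Rs..Rs}" for x
  proof -
    have "x\<^sup>2 \<le> Rs\<^sup>2" using x Rs by (auto intro!: power2_le_iff_abs_le[THEN iffD2] simp: abs_le_iff)
    then show ?thesis using P_R_nonneg[OF Rs(1) _ x] Rs by (simp add: Q_def)
  qed
  have pushed: "equilibrium R = density lborel (\<lambda>x. ennreal (P_R V R x / (pi * sqrt (R\<^sup>2 - x\<^sup>2)) * indicator {-R<..<R} x))"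
    if "0 < R" "R \<le> Rs" for R
    by (rule equilibrium_eq_density) (use that crit_mono[of R Rs] Rs in auto)
  \<comment> \<open>Inside, \<open>P / sqrt D = (P / D) * sqrt D\<close> with
    \<open>D = Rs^2 - x^2\<close>. At the endpoints the open indicator on one side and
    \<open>sqrt 0\<close> on the other both give 0, so the densities agree everywhere.\<close>
  have pulled: "equilibrium Rs = density lborel (\<lambda>x. ennreal (Q x * sqrt (Rs\<^sup>2 - x\<^sup>2) / pi * indicator {-Rs..Rs} x))"
    unfolding pushed[OF Rs(1) order_refl]
  proof (rule arg_cong[where f = "density lborel"], rule ext)
    fix x
    show "ennreal (P_R V Rs x / (pi * sqrt (Rs\<^sup>2 - x\<^sup>2)) * indicator {-Rs<..<Rs} x) = ennreal (Q x * sqrt (Rs\<^sup>2 - x\<^sup>2) / pi * indicator {-Rs..Rs} x)"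
    proof (cases "\<bar>x\<bar> < Rs")
      case True
      then have "sqrt (Rs\<^sup>2 - x\<^sup>2) / (Rs\<^sup>2 - x\<^sup>2) = 1 / sqrt (Rs\<^sup>2 - x\<^sup>2)"
        using sq[OF True] by (simp add: real_div_sqrt field_simps)
      moreover have "Q x * sqrt (Rs\<^sup>2 - x\<^sup>2) / pi = P_R V Rs x / pi * (sqrt (Rs\<^sup>2 - x\<^sup>2) / (Rs\<^sup>2 - x\<^sup>2))"
        by (simp add: Q_def)
      ultimately have "Q x * sqrt (Rs\<^sup>2 - x\<^sup>2) / pi = P_R V Rs x / (pi * sqrt (Rs\<^sup>2 - x\<^sup>2))"
        by simp
      then show ?thesis using True by (simp add: indicator_def abs_less_iff)
    next
      case False
      then have "x \<notin> {-Rs<..<Rs}" by auto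
      then have "indicator {-Rs<..<Rs} x = (0::real)" by simp
      moreover have "Q x * sqrt (Rs\<^sup>2 - x\<^sup>2) / pi * indicator {-Rs..Rs} x = 0"
      proof (cases "\<bar>x\<bar> = Rs")
        case True
        then have "Rs\<^sup>2 - x\<^sup>2 = 0" using power2_abs[of x] by simp
        then show ?thesis by simp
      next
        case False
        with \<open>\<not> \<bar>x\<bar> < Rs\<close> have "x \<notin> {-Rs..Rs}" by auto
        then show ?thesis by simp
      qed
      ultimately show ?thesis by (simp only: mult_zero_right)
    qed
  qed
  have unique: "constrained_minimiser V R (equilibrium S) \<and> (\<exists>!\<rho>. constrained_minimiser V R \<rho>)"
    if "0 < S" "S \<le> R" "crit S \<le> 1" "S < R \<Longrightarrow> crit S = 1" for R S
    using equilibrium_unique_minimiser[OF that] by blast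
  have minimiser: "constrained_minimiser V R (if R < Rs then equilibrium R else equilibrium Rs) \<and>
      (\<exists>!\<rho>. constrained_minimiser V R \<rho>)" if R: "0 < R" for R
  proof (cases "R < Rs")
    case True
    then show ?thesis using unique[of R R] R Rs(3)[of R] by simp
  next
    case False
    then show ?thesis using unique[of Rs R] Rs(1,2) by simp
  qed
  show ?thesis
  proof (intro exI[of _ Rs] conjI exI[of _ Q] allI impI ballI)
    fix R :: real assume R: "0 < R"
    show "\<exists>!\<rho>. constrained_minimiser V R \<rho>" using minimiser[OF R] by (rule conjunct2)
    show "constrained_minimiser V R
       (if R < Rs
        then density lborel (\<lambda>x. ennreal (P_R V R x / (pi * sqrt (R\<^sup>2 - x\<^sup>2)) * indicator {-R<..<R} x))
        else density lborel (\<lambda>x. ennreal (Q x * sqrt (Rs\<^sup>2 - x\<^sup>2) / pi * indicator {-Rs..Rs} x)))"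
    proof (cases "R < Rs")
      case True
      then show ?thesis using conjunct1[OF minimiser[OF R]] pushed[OF R less_imp_le[OF True]] by (simp only: if_True)
    next
      case False
      then show ?thesis using conjunct1[OF minimiser[OF R]] pulled by (simp only: if_False)
    qed
    fix x assume "R < Rs" "x \<in> {-R..R}"
    then show "0 \<le> P_R V R x" using Rs(3)[OF R] R by (intro P_R_nonneg) auto
  next
    show "0 < Rs" "crit_sum V Rs = 1" using Rs by (simp_all add: crit_sum_eq)
    show "crit_sum V r \<noteq> 1" if "0 < r \<and> r < Rs" for r using Rs(3)[of r] that by (simp add: crit_sum_eq)
  qed (fact lim Q_nonneg)+
qed

end
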